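(* Let $\varphi$ be a continuous Herz--Schur multiplier on a second countable, locally compact group $G$, and let $d$ be a proper, left invariant metric on $G$ satisfying, for some constants $a,b>0$, $$\mu(B_n(e))\leq a\cdot e^{bn}\qquad(n\in\mathbb N),$$ where $\mu$ is a left invariant Haar measure on $G$ and $B_n(e)=\{g\in G : d(g,e)<n\}$ is the open ball of radius $n$ centered at the identity element $e\in G$. Then there exist a strongly continuous representation $(\pi,\mathscr H)$ of $G$ on a Hilbert space $\mathscr H$ and vectors $\xi,\eta\in\mathscr H$ such that $$\varphi(y^{-1}x)=\langle \pi(x)\xi,\pi(y)\eta\rangle\qquad(x,y\in G),$$ with $$\sup_{x\in G}\|\pi(x)\xi\|\leq\sqrt2\,\|\varphi\|_{M_0A(G)}^{1/2}\quad\text{and}\quad \sup_{y\in G}\|\pi(y)\eta\|\leq\sqrt2\,\|\varphi\|_{M_0A(G)}^{1/2}.$$ Moreover, for every fixed $c>b$, $(\pi,\mathscr H)$ (together with such $\xi,\eta$) can be chosen such that $$\|\pi(g)\|\leq e^{\frac{c}{2}d(g,e)}\qquad(g\in G).$$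
   Context: Schur multipliers: for a non-empty set $Y$, a function $\psi:Y\times Y\to\mathbb C$ is a Schur multiplier if for every operator $A=(a_{x,y})_{x,y\in Y}\in B(\ell^2(Y))$ the matrix $(\psi(x,y)a_{x,y})_{x,y\in Y}$ represents an operator $M_\psi A\in B(\ell^2(Y))$; then $M_\psi$ is a bounded operator on $B(\ell^2(Y))$ and $\|\psi\|_S=\|M_\psi\|$. Herz--Schur multipliers: a continuous function $\varphi:G\to\mathbb C$ on a locally compact group $G$ is a (continuous) Herz--Schur multiplier if $\hat\varphi(x,y)=\varphi(y^{-1}x)$ $(x,y\in G)$ is a Schur multiplier on $G\times G$ ($G$ viewed as a set), and its Herz--Schur norm is $\|\varphi\|_{HS}=\|\hat\varphi\|_S$. The norm $\|\cdot\|_{M_0A(G)}$: $M_0A(G)$ is the algebra of completely bounded Fourier multipliers, i.e. continuous $\varphi:G\to\mathbb C$ such that $\lambda(g)\mapsto\varphi(g)\lambda(g)$ ($\lambda$ the left regular representation) extends to a $\sigma$-weakly continuous, completely bounded operator $M_\varphi$ on the group von Neumann algebra of $G$, with $\|\varphi\|_{M_0A(G)}=\|M_\varphi\|_{\mathrm{cb}}$. By a known theorem of Bożejko and Fendler, $M_0A(G)$ coincides isometrically with the continuous Herz--Schur multipliers, so $\|\varphi\|_{M_0A(G)}=\|\varphi\|_{HS}$. Representations: a representation $(\pi,\mathscr H)$ of $G$ on a (complex) Hilbert space $\mathscr H$ is a homomorphism of $G$ into the group of invertible elements of $B(\mathscr H)$ (not assumed unitary or uniformly bounded). It is strongly continuous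 if $g\mapsto\pi(g)$ is continuous for the strong operator topology on $B(\mathscr H)$. Inner products are linear in the first variable. A metric $d$ on $G$ is understood to induce the topology of $G$; it is left invariant if $d(gx,gy)=d(x,y)$ for all $g,x,y\in G$, and proper if closed balls are compact. *)

theory Defs
  imports "HOL-Analysis.Analysis" "HOL-Algebra.Module"
begin

section \<open>Complex Hilbert spaces with explicit carrier\<close>

definition complex_ring :: "complex ring" where
  "complex_ring = \<lparr>carrier = UNIV, mult = (*), one = 1, zero = 0, add = (+)\<rparr>"

text \<open>The fields \<open>mult\<close> and \<open>one\<close> inherited from the ring record are irrelevant for Hilbert spaces.\<close>

record 'a hilbert = "(complex, 'a) module" +
  hinner :: "'a \<Rightarrow> 'a \<Rightarrow> complex"

definition hnorm :: "'a hilbert \<Rightarrow> 'a \<Rightarrow> real" where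
  "hnorm H x = sqrt (Re (hinner H x x))"

definition hdist :: "'a hilbert \<Rightarrow> 'a \<Rightarrow> 'a \<Rightarrow> real" where
  "hdist H x y = hnorm H (x \<ominus>\<^bsub>H\<^esub> y)"

definition norm_topology :: "'a hilbert \<Rightarrow> 'a topology" where
  "norm_topology H = Metric_space.mtopology (carrier H) (hdist H)"

locale hilbert_space = Module.module complex_ring H for H :: "'a hilbert" (structure) +
  assumes hinner_add_left:
      "\<lbrakk>x \<in> carrier H; y \<in> carrier H; z \<in> carrier H\<rbrakk> \<Longrightarrow>
        hinner H (x \<oplus> y) z = hinner H x z + hinner H y z"
    and hinner_smult_left:
      "\<lbrakk>x \<in> carrier H; y \<in> carrier H\<rbrakk> \<Longrightarrow> hinner H (c \<odot> x) y = c * hinner H x y"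
    and hinner_cnj:
      "\<lbrakk>x \<in> carrier H; y \<in> carrier H\<rbrakk> \<Longrightarrow> hinner H y x = cnj (hinner H x y)"
    and hinner_nonneg: "x \<in> carrier H \<Longrightarrow> Re (hinner H x x) \<ge> 0"
    and hinner_definite: "\<lbrakk>x \<in> carrier H; hinner H x x = 0\<rbrakk> \<Longrightarrow> x = \<zero>"
    and complete: "Metric_space.mcomplete (carrier H) (hdist H)"

section \<open>Bounded operators\<close>

text \<open>Operators are extensional functions (\<open>undefined\<close> off the carrier), so that equality of
  operators is equality of functions.\<close>

definition bounded_operators :: "'a hilbert \<Rightarrow> ('a \<Rightarrow> 'a) set" where
  "bounded_operators H = {T \<in> carrier H \<rightarrow>\<^sub>E carrier H.
     (\<forall>x\<in>carrier H. \<forall>y\<in>carrier H. T (x \<oplus>\<^bsub>H\<^esub> y) = T x \<oplus>\<^bsub>H\<^esub> T y) \<and>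
     (\<forall>c. \<forall>x\<in>carrier H. T (c \<odot>\<^bsub>H\<^esub> x) = c \<odot>\<^bsub>H\<^esub> T x) \<and>
     (\<exists>C. \<forall>x\<in>carrier H. hnorm H (T x) \<le> C * hnorm H x)}"

definition op_algebra :: "'a hilbert \<Rightarrow> (complex, 'a \<Rightarrow> 'a) module" where
  "op_algebra H =
    \<lparr>carrier = bounded_operators H,
     mult = compose (carrier H),
     one = (\<lambda>x\<in>carrier H. x),
     zero = (\<lambda>x\<in>carrier H. \<zero>\<^bsub>H\<^esub>),
     add = (\<lambda>S T. \<lambda>x\<in>carrier H. S x \<oplus>\<^bsub>H\<^esub> T x),
     smult = (\<lambda>c T. \<lambda>x\<in>carrier H. c \<odot>\<^bsub>H\<^esub> T x)\<rparr>"

definition op_norm :: "'a hilbert \<Rightarrow> ('a \<Rightarrow> 'a) \<Rightarrow> real" where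
  "op_norm H T = Sup {hnorm H (T x) |x. x \<in> carrier H \<and> hnorm H x \<le> 1}"

definition strong_op_topology :: "'a hilbert \<Rightarrow> ('a \<Rightarrow> 'a) topology" where
  "strong_op_topology H =
     subtopology (product_topology (\<lambda>_. norm_topology H) (carrier H)) (bounded_operators H)"

definition square_summable_seqs :: "'a hilbert \<Rightarrow> (nat \<Rightarrow> 'a) set" where
  "square_summable_seqs H = {\<xi>. range \<xi> \<subseteq> carrier H \<and> summable (\<lambda>k. (hnorm H (\<xi> k))\<^sup>2)}"

text \<open>The \<open>\<sigma>\<close>-weak topology is the initial topology for the functionals
  \<open>T \<mapsto> \<Sum>k. \<langle>T \<xi>\<^sub>k, \<eta>\<^sub>k\<rangle>\<close> with square summable \<open>\<xi>\<close> and \<open>\<eta>\<close>.\<close>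

definition sigma_weak_topology :: "'a hilbert \<Rightarrow> ('a \<Rightarrow> 'a) topology" where
  "sigma_weak_topology H =
    (let I = square_summable_seqs H \<times> square_summable_seqs H in
     pullback_topology (bounded_operators H)
       (\<lambda>T. \<lambda>p\<in>I. \<Sum>k. hinner H (T (fst p k)) (snd p k))
       (product_topology (\<lambda>_. euclidean :: complex topology) I))"

section \<open>Herz--Schur multipliers\<close>

definition ell2 :: "('y \<Rightarrow> complex) hilbert" where
  "ell2 =
    \<lparr>carrier = {f. (\<lambda>y. (cmod (f y))\<^sup>2) summable_on UNIV},
     mult = undefined, one = undefined,
     zero = (\<lambda>_. 0),
     add = (\<lambda>f g y. f y + g y),
     smult = (\<lambda>c f y. c * f y),
     hinner = (\<lambda>f g. \<Sum>\<^sub>\<infinity>y. f y * cnj (g y))\<rparr>"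

definition matrix_entry :: "(('y \<Rightarrow> complex) \<Rightarrow> ('y \<Rightarrow> complex)) \<Rightarrow> 'y \<Rightarrow> 'y \<Rightarrow> complex" where
  "matrix_entry A x y = A (\<lambda>z. if z = y then 1 else 0) x"

definition schur_multiplier :: "('y \<Rightarrow> 'y \<Rightarrow> complex) \<Rightarrow> bool" where
  "schur_multiplier \<psi> \<longleftrightarrow>
    (\<forall>A\<in>bounded_operators ell2. \<exists>B\<in>bounded_operators ell2.
       \<forall>x y. matrix_entry B x y = \<psi> x y * matrix_entry A x y)"

text \<open>Groups are written additively: \<open>group_add\<close> is not assumed commutative, and
  \<open>y\<inverse> x\<close> becomes \<open>- y + x\<close>.\<close>

definition herz_schur_multiplier :: "('g::topological_group_add \<Rightarrow> complex) \<Rightarrow> bool" where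
  "herz_schur_multiplier \<phi> \<longleftrightarrow>
     continuous_on UNIV \<phi> \<and> schur_multiplier (\<lambda>x y. \<phi> (- y + x))"

section \<open>Haar measure and the group von Neumann algebra\<close>

text \<open>On second countable locally compact groups, regularity is automatic for Borel measures that
  are finite on compact sets.\<close>

definition left_haar_measure :: "('g::topological_group_add) measure \<Rightarrow> bool" where
  "left_haar_measure \<mu> \<longleftrightarrow>
     sets \<mu> = sets borel \<and>
     (\<forall>g. \<forall>A\<in>sets borel. emeasure \<mu> ((+) g ` A) = emeasure \<mu> A) \<and>
     (\<forall>K. compact K \<longrightarrow> emeasure \<mu> K < \<infinity>) \<and>
     emeasure \<mu> UNIV \<noteq> 0"

definition square_integrable :: "'x measure \<Rightarrow> ('x \<Rightarrow> complex) set" where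
  "square_integrable M = {f \<in> borel_measurable M. integrable M (\<lambda>x. (cmod (f x))\<^sup>2)}"

definition ae_class :: "'x measure \<Rightarrow> ('x \<Rightarrow> complex) \<Rightarrow> ('x \<Rightarrow> complex) set" where
  "ae_class M f = {h \<in> borel_measurable M. AE x in M. h x = f x}"

definition rep :: "('x \<Rightarrow> complex) set \<Rightarrow> 'x \<Rightarrow> complex" where
  "rep F = (SOME f. f \<in> F)"

definition L2 :: "'x measure \<Rightarrow> ('x \<Rightarrow> complex) set hilbert" where
  "L2 M =
    \<lparr>carrier = ae_class M ` square_integrable M,
     mult = undefined, one = undefined,
     zero = ae_class M (\<lambda>_. 0),
     add = (\<lambda>F G. ae_class M (\<lambda>x. rep F x + rep G x)),
     smult = (\<lambda>c F. ae_class M (\<lambda>x. c * rep F x)),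
     hinner = (\<lambda>F G. \<integral>x. rep F x * cnj (rep G x) \<partial>M)\<rparr>"

definition left_regular ::
  "('g::topological_group_add) measure \<Rightarrow> 'g \<Rightarrow> ('g \<Rightarrow> complex) set \<Rightarrow> ('g \<Rightarrow> complex) set" where
  "left_regular \<mu> g = (\<lambda>F\<in>carrier (L2 \<mu>). ae_class \<mu> (\<lambda>x. rep F (- g + x)))"

text \<open>The von Neumann algebra generated by the left regular representation: the \<open>\<sigma>\<close>-weak
  closure of the linear span of its range.\<close>

definition group_vN ::
  "('g::topological_group_add) measure \<Rightarrow> (('g \<Rightarrow> complex) set \<Rightarrow> ('g \<Rightarrow> complex) set) set" where
  "group_vN \<mu> = sigma_weak_topology (L2 \<mu>) closure_of
     {finsum (op_algebra (L2 \<mu>)) (\<lambda>g. c g \<odot>\<^bsub>op_algebra (L2 \<mu>)\<^esub> left_regular \<mu> g) F |c F. finite F}"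

section \<open>Completely bounded Fourier multipliers\<close>

text \<open>Norm of an \<open>n \<times> n\<close> matrix of operators on \<open>H\<close>, acting on the \<open>n\<close>-fold Hilbert sum
  of \<open>H\<close>.\<close>

definition matrix_op_norm :: "'a hilbert \<Rightarrow> nat \<Rightarrow> (nat \<Rightarrow> nat \<Rightarrow> 'a \<Rightarrow> 'a) \<Rightarrow> real" where
  "matrix_op_norm H n A =
    Sup {sqrt (\<Sum>i<n. (hnorm H (finsum H (\<lambda>j. A i j (\<xi> j)) {..<n}))\<^sup>2) |\<xi>.
           (\<forall>j<n. \<xi> j \<in> carrier H) \<and> (\<Sum>j<n. (hnorm H (\<xi> j))\<^sup>2) \<le> 1}"

definition linear_on_ops :: "'a hilbert \<Rightarrow> ('a \<Rightarrow> 'a) set \<Rightarrow> (('a \<Rightarrow> 'a) \<Rightarrow> 'a \<Rightarrow> 'a) \<Rightarrow> bool" where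
  "linear_on_ops H V \<Phi> \<longleftrightarrow>
    (\<forall>S\<in>V. \<forall>T\<in>V. \<Phi> (S \<oplus>\<^bsub>op_algebra H\<^esub> T) = \<Phi> S \<oplus>\<^bsub>op_algebra H\<^esub> \<Phi> T) \<and>
    (\<forall>c. \<forall>T\<in>V. \<Phi> (c \<odot>\<^bsub>op_algebra H\<^esub> T) = c \<odot>\<^bsub>op_algebra H\<^esub> \<Phi> T)"

definition completely_bounded ::
  "'a hilbert \<Rightarrow> ('a \<Rightarrow> 'a) set \<Rightarrow> (('a \<Rightarrow> 'a) \<Rightarrow> 'a \<Rightarrow> 'a) \<Rightarrow> bool" where
  "completely_bounded H V \<Phi> \<longleftrightarrow>
    linear_on_ops H V \<Phi> \<and>
    (\<exists>C. \<forall>n A. (\<forall>i<n. \<forall>j<n. A i j \<in> V) \<longrightarrow>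
       matrix_op_norm H n (\<lambda>i j. \<Phi> (A i j)) \<le> C * matrix_op_norm H n A)"

definition cb_norm :: "'a hilbert \<Rightarrow> ('a \<Rightarrow> 'a) set \<Rightarrow> (('a \<Rightarrow> 'a) \<Rightarrow> 'a \<Rightarrow> 'a) \<Rightarrow> real" where
  "cb_norm H V \<Phi> =
    Sup {matrix_op_norm H n (\<lambda>i j. \<Phi> (A i j)) |n A.
           (\<forall>i<n. \<forall>j<n. A i j \<in> V) \<and> matrix_op_norm H n A \<le> 1}"

definition fourier_multiplier_map ::
  "('g::topological_group_add) measure \<Rightarrow> ('g \<Rightarrow> complex) \<Rightarrow>
   ((('g \<Rightarrow> complex) set \<Rightarrow> ('g \<Rightarrow> complex) set) \<Rightarrow> (('g \<Rightarrow> complex) set \<Rightarrow> ('g \<Rightarrow> complex) set)) \<Rightarrow>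
   bool" where
  "fourier_multiplier_map \<mu> \<phi> \<Phi> \<longleftrightarrow>
    \<Phi> \<in> group_vN \<mu> \<rightarrow> group_vN \<mu> \<and>
    completely_bounded (L2 \<mu>) (group_vN \<mu>) \<Phi> \<and>
    continuous_map (subtopology (sigma_weak_topology (L2 \<mu>)) (group_vN \<mu>))
      (subtopology (sigma_weak_topology (L2 \<mu>)) (group_vN \<mu>)) \<Phi> \<and>
    (\<forall>g. \<Phi> (left_regular \<mu> g) = \<phi> g \<odot>\<^bsub>op_algebra (L2 \<mu>)\<^esub> left_regular \<mu> g)"

text \<open>The map \<open>\<Phi>\<close> is unique on the group von Neumann algebra by \<open>\<sigma>\<close>-weak density, so the
  choice is immaterial. It exists for every continuous Herz--Schur multiplier (Bozejko--Fendler);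
  for other \<open>\<phi>\<close> the value is meaningless. It does not depend on the normalisation
  of \<open>\<mu>\<close>.\<close>

definition M0A_norm :: "('g::topological_group_add) measure \<Rightarrow> ('g \<Rightarrow> complex) \<Rightarrow> real" where
  "M0A_norm \<mu> \<phi> = cb_norm (L2 \<mu>) (group_vN \<mu>) (SOME \<Phi>. fourier_multiplier_map \<mu> \<phi> \<Phi>)"

section \<open>Representations\<close>

text \<open>Existence of a Hilbert space is stated over carriers in the type
  \<open>('g \<times> nat \<Rightarrow> complex) set\<close>, since types cannot be quantified existentially. It holds a copy
  of every separable Hilbert space, and \<open>L\<^sup>2(G; \<ell>\<^sup>2)\<close> as classes of functions on \<open>G \<times> \<nat>\<close>.\<close>

definition add_group :: "('g::group_add) monoid" where
  "add_group = \<lparr>carrier = UNIV, mult = (+), one = 0\<rparr>"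

definition strongly_continuous_rep ::
  "'a hilbert \<Rightarrow> ('g::topological_group_add \<Rightarrow> 'a \<Rightarrow> 'a) \<Rightarrow> bool" where
  "strongly_continuous_rep H \<pi> \<longleftrightarrow>
     \<pi> \<in> hom add_group (units_of (op_algebra H)) \<and>
     continuous_map euclidean (strong_op_topology H) \<pi>"

end

theory Submission
  imports Defs
begin

text \<open>
  The values of a Herz--Schur multiplier \<open>\<phi>\<close> are inner products: \<open>\<phi>(y\<inverse>x) = \<langle>P x, Q y\<rangle>\<close> for
  bounded maps \<open>P\<close>, \<open>Q\<close> into a Hilbert space. There is in general no bounded operator that moves
  every \<open>P x\<close> to \<open>P(hx)\<close>. Averaging over the group supplies one. Given a probability measure
  \<open>\<nu>\<close> on \<open>G\<close>, consider in \<open>L\<^sup>2(\<nu>; \<ell>\<^sup>2)\<close> the functions \<open>\<xi>\<^sub>x(g) = P(g\<inverse>x)\<close> and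
  \<open>\<eta>\<^sub>y(g) = Q(g\<inverse>y)\<close>. As \<open>(g\<inverse>y)\<inverse>(g\<inverse>x) = y\<inverse>x\<close>, the inner product of \<open>\<xi>\<^sub>x\<close> and \<open>\<eta>\<^sub>y\<close> is
  again \<open>\<phi>(y\<inverse>x)\<close>, and the norms are still bounded by those of \<open>P\<close> and \<open>Q\<close>. But now left
  translation by \<open>h\<close> carries \<open>\<xi>\<^sub>x\<close> to \<open>\<xi>\<^bsub>hx\<^esub>\<close>, and it is bounded as soon as \<open>\<nu>(hA)\<close> is
  dominated by a multiple of \<open>\<nu>(A)\<close>. The measure with density proportional to
  \<open>exp(-c d(g,e))\<close> has this property with the factor \<open>exp(c d(h,e))\<close>, by the triangle
  inequality and left invariance of \<open>d\<close>; it is finite for \<open>c > b\<close> by the growth condition.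
  The square root of that factor is the bound on the norm of the representation
  (\<open>representation_from_factorization\<close>). Strong continuity is obtained by passing to the closed
  invariant subspace of vectors with continuous orbits, which contains both functions.

  The factorization has to come with coordinates that are continuous functions on \<open>G\<close>, and with
  the bound \<open>\<parallel>\<phi>\<parallel>\<close> (the completely bounded norm) on \<open>\<parallel>P x\<parallel>\<^sup>2\<close> and \<open>\<parallel>Q y\<parallel>\<^sup>2\<close>. Let \<open>\<psi>\<close> be a function
  of two variables such that entrywise multiplication by \<open>\<psi>\<close> has norm at most \<open>C\<close> on all finite
  matrices. A duality argument, carried out as the minimisation of a convex function on a compact
  set of kernels, shows that \<open>\<psi>\<close> is the off-diagonal block of a positive definite kernel with
  diagonal at most \<open>C\<close> (\<open>schur_bounded_kernel\<close>). Projecting the vectors \<open>P x\<close> to the closed span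
  of the \<open>Q y\<close>, and then the \<open>Q y\<close> to that of the new \<open>P x\<close>, changes no value of \<open>\<psi>\<close>, and
  makes both families weakly continuous if \<open>\<psi>\<close> is separately continuous
  (\<open>schur_bounded_continuous_factorization\<close>).

  That \<open>\<psi>(x,y) = \<phi>(y\<inverse>x)\<close> satisfies the hypothesis with \<open>C = \<parallel>\<phi>\<parallel>\<close> follows by applying the
  multiplier map to matrices with entries \<open>a\<^sub>i\<^sub>j \<lambda>(x\<^sub>i\<inverse>x\<^sub>j)\<close> (\<open>fourier_multiplier_schur_bounded\<close>).
  Before that, the multiplier map must be shown to exist. The definition of a Schur multiplier
  yields some finite bound \<open>C\<close>, by a block diagonal operator made of translated bad matrices
  (\<open>schur_multiplier_schur_bounded\<close>); the resulting factorization with coordinates \<open>p\<^sub>n\<close>, \<open>q\<^sub>n\<close>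
  gives the multiplier map as \<open>T \<mapsto> \<Sum>\<^sub>n b\<^sub>n\<^sup>* T a\<^sub>n\<close>, where \<open>a\<^sub>n\<close> and \<open>b\<^sub>n\<close> are the multiplication
  operators by \<open>p\<^sub>n(x\<inverse>)\<close> and \<open>q\<^sub>n(x\<inverse>)\<close> (\<open>fourier_multiplier_map_exists\<close>).
\<close>

section \<open>Positive definite kernels\<close>

text \<open>Points may occur repeatedly in the families \<open>z\<close>. This allows one to append a point to a
  family without asking whether it is there already.\<close>

definition psd_kernel :: "('z \<Rightarrow> 'z \<Rightarrow> complex) \<Rightarrow> bool" where
  "psd_kernel k \<longleftrightarrow> (\<forall>x y. k y x = cnj (k x y)) \<and>
     (\<forall>(n::nat) z c. 0 \<le> Re (\<Sum>i<n. \<Sum>j<n. c i * cnj (c j) * k (z i) (z j)))"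

lemma psd_kernel_cnj: "psd_kernel k \<Longrightarrow> cnj (k x y) = k y x"
  unfolding psd_kernel_def by metis

lemma psd_kernel_nonneg:
  "psd_kernel k \<Longrightarrow> 0 \<le> Re (\<Sum>i<(n::nat). \<Sum>j<n. c i * cnj (c j) * k (z i) (z j))"
  unfolding psd_kernel_def by blast

lemma psd_kernel_two_points:
  assumes "psd_kernel k"
  shows "0 \<le> (cmod c)\<^sup>2 * Re (k x x) + (cmod d)\<^sup>2 * Re (k y y) + 2 * Re (c * cnj d * k x y)"
proof -
  have "0 \<le> Re (\<Sum>i<(2::nat). \<Sum>j<(2::nat). (\<lambda>i. if i = 0 then c else d) i *
      cnj ((\<lambda>i. if i = 0 then c else d) j) * k ((\<lambda>i. if i = 0 then x else y) i) ((\<lambda>i. if i = 0 then x else y) j))"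
    by (rule psd_kernel_nonneg[OF assms])
  also have "\<dots> = Re (c * cnj c * k x x + c * cnj d * k x y + (d * cnj c * k y x + d * cnj d * k y y))"
    by (simp add: numeral_2_eq_2)
  also have "d * cnj c * k y x = cnj (c * cnj d * k x y)"
    using psd_kernel_cnj[OF assms, of x y] by simp
  also have "Re (c * cnj c * k x x) = (cmod c)\<^sup>2 * Re (k x x)"
    by (simp add: complex_norm_square[symmetric] flip: of_real_power)
  moreover have "Re (d * cnj d * k y y) = (cmod d)\<^sup>2 * Re (k y y)"
    by (simp add: complex_norm_square[symmetric] flip: of_real_power)
  ultimately show ?thesis by (simp add: algebra_simps)
qed

lemma psd_kernel_diag: "psd_kernel k \<Longrightarrow> 0 \<le> Re (k x x)"
  using psd_kernel_two_points[of k 1 x 0 x] by simp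

lemma psd_kernel_diag_of_real: "psd_kernel k \<Longrightarrow> k x x = of_real (Re (k x x))"
  using psd_kernel_cnj[of k x x] by (simp add: complex_eq_iff)

text \<open>The form with coefficients \<open>s\<close> and \<open>k x y\<close> is a nonnegative quadratic polynomial in the
  real number \<open>s\<close>.\<close>

lemma psd_kernel_Cauchy_Schwarz:
  assumes "psd_kernel k"
  shows "(cmod (k x y))\<^sup>2 \<le> Re (k x x) * Re (k y y)"
proof -
  define K where "K = (cmod (k x y))\<^sup>2"
  have *: "0 \<le> s\<^sup>2 * Re (k x x) + K * Re (k y y) + 2 * s * K" for s :: real
  proof -
    have "Re (of_real s * cnj (k x y) * k x y) = s * K"
      using complex_norm_square[of "k x y"] unfolding K_def
      by (metis (no_types, lifting) Re_complex_of_real mult.assoc mult.commute of_real_mult)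
    then show ?thesis
      using psd_kernel_two_points[OF assms, of "of_real s" x "k x y" y] unfolding K_def by simp
  qed
  have K0: "K \<ge> 0" by (simp add: K_def)
  show ?thesis
  proof (cases "Re (k x x) = 0")
    case True
    have "K = 0"
    proof (rule ccontr)
      assume "K \<noteq> 0"
      have "K * Re (k y y) + 2 * (- (Re (k y y) + 1) / 2) * K = - K"
        by (simp add: field_simps)
      then show False using *[of "- (Re (k y y) + 1) / 2"] True K0 \<open>K \<noteq> 0\<close> by simp
    qed
    then show ?thesis using True by (simp add: K_def)
  next
    case False
    then have p: "Re (k x x) > 0" using psd_kernel_diag[OF assms, of x] by simp
    have "0 \<le> (- K / Re (k x x))\<^sup>2 * Re (k x x) + K * Re (k y y) + 2 * (- K / Re (k x x)) * K"
      by (rule *)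
    also have "\<dots> = K * (Re (k x x) * Re (k y y) - K) / Re (k x x)"
      using p by (simp add: field_simps power2_eq_square)
    finally have "0 \<le> K * (Re (k x x) * Re (k y y) - K)"
      using p by (simp add: zero_le_divide_iff)
    then have "K = 0 \<or> K \<le> Re (k x x) * Re (k y y)"
      using K0 by (auto simp: zero_le_mult_iff)
    then show ?thesis using psd_kernel_diag[OF assms] by (auto simp: K_def)
  qed
qed

lemma psd_kernel_bounded:
  assumes "psd_kernel k" "\<And>x. Re (k x x) \<le> R"
  shows "cmod (k x y) \<le> R"
proof -
  have "(cmod (k x y))\<^sup>2 \<le> R * R"
    using psd_kernel_Cauchy_Schwarz[OF assms(1), of x y] assms psd_kernel_diag[OF assms(1)]
    by (meson mult_mono order_trans)
  moreover have "0 \<le> R" using assms psd_kernel_diag[OF assms(1)] by (meson order_trans)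
  ultimately show ?thesis by (metis power2_eq_square power2_le_imp_le)
qed

lemma psd_kernel_zero: "psd_kernel (\<lambda>x y. 0)"
  by (simp add: psd_kernel_def)

lemma psd_kernel_add: "psd_kernel k \<Longrightarrow> psd_kernel l \<Longrightarrow> psd_kernel (\<lambda>x y. k x y + l x y)"
proof -
  assume k: "psd_kernel k" and l: "psd_kernel l"
  have "0 \<le> Re (\<Sum>i<n. \<Sum>j<n. c i * cnj (c j) * (k (z i) (z j) + l (z i) (z j)))" for n :: nat and c z
    using psd_kernel_nonneg[OF k, of c z n] psd_kernel_nonneg[OF l, of c z n]
    by (simp add: distrib_left sum.distrib)
  then show ?thesis
    unfolding psd_kernel_def using psd_kernel_cnj[OF k] psd_kernel_cnj[OF l] by simp
qed

lemma psd_kernel_scale: "psd_kernel k \<Longrightarrow> 0 \<le> t \<Longrightarrow> psd_kernel (\<lambda>x y. of_real t * k x y)"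
proof -
  assume k: "psd_kernel k" and t: "0 \<le> t"
  have "(\<Sum>i<n. \<Sum>j<n. c i * cnj (c j) * (of_real t * k (z i) (z j))) =
     of_real t * (\<Sum>i<n. \<Sum>j<n. c i * cnj (c j) * k (z i) (z j))" for n :: nat and c z
    by (simp add: sum_distrib_left mult_ac)
  then have "0 \<le> Re (\<Sum>i<n. \<Sum>j<n. c i * cnj (c j) * (of_real t * k (z i) (z j)))" for n :: nat and c z
    using psd_kernel_nonneg[OF k, of c z n] t by (simp only:) simp
  moreover have "of_real t * k y x = cnj (of_real t * k x y)" for x y
    using psd_kernel_cnj[OF k, of x y] by simp
  ultimately show ?thesis unfolding psd_kernel_def by blast
qed

lemma psd_kernel_rank_one: "psd_kernel (\<lambda>x y. f x * cnj (f y))"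
proof -
  have "(\<Sum>i<n. \<Sum>j<n. c i * cnj (c j) * (f (z i) * cnj (f (z j)))) =
     (\<Sum>i<n. c i * f (z i)) * cnj (\<Sum>i<n. c i * f (z i))" for n :: nat and c z
    by (simp add: sum_product mult_ac)
  then have "(\<Sum>i<n. \<Sum>j<n. c i * cnj (c j) * (f (z i) * cnj (f (z j)))) =
     of_real ((cmod (\<Sum>i<n. c i * f (z i)))\<^sup>2)" for n :: nat and c z
    by (simp only: complex_norm_square)
  then show ?thesis unfolding psd_kernel_def by simp
qed

lemma psd_kernel_restrict:
  assumes "psd_kernel k"
  shows "psd_kernel (\<lambda>x y. if x \<in> S \<and> y \<in> S then k x y else 0)"
proof -
  have "c i * cnj (c j) * (if z i \<in> S \<and> z j \<in> S then k (z i) (z j) else 0) =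
     (if z i \<in> S then c i else 0) * cnj (if z j \<in> S then c j else 0) * k (z i) (z j)" for c z and i j :: nat
    by auto
  then show ?thesis
    using psd_kernel_nonneg[OF assms] psd_kernel_cnj[OF assms] unfolding psd_kernel_def by simp
qed

lemma continuous_on_kernel_entry: "continuous_on A (\<lambda>k::'z \<Rightarrow> 'z \<Rightarrow> complex. k x y)"
proof -
  have "continuous_on A (\<lambda>k::'z \<Rightarrow> 'z \<Rightarrow> complex. k)" by (rule continuous_on_id)
  then have "continuous_on A (\<lambda>k::'z \<Rightarrow> 'z \<Rightarrow> complex. k x)"
    by (rule continuous_on_product_then_coordinatewise)
  then show ?thesis by (rule continuous_on_product_then_coordinatewise)
qed

lemma closed_psd_kernel: "closed {k. psd_kernel k}"
proof -
  have "continuous_on UNIV (\<lambda>k::'a \<Rightarrow> 'a \<Rightarrow> complex.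
      Re (\<Sum>i<n. \<Sum>j<n. c i * cnj (c j) * k (z i) (z j)))" for n :: nat and c z
    by (rule continuous_on_Re, rule continuous_on_sum, rule continuous_on_sum,
        rule continuous_on_mult, rule continuous_on_const, rule continuous_on_kernel_entry)
  moreover have "continuous_on UNIV (\<lambda>k::'a \<Rightarrow> 'a \<Rightarrow> complex. cnj (k x y))" for x y
    by (rule continuous_on_cnj, rule continuous_on_kernel_entry)
  ultimately have "closed {k::'a \<Rightarrow> 'a \<Rightarrow> complex. k y x = cnj (k x y)}"
    "closed {k::'a \<Rightarrow> 'a \<Rightarrow> complex. 0 \<le> Re (\<Sum>i<n. \<Sum>j<n. c i * cnj (c j) * k (z i) (z j))}"
    for x y and n :: nat and c z
    by (simp_all only: closed_Collect_eq continuous_on_kernel_entry closed_Collect_le continuous_on_const)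
  then show ?thesis
    unfolding psd_kernel_def by (simp only: closed_Collect_conj closed_Collect_all)
qed

text \<open>Tychonoff's theorem: the diagonal bounds all entries.\<close>

lemma compact_psd_kernel: "compact {k::'z \<Rightarrow> 'z \<Rightarrow> complex. psd_kernel k \<and> (\<forall>x. Re (k x x) \<le> R)}"
proof -
  have c1: "compact (PiE UNIV (\<lambda>_::'z. S))" if "compact S" for S :: "'a::topological_space set"
  proof -
    have "compactin (product_topology (\<lambda>_. euclidean) UNIV) (PiE UNIV (\<lambda>_::'z. S))"
      by (rule compactin_PiE[THEN iffD2]) (simp only: compactin_euclidean_iff that simp_thms ball_simps)
    then show ?thesis by (simp only: euclidean_product_topology compactin_euclidean_iff)
  qed
  have "compact (PiE UNIV (\<lambda>_::'z. PiE UNIV (\<lambda>_::'z. cball (0::complex) R)))"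
    by (intro c1 compact_cball)
  moreover have "closed {k::'z \<Rightarrow> 'z \<Rightarrow> complex. psd_kernel k \<and> (\<forall>x. Re (k x x) \<le> R)}"
    by (simp only: closed_Collect_conj closed_psd_kernel closed_Collect_all closed_Collect_le
      continuous_on_const continuous_on_Re continuous_on_kernel_entry)
  ultimately have "compact ((PiE UNIV (\<lambda>_::'z. PiE UNIV (\<lambda>_::'z. cball (0::complex) R))) \<inter>
     {k::'z \<Rightarrow> 'z \<Rightarrow> complex. psd_kernel k \<and> (\<forall>x. Re (k x x) \<le> R)})"
    by (rule compact_Int_closed)
  moreover have "{k::'z \<Rightarrow> 'z \<Rightarrow> complex. psd_kernel k \<and> (\<forall>x. Re (k x x) \<le> R)} \<subseteq>
     PiE UNIV (\<lambda>_::'z. PiE UNIV (\<lambda>_::'z. cball (0::complex) R))"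
    by (auto simp: psd_kernel_bounded)
  ultimately show ?thesis by (simp add: Int_absorb1)
qed

section \<open>Bounded Schur multiplication of finite matrices\<close>

text \<open>With a bilinear form in place of a sesquilinear one the condition is visibly invariant under
  transposition. The spectral norm is the same, as \<open>v\<close> may be conjugated.\<close>

definition contraction_on :: "'x set \<Rightarrow> ('x \<Rightarrow> 'x \<Rightarrow> complex) \<Rightarrow> bool" where
  "contraction_on F a \<longleftrightarrow>
    (\<forall>u v. cmod (\<Sum>x\<in>F. \<Sum>y\<in>F. a x y * u x * v y)
       \<le> L2_set (\<lambda>x. cmod (u x)) F * L2_set (\<lambda>y. cmod (v y)) F)"

text \<open>The least such \<open>C\<close> is the norm of entrywise multiplication by \<open>\<psi>\<close> on matrices with
  finite index sets and the spectral norm.\<close>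

definition schur_bounded :: "('x \<Rightarrow> 'x \<Rightarrow> complex) \<Rightarrow> real \<Rightarrow> bool" where
  "schur_bounded \<psi> C \<longleftrightarrow>
    (\<forall>F a u v. finite F \<longrightarrow> contraction_on F a \<longrightarrow>
       cmod (\<Sum>x\<in>F. \<Sum>y\<in>F. \<psi> x y * a x y * u x * v y)
         \<le> C * (L2_set (\<lambda>x. cmod (u x)) F * L2_set (\<lambda>y. cmod (v y)) F))"

lemma L2_set_power2: "(L2_set f A)\<^sup>2 = (\<Sum>i\<in>A. (f i)\<^sup>2)"
  by (simp add: L2_set_def sum_nonneg)

lemma contraction_onI_quadratic:
  assumes F: "finite F"
    and q: "\<And>u v. 2 * cmod (\<Sum>x\<in>F. \<Sum>y\<in>F. a x y * u x * v y)
       \<le> (\<Sum>x\<in>F. (cmod (u x))\<^sup>2) + (\<Sum>y\<in>F. (cmod (v y))\<^sup>2)"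
  shows "contraction_on F a"
  unfolding contraction_on_def
proof (intro allI)
  fix u v :: "'a \<Rightarrow> complex"
  define U V where "U = L2_set (\<lambda>x. cmod (u x)) F" and "V = L2_set (\<lambda>y. cmod (v y)) F"
  have U0: "U \<ge> 0" and V0: "V \<ge> 0" by (simp_all add: U_def V_def L2_set_nonneg)
  show "cmod (\<Sum>x\<in>F. \<Sum>y\<in>F. a x y * u x * v y) \<le> U * V"
  proof (cases "U = 0 \<or> V = 0")
    case True
    then have "(\<forall>x\<in>F. u x = 0) \<or> (\<forall>y\<in>F. v y = 0)"
      using F by (simp add: U_def V_def L2_set_eq_0_iff)
    then have "(\<Sum>x\<in>F. \<Sum>y\<in>F. a x y * u x * v y) = 0" by auto
    then show ?thesis using U0 V0 by simp
  next
    case False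
    then have UV: "U > 0" "V > 0" using U0 V0 by auto
    let ?u = "\<lambda>x. u x / of_real U" and ?v = "\<lambda>y. v y / of_real V"
    have "(\<Sum>x\<in>F. (cmod (?u x))\<^sup>2) = (\<Sum>x\<in>F. (cmod (u x))\<^sup>2) / U\<^sup>2"
      by (simp add: norm_divide power_divide sum_divide_distrib)
    also have "\<dots> = 1" using UV by (simp add: U_def flip: L2_set_power2)
    finally have 1: "(\<Sum>x\<in>F. (cmod (?u x))\<^sup>2) = 1" .
    have "(\<Sum>x\<in>F. (cmod (?v x))\<^sup>2) = (\<Sum>x\<in>F. (cmod (v x))\<^sup>2) / V\<^sup>2"
      by (simp add: norm_divide power_divide sum_divide_distrib)
    also have "\<dots> = 1" using UV by (simp add: V_def flip: L2_set_power2)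
    finally have 2: "(\<Sum>x\<in>F. (cmod (?v x))\<^sup>2) = 1" .
    have "(\<Sum>x\<in>F. \<Sum>y\<in>F. a x y * ?u x * ?v y) = (\<Sum>x\<in>F. \<Sum>y\<in>F. a x y * u x * v y) / of_real (U * V)"
      by (simp add: sum_divide_distrib)
    then have "cmod (\<Sum>x\<in>F. \<Sum>y\<in>F. a x y * ?u x * ?v y) = cmod (\<Sum>x\<in>F. \<Sum>y\<in>F. a x y * u x * v y) / (U * V)"
      using UV by (simp only: norm_divide norm_of_real) simp
    with q[of ?u ?v] 1 2 have "cmod (\<Sum>x\<in>F. \<Sum>y\<in>F. a x y * u x * v y) / (U * V) \<le> 1" by simp
    then show ?thesis using UV by (simp add: divide_le_eq)
  qed
qed

text \<open>The penalty \<open>s \<mapsto> max(0,s)\<^sup>2\<close> lies below the quadratic polynomial that agrees with it to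
  first order at \<open>a\<close>; so minimality can be exploited without differentiating it.\<close>

lemma max_zero_add_power2_le: "(max 0 (a + b))\<^sup>2 \<le> (max 0 a + b)\<^sup>2" for a b :: real
proof (cases "a + b \<le> 0")
  case False
  then have "\<bar>a + b\<bar> \<le> \<bar>max 0 a + b\<bar>" by (simp add: max_def)
  then show ?thesis using False by (simp add: abs_le_square_iff max_def)
qed simp

lemma nonneg_of_quadratic_bound:
  fixes L Q t0 :: real
  assumes t0: "t0 > 0" and Q: "Q \<ge> 0"
    and le: "\<And>t. 0 < t \<Longrightarrow> t \<le> t0 \<Longrightarrow> 0 \<le> 2 * t * L + t\<^sup>2 * Q"
  shows "0 \<le> L"
proof (rule ccontr)
  assume "\<not> 0 \<le> L"
  then have L: "L < 0" by simp
  define t where "t = min t0 (- L / (Q + 1))"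
  have t: "0 < t" "t \<le> t0" using t0 L Q by (auto simp: t_def divide_pos_pos divide_neg_pos)
  have "t * (Q + 1) \<le> - L"
  proof -
    have "t \<le> - L / (Q + 1)" by (simp add: t_def)
    then show ?thesis using Q by (simp only: pos_le_divide_eq)
  qed
  then have "t * (2 * L + t * Q) < 0" using t L by (intro mult_pos_neg) (auto simp: algebra_simps)
  with le[OF t] show False by (simp add: power2_eq_square algebra_simps)
qed

lemma sum_Times_bool:
  fixes f :: "'x \<times> bool \<Rightarrow> 'c::comm_monoid_add"
  shows "(\<Sum>z\<in>F \<times> UNIV. f z) = (\<Sum>x\<in>F. f (x, True)) + (\<Sum>x\<in>F. f (x, False))"
proof -
  have "(\<Sum>z\<in>F \<times> UNIV. f z) = (\<Sum>x\<in>F. \<Sum>b\<in>UNIV. f (x, b))"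
    by (simp add: sum.cartesian_product)
  then show ?thesis by (simp add: UNIV_bool sum.distrib add.commute)
qed

lemma cmod_add_scaled_power2:
  "(cmod (A + of_real t * N))\<^sup>2 = (cmod A)\<^sup>2 + 2 * t * Re (cnj A * N) + t\<^sup>2 * (cmod N)\<^sup>2"
  by (simp only: cmod_power2) (simp add: power2_eq_square algebra_simps)

text \<open>Minimise the squared distance of the off-diagonal block to \<open>\<psi>\<close>, plus a penalty for diagonal
  entries above \<open>C\<close>. Let \<open>A\<close> be the residual of the block at a minimum and \<open>s\<close> the vector of
  diagonal excesses. Adding small rank one kernels does not decrease the functional, which says
  that \<open>A/2\<close>, divided by \<open>\<surd>s\<close> on both sides, is a contraction. The hypothesis on
  \<open>\<psi>\<close>, tested at the vectors \<open>\<surd>s\<close>, bounds the pairing of \<open>\<psi>\<close> with \<open>A\<close> by \<open>C\<Sum>s\<close>.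
  Shrinking the minimiser towards zero does not decrease the functional either, and the two
  inequalities together leave \<open>\<Sum>|A|\<^sup>2 + \<Sum>s\<^sup>2 \<le> 0\<close>.\<close>

lemma schur_bounded_kernel_on_finite:
  fixes \<psi> :: "'x \<Rightarrow> 'x \<Rightarrow> complex"
  assumes sb: "schur_bounded \<psi> C" and C: "C \<ge> 0" and F: "finite F"
  shows "\<exists>k. psd_kernel k \<and> (\<forall>z. Re (k z z) \<le> C) \<and>
           (\<forall>x\<in>F. \<forall>y\<in>F. k (x, True) (y, False) = \<psi> x y)"
proof -
  define Z where "Z = F \<times> (UNIV :: bool set)"
  have Z: "finite Z" using F by (simp add: Z_def)
  define J where "J k = (\<Sum>x\<in>F. \<Sum>y\<in>F. (cmod (k (x, True) (y, False) - \<psi> x y))\<^sup>2)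
      + (\<Sum>z\<in>Z. (max 0 (Re (k z z) - C))\<^sup>2)" for k :: "'x \<times> bool \<Rightarrow> 'x \<times> bool \<Rightarrow> complex"
  define J0 where "J0 = J (\<lambda>_ _. 0)"
  have J_nonneg: "0 \<le> J k" for k unfolding J_def by (intro add_nonneg_nonneg sum_nonneg) auto
  define R where "R = C + sqrt J0 + 1"
  define E where "E = {k :: 'x \<times> bool \<Rightarrow> 'x \<times> bool \<Rightarrow> complex. psd_kernel k \<and> (\<forall>z. Re (k z z) \<le> R)}"
  have R0: "0 \<le> R" using C J_nonneg by (simp add: R_def J0_def)
  have zE: "(\<lambda>_ _. 0) \<in> E" using R0 by (simp add: E_def psd_kernel_zero)
  have "continuous_on E J"
    unfolding J_def
    by (intro continuous_on_add continuous_on_sum continuous_on_power continuous_on_norm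
        continuous_on_diff continuous_on_max continuous_on_const continuous_on_Re continuous_on_kernel_entry)
  then obtain m where m: "m \<in> E" and min: "\<And>k. k \<in> E \<Longrightarrow> J m \<le> J k"
    using continuous_attains_inf[of E J] compact_psd_kernel[of R] zE unfolding E_def by blast
  have pm: "psd_kernel m" and mR: "Re (m z z) \<le> R" for z using m unfolding E_def by blast+
  define A where "A x y = m (x, True) (y, False) - \<psi> x y" for x y
  define s where "s z = max 0 (Re (m z z) - C)" for z
  have s0: "s z \<ge> 0" for z by (simp add: s_def)
  have Jm: "J m = (\<Sum>x\<in>F. \<Sum>y\<in>F. (cmod (A x y))\<^sup>2) + (\<Sum>z\<in>Z. (s z)\<^sup>2)"
    by (simp add: J_def A_def s_def)
  have m_diag: "Re (m z z) \<le> C + sqrt J0" if "z \<in> Z" for z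
  proof -
    have "(s z)\<^sup>2 \<le> (\<Sum>z\<in>Z. (s z)\<^sup>2)" by (rule member_le_sum) (use that Z in auto)
    also have "\<dots> \<le> J m" unfolding Jm by (simp add: sum_nonneg)
    also have "\<dots> \<le> J0" unfolding J0_def by (rule min[OF zE])
    finally have "s z \<le> sqrt J0" by (rule real_le_rsqrt)
    then show ?thesis by (simp add: s_def)
  qed
  have variation: "0 \<le> Re (\<Sum>x\<in>F. \<Sum>y\<in>F. cnj (A x y) * N (x, True) (y, False)) + (\<Sum>z\<in>Z. s z * Re (N z z))"
    if t0: "t0 > 0" and NE: "\<And>t. 0 < t \<Longrightarrow> t \<le> t0 \<Longrightarrow> (\<lambda>z w. m z w + of_real t * N z w) \<in> E" for N t0
  proof (rule nonneg_of_quadratic_bound[OF t0])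
    let ?Q = "(\<Sum>x\<in>F. \<Sum>y\<in>F. (cmod (N (x, True) (y, False)))\<^sup>2) + (\<Sum>z\<in>Z. (Re (N z z))\<^sup>2)"
    show "0 \<le> ?Q" by (intro add_nonneg_nonneg sum_nonneg) auto
    fix t assume t: "0 < t" "t \<le> t0"
    have "J m \<le> J (\<lambda>z w. m z w + of_real t * N z w)" by (rule min[OF NE[OF t]])
    also have "\<dots> = (\<Sum>x\<in>F. \<Sum>y\<in>F. (cmod (A x y + of_real t * N (x, True) (y, False)))\<^sup>2)
        + (\<Sum>z\<in>Z. (max 0 (Re (m z z) - C + t * Re (N z z)))\<^sup>2)"
      unfolding J_def A_def by (simp add: algebra_simps)
    also have "\<dots> \<le> (\<Sum>x\<in>F. \<Sum>y\<in>F. (cmod (A x y + of_real t * N (x, True) (y, False)))\<^sup>2)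
        + (\<Sum>z\<in>Z. (s z + t * Re (N z z))\<^sup>2)"
      unfolding s_def by (intro add_left_mono sum_mono max_zero_add_power2_le)
    also have "\<dots> = (\<Sum>x\<in>F. \<Sum>y\<in>F. (cmod (A x y))\<^sup>2 + 2 * t * Re (cnj (A x y) * N (x, True) (y, False))
          + t\<^sup>2 * (cmod (N (x, True) (y, False)))\<^sup>2)
        + (\<Sum>z\<in>Z. (s z)\<^sup>2 + 2 * t * (s z * Re (N z z)) + t\<^sup>2 * (Re (N z z))\<^sup>2)"
      by (simp only: cmod_add_scaled_power2) (simp add: power2_eq_square algebra_simps)
    also have "\<dots> = J m + 2 * t * (Re (\<Sum>x\<in>F. \<Sum>y\<in>F. cnj (A x y) * N (x, True) (y, False))
        + (\<Sum>z\<in>Z. s z * Re (N z z))) + t\<^sup>2 * ?Q"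
      unfolding Jm Re_sum sum.distrib by (simp only: sum_distrib_left distrib_left add_ac)
    finally show "0 \<le> 2 * t * (Re (\<Sum>x\<in>F. \<Sum>y\<in>F. cnj (A x y) * N (x, True) (y, False))
        + (\<Sum>z\<in>Z. s z * Re (N z z))) + t\<^sup>2 * ?Q" by simp
  qed
  have radial: "Re (\<Sum>x\<in>F. \<Sum>y\<in>F. cnj (A x y) * m (x, True) (y, False)) + (\<Sum>z\<in>Z. s z * Re (m z z)) \<le> 0"
  proof -
    have "(\<lambda>z w. m z w + of_real t * (- m z w)) \<in> E" if "0 < t" "t \<le> 1" for t
    proof -
      have "(\<lambda>z w. m z w + of_real t * (- m z w)) = (\<lambda>z w. of_real (1 - t) * m z w)"
        by (simp add: algebra_simps fun_eq_iff)
      moreover have "(1 - t) * Re (m z z) \<le> R" for z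
      proof -
        have "(1 - t) * Re (m z z) \<le> 1 * Re (m z z)"
          using that psd_kernel_diag[OF pm] by (intro mult_right_mono) auto
        then show ?thesis using mR[of z] by simp
      qed
      ultimately show ?thesis using that psd_kernel_scale[OF pm, of "1 - t"] by (simp add: E_def)
    qed
    from variation[OF _ this, of 1] show ?thesis by (simp add: sum_negf)
  qed
  have rank_one: "0 \<le> Re (\<Sum>x\<in>F. \<Sum>y\<in>F. cnj (A x y) * (c (x, True) * cnj (c (y, False))))
       + (\<Sum>z\<in>Z. s z * (cmod (c z))\<^sup>2)" for c
  proof -
    define d where "d z = (if z \<in> Z then c z else 0)" for z
    define K where "K = (\<Sum>z\<in>Z. (cmod (c z))\<^sup>2)"
    have K0: "0 \<le> K" by (simp add: K_def sum_nonneg)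
    have NE: "(\<lambda>z w. m z w + of_real t * (d z * cnj (d w))) \<in> E" if t: "0 < t" "t \<le> 1 / (K + 1)" for t
    proof -
      have "Re (m z z + of_real t * (d z * cnj (d z))) \<le> R" for z
      proof (cases "z \<in> Z")
        case True
        have "(cmod (c z))\<^sup>2 \<le> K" unfolding K_def by (rule member_le_sum) (use True Z in auto)
        then have "t * (cmod (c z))\<^sup>2 \<le> 1 / (K + 1) * K" using t K0 by (intro mult_mono) auto
        also have "\<dots> \<le> 1" using K0 by (simp add: field_simps)
        finally have "t * (cmod (c z))\<^sup>2 \<le> 1" .
        moreover have "Re (d z * cnj (d z)) = (cmod (c z))\<^sup>2"
          using True by (simp add: d_def flip: complex_norm_square of_real_power)
        ultimately show ?thesis using m_diag[OF True] by (simp add: R_def)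
      next
        case False then show ?thesis using mR by (simp add: d_def)
      qed
      then show ?thesis
        using t psd_kernel_add[OF pm psd_kernel_scale[OF psd_kernel_rank_one[of d], of t]] by (simp add: E_def)
    qed
    have "0 < 1 / (K + 1)" using K0 by simp
    from variation[OF this NE]
    have "0 \<le> Re (\<Sum>x\<in>F. \<Sum>y\<in>F. cnj (A x y) * (d (x, True) * cnj (d (y, False))))
       + (\<Sum>z\<in>Z. s z * Re (d z * cnj (d z)))" .
    also have "(\<Sum>x\<in>F. \<Sum>y\<in>F. cnj (A x y) * (d (x, True) * cnj (d (y, False)))) =
       (\<Sum>x\<in>F. \<Sum>y\<in>F. cnj (A x y) * (c (x, True) * cnj (c (y, False))))"
      by (intro sum.cong refl) (simp add: d_def Z_def)
    also have "(\<Sum>z\<in>Z. s z * Re (d z * cnj (d z))) = (\<Sum>z\<in>Z. s z * (cmod (c z))\<^sup>2)"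
      by (intro sum.cong refl) (simp add: d_def flip: complex_norm_square of_real_power)
    finally show ?thesis .
  qed
  define S where "S = (\<Sum>z\<in>Z. s z)"
  (* Some s z may vanish; s + e replaces s until e tends to 0. *)
  have perturbed: "cmod (\<Sum>x\<in>F. \<Sum>y\<in>F. \<psi> x y * cnj (A x y)) \<le> C * (S + real (card Z) * e)"
    if e: "e > 0" for e
  proof -
    define r where "r z = sqrt (s z + e)" for z
    have r: "r z > 0" and r2: "(r z)\<^sup>2 = s z + e" for z using s0[of z] e by (simp_all add: r_def)
    define a where "a x y = cnj (A x y) / of_real (2 * r (x, True) * r (y, False))" for x y
    have ca: "contraction_on F a"
    proof (rule contraction_onI_quadratic[OF F])
      fix u v :: "'x \<Rightarrow> complex"
      define B where "B = (\<Sum>x\<in>F. \<Sum>y\<in>F. a x y * u x * v y)"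
      define \<theta> where "\<theta> = - cnj (sgn B)"
      have \<theta>: "cmod \<theta> \<le> 1" "Re (\<theta> * B) = - cmod B"
      proof -
        show "cmod \<theta> \<le> 1" by (simp add: \<theta>_def norm_sgn)
        have "B * cnj B = of_real ((cmod B)\<^sup>2)" by (rule complex_norm_square[symmetric])
        then have "cnj (sgn B) * B = of_real (cmod B)"
          by (cases "B = 0") (simp_all add: sgn_eq power2_eq_square mult.commute)
        then show "Re (\<theta> * B) = - cmod B" by (simp add: \<theta>_def)
      qed
      define c where "c z = (if snd z then \<theta> * u (fst z) else cnj (v (fst z))) / of_real (r z)" for z
      have "(\<Sum>x\<in>F. \<Sum>y\<in>F. cnj (A x y) * (c (x, True) * cnj (c (y, False)))) =
          (\<Sum>x\<in>F. \<Sum>y\<in>F. (2 * \<theta>) * (a x y * u x * v y))"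
        using r by (intro sum.cong refl) (simp add: c_def a_def less_imp_neq[symmetric] field_simps)
      also have "\<dots> = 2 * (\<theta> * B)" by (simp add: B_def sum_distrib_left mult.assoc)
      finally have 1: "Re (\<Sum>x\<in>F. \<Sum>y\<in>F. cnj (A x y) * (c (x, True) * cnj (c (y, False)))) = - 2 * cmod B"
        using \<theta>(2) by simp
      have "s z * (cmod (c z))\<^sup>2 \<le> (cmod (if snd z then u (fst z) else v (fst z)))\<^sup>2" for z
      proof -
        have "(cmod (c z))\<^sup>2 = (cmod (if snd z then \<theta> * u (fst z) else v (fst z)))\<^sup>2 / (s z + e)"
          by (simp add: c_def norm_divide power_divide r2)
        also have "\<dots> \<le> (cmod (if snd z then u (fst z) else v (fst z)))\<^sup>2 / (s z + e)"
          using s0[of z] e \<theta>(1)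
          by (intro divide_right_mono power_mono) (auto simp: norm_mult mult_left_le_one_le)
        finally have "s z * (cmod (c z))\<^sup>2 \<le> s z * ((cmod (if snd z then u (fst z) else v (fst z)))\<^sup>2 / (s z + e))"
          using s0 by (rule mult_left_mono)
        also have "\<dots> = (s z / (s z + e)) * (cmod (if snd z then u (fst z) else v (fst z)))\<^sup>2" by simp
        also have "\<dots> \<le> 1 * (cmod (if snd z then u (fst z) else v (fst z)))\<^sup>2"
          using s0[of z] e by (intro mult_right_mono) auto
        finally show ?thesis by simp
      qed
      then have "(\<Sum>z\<in>Z. s z * (cmod (c z))\<^sup>2) \<le> (\<Sum>z\<in>Z. (cmod (if snd z then u (fst z) else v (fst z)))\<^sup>2)"
        by (rule sum_mono)
      also have "\<dots> = (\<Sum>x\<in>F. (cmod (u x))\<^sup>2) + (\<Sum>y\<in>F. (cmod (v y))\<^sup>2)"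
        unfolding Z_def sum_Times_bool by simp
      finally show "2 * cmod (\<Sum>x\<in>F. \<Sum>y\<in>F. a x y * u x * v y)
          \<le> (\<Sum>x\<in>F. (cmod (u x))\<^sup>2) + (\<Sum>y\<in>F. (cmod (v y))\<^sup>2)"
        using rank_one[of c] 1 by (simp add: B_def)
    qed
    have "cmod (\<Sum>x\<in>F. \<Sum>y\<in>F. \<psi> x y * a x y * of_real (r (x, True)) * of_real (r (y, False)))
       \<le> C * (L2_set (\<lambda>x. cmod (of_real (r (x, True)))) F * L2_set (\<lambda>y. cmod (of_real (r (y, False)))) F)"
      using sb[unfolded schur_bounded_def, rule_format, OF F ca,
          of "\<lambda>x. of_real (r (x, True))" "\<lambda>y. of_real (r (y, False))"] .
    also have "(\<Sum>x\<in>F. \<Sum>y\<in>F. \<psi> x y * a x y * of_real (r (x, True)) * of_real (r (y, False))) =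
       (\<Sum>x\<in>F. \<Sum>y\<in>F. \<psi> x y * cnj (A x y)) / 2"
      unfolding sum_divide_distrib
      using r by (intro sum.cong refl) (simp add: a_def less_imp_neq[symmetric])
    also have "C * (L2_set (\<lambda>x. cmod (of_real (r (x, True)))) F * L2_set (\<lambda>y. cmod (of_real (r (y, False)))) F) \<le>
       C * ((S + real (card Z) * e) / 2)"
    proof (rule mult_left_mono[OF _ C])
      have "(\<Sum>x\<in>F. s (x, True) + e) + (\<Sum>y\<in>F. s (y, False) + e) = S + real (card Z) * e"
        unfolding S_def Z_def sum_Times_bool by (simp add: sum.distrib card_cartesian_product algebra_simps)
      moreover have rL: "L2_set (\<lambda>x. cmod (of_real (r (x, b)))) F = sqrt (\<Sum>x\<in>F. s (x, b) + e)" for b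
        by (simp add: L2_set_def r2)
      moreover have gm: "sqrt p * sqrt q \<le> (p + q) / 2" if "p \<ge> 0" "q \<ge> 0" for p q :: real
        using arith_geo_mean_sqrt[OF that] by (simp add: real_sqrt_mult)
      ultimately show "L2_set (\<lambda>x. cmod (of_real (r (x, True)))) F * L2_set (\<lambda>y. cmod (of_real (r (y, False)))) F
          \<le> (S + real (card Z) * e) / 2"
        unfolding rL using gm[of "\<Sum>x\<in>F. s (x, True) + e" "\<Sum>x\<in>F. s (x, False) + e"] s0 e
        by (simp add: sum_nonneg)
    qed
    finally show ?thesis by (simp add: norm_divide)
  qed
  have "cmod (\<Sum>x\<in>F. \<Sum>y\<in>F. \<psi> x y * cnj (A x y)) \<le> C * S"
  proof (rule field_le_epsilon)
    fix e :: real assume e: "e > 0"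
    define d where "d = e / (C * real (card Z) + 1)"
    have pos: "C * real (card Z) + 1 > 0" using C by (simp add: add_nonneg_pos)
    have "d > 0" using e pos by (simp add: d_def)
    note perturbed[OF this]
    also have "C * (S + real (card Z) * d) = C * S + (C * real (card Z)) * d" by (simp add: algebra_simps)
    also have "(C * real (card Z)) * d \<le> (C * real (card Z) + 1) * d" using \<open>d > 0\<close> by (simp add: algebra_simps)
    also have "(C * real (card Z) + 1) * d = e" using pos by (simp add: d_def)
    finally show "cmod (\<Sum>x\<in>F. \<Sum>y\<in>F. \<psi> x y * cnj (A x y)) \<le> C * S + e" by simp
  qed
  then have dual: "- (C * S) \<le> Re (\<Sum>x\<in>F. \<Sum>y\<in>F. \<psi> x y * cnj (A x y))"
    using abs_Re_le_cmod[of "\<Sum>x\<in>F. \<Sum>y\<in>F. \<psi> x y * cnj (A x y)"] by linarith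
  have "(\<Sum>x\<in>F. \<Sum>y\<in>F. cnj (A x y) * m (x, True) (y, False)) =
      of_real (\<Sum>x\<in>F. \<Sum>y\<in>F. (cmod (A x y))\<^sup>2) + (\<Sum>x\<in>F. \<Sum>y\<in>F. \<psi> x y * cnj (A x y))"
  proof -
    have "cnj (A x y) * m (x, True) (y, False) = of_real ((cmod (A x y))\<^sup>2) + \<psi> x y * cnj (A x y)" for x y
    proof -
      have "m (x, True) (y, False) = A x y + \<psi> x y" by (simp add: A_def)
      then show ?thesis by (simp only: complex_norm_square) (simp add: algebra_simps)
    qed
    then show ?thesis by (simp add: sum.distrib)
  qed
  moreover have "(\<Sum>z\<in>Z. s z * Re (m z z)) = (\<Sum>z\<in>Z. (s z)\<^sup>2) + C * S"
  proof -
    have "s z * Re (m z z) = (s z)\<^sup>2 + C * s z" for z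
      by (auto simp: s_def max_def power2_eq_square algebra_simps)
    then show ?thesis by (simp add: S_def sum.distrib sum_distrib_left)
  qed
  ultimately have "(\<Sum>x\<in>F. \<Sum>y\<in>F. (cmod (A x y))\<^sup>2) + (\<Sum>z\<in>Z. (s z)\<^sup>2) \<le> 0"
    using radial dual by simp
  moreover have "(\<Sum>x\<in>F. \<Sum>y\<in>F. (cmod (A x y))\<^sup>2) \<ge> 0" "(\<Sum>z\<in>Z. (s z)\<^sup>2) \<ge> 0"
    by (simp_all add: sum_nonneg)
  ultimately have "(\<Sum>x\<in>F. \<Sum>y\<in>F. (cmod (A x y))\<^sup>2) = 0" "(\<Sum>z\<in>Z. (s z)\<^sup>2) = 0" by linarith+
  then have "\<forall>x\<in>F. \<forall>y\<in>F. A x y = 0" "\<forall>z\<in>Z. s z = 0"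
    using F Z by (simp_all add: sum_nonneg_eq_0_iff sum_nonneg)
  then have eq: "\<forall>x\<in>F. \<forall>y\<in>F. m (x, True) (y, False) = \<psi> x y" and le: "\<forall>z\<in>Z. Re (m z z) \<le> C"
    by (auto simp: A_def s_def max_def split: if_splits)
  let ?k = "\<lambda>z w. if z \<in> Z \<and> w \<in> Z then m z w else 0"
  have "psd_kernel ?k" by (rule psd_kernel_restrict[OF pm])
  moreover have "Re (?k z z) \<le> C" for z using le C by simp
  moreover have "\<forall>x\<in>F. \<forall>y\<in>F. ?k (x, True) (y, False) = \<psi> x y" using eq by (simp add: Z_def)
  ultimately show ?thesis by blast
qed

text \<open>The finite case and compactness of the set of kernels with diagonal at most \<open>C\<close>.
  A point tagged \<open>True\<close> stands for \<open>P x\<close>, one tagged \<open>False\<close> for \<open>Q y\<close>.\<close>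

theorem schur_bounded_kernel:
  fixes \<psi> :: "'x \<Rightarrow> 'x \<Rightarrow> complex"
  assumes sb: "schur_bounded \<psi> C" and C: "C \<ge> 0"
  obtains k where "psd_kernel k" "\<And>z. Re (k z z) \<le> C" "\<And>x y. k (x, True) (y, False) = \<psi> x y"
proof -
  let ?E = "{k :: 'x \<times> bool \<Rightarrow> 'x \<times> bool \<Rightarrow> complex. psd_kernel k \<and> (\<forall>z. Re (k z z) \<le> C)}"
  define T where "T p = {k :: 'x \<times> bool \<Rightarrow> 'x \<times> bool \<Rightarrow> complex. k (fst p, True) (snd p, False) = \<psi> (fst p) (snd p)}" for p
  have "?E \<inter> (\<Inter>p\<in>UNIV. T p) \<noteq> {}"
  proof (rule compact_imp_fip_image[OF compact_psd_kernel])
    show "closed (T p)" for p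
      unfolding T_def by (rule closed_Collect_eq[OF continuous_on_kernel_entry continuous_on_const])
    fix I :: "('x \<times> 'x) set" assume I: "finite I"
    obtain k where k: "psd_kernel k" "\<forall>z. Re (k z z) \<le> C"
      "\<forall>x\<in>fst ` I \<union> snd ` I. \<forall>y\<in>fst ` I \<union> snd ` I. k (x, True) (y, False) = \<psi> x y"
      using schur_bounded_kernel_on_finite[OF sb C, of "fst ` I \<union> snd ` I"] I by auto
    then have "k \<in> ?E \<inter> (\<Inter>p\<in>I. T p)" by (auto simp: T_def)
    then show "?E \<inter> (\<Inter>p\<in>I. T p) \<noteq> {}" by blast
  qed
  then obtain k where "k \<in> ?E" "\<And>p. k \<in> T p" by blast
  then show ?thesis using that[of k] by (auto simp: T_def)
qed

section \<open>Factorizations with continuous coordinates\<close>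

text \<open>In terms of vectors, \<open>t z\<close> is the component of \<open>z\<close> along the unit vector in direction \<open>v\<close>,
  and the new kernel is the Gram kernel of the components orthogonal to \<open>v\<close>. A null
  vector \<open>v\<close> gives \<open>t = 0\<close>, by division by zero.\<close>

lemma psd_kernel_schur_complement:
  assumes k: "psd_kernel k" and t: "\<And>z. t z = k z v / of_real (sqrt (Re (k v v)))"
  shows "psd_kernel (\<lambda>z w. k z w - t z * cnj (t w))"
    and "k z v - t z * cnj (t v) = 0"
proof -
  define r where "r = Re (k v v)"
  have r0: "r \<ge> 0" using psd_kernel_diag[OF k] by (simp add: r_def)
  have kvv: "k v v = of_real r" using psd_kernel_diag_of_real[OF k, of v] by (simp add: r_def)
  have kz: "k z v = 0" if "r = 0" for z
    using psd_kernel_Cauchy_Schwarz[OF k, of z v] that by (simp add: r_def)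
  have tt: "t z * cnj (t w) = k z v * k v w / of_real r" for z w
  proof -
    have "complex_of_real (sqrt r) * of_real (sqrt r) = of_real r"
      using r0 by (simp flip: of_real_mult)
    then show ?thesis by (simp add: t r_def[symmetric] psd_kernel_cnj[OF k])
  qed
  show "k z v - t z * cnj (t v) = 0"
    unfolding tt kvv using kz[of z] by (cases "r = 0") auto

  have "0 \<le> Re (\<Sum>i<n. \<Sum>j<n. c i * cnj (c j) * (k (z i) (z j) - t (z i) * cnj (t (z j))))"
    for n :: nat and z c
  proof -
    define S where "S = (\<Sum>i<n. c i * k (z i) v)"
    (* Append v with the coefficient that makes the combination orthogonal to v. *)
    define c' where "c' i = (if i = n then - S / of_real r else c i)" for i
    define z' where "z' i = (if i = n then v else z i)" for i
    have S': "cnj S = (\<Sum>i<n. cnj (c i) * k v (z i))"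
      by (simp add: S_def psd_kernel_cnj[OF k])
    have "(\<Sum>i<Suc n. \<Sum>j<Suc n. c' i * cnj (c' j) * k (z' i) (z' j)) =
       (\<Sum>i<n. \<Sum>j<n. c i * cnj (c j) * k (z i) (z j)) + (\<Sum>i<n. c i * cnj (- S / of_real r) * k (z i) v)
       + ((\<Sum>j<n. (- S / of_real r) * cnj (c j) * k v (z j)) + (- S / of_real r) * cnj (- S / of_real r) * k v v)"
      by (simp only: sum.lessThan_Suc sum.distrib) (simp add: c'_def z'_def)
    also have "(\<Sum>i<n. c i * cnj (- S / of_real r) * k (z i) v) = cnj (- S / of_real r) * S"
      unfolding S_def sum_distrib_left by (intro sum.cong refl) (simp add: mult_ac)
    also have "(\<Sum>j<n. (- S / of_real r) * cnj (c j) * k v (z j)) = (- S / of_real r) * cnj S"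
      unfolding S' sum_distrib_left by (intro sum.cong refl) (simp add: mult_ac)
    also have "(\<Sum>i<n. \<Sum>j<n. c i * cnj (c j) * k (z i) (z j)) + cnj (- S / of_real r) * S +
        ((- S / of_real r) * cnj S + (- S / of_real r) * cnj (- S / of_real r) * k v v) =
        (\<Sum>i<n. \<Sum>j<n. c i * cnj (c j) * k (z i) (z j)) - S * cnj S / of_real r"
      by (cases "r = 0") (auto simp: kvv field_simps)
    also have "S * cnj S / of_real r = (\<Sum>i<n. \<Sum>j<n. c i * cnj (c j) * (t (z i) * cnj (t (z j))))"
      unfolding S' unfolding S_def tt sum_product sum_divide_distrib by (intro sum.cong refl) (simp add: mult_ac)
    finally have "(\<Sum>i<Suc n. \<Sum>j<Suc n. c' i * cnj (c' j) * k (z' i) (z' j)) =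
       (\<Sum>i<n. \<Sum>j<n. c i * cnj (c j) * (k (z i) (z j) - t (z i) * cnj (t (z j))))"
      by (simp add: right_diff_distrib sum_subtractf)
    then show ?thesis using psd_kernel_nonneg[OF k, of c' z' "Suc n"] by (simp only:)
  qed
  then show "psd_kernel (\<lambda>z w. k z w - t z * cnj (t w))"
    unfolding psd_kernel_def by (simp add: psd_kernel_cnj[OF k] mult.commute)
qed

text \<open>The Gram kernel after projection to the orthogonal complement of the vectors \<open>v j\<close> with
  \<open>j < n\<close>; the coordinates below refer to the basis that the Gram--Schmidt process makes of \<open>v\<close>.\<close>

fun cholesky_residual :: "('z \<Rightarrow> 'z \<Rightarrow> complex) \<Rightarrow> (nat \<Rightarrow> 'z) \<Rightarrow> nat \<Rightarrow> 'z \<Rightarrow> 'z \<Rightarrow> complex" where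
  "cholesky_residual k v 0 z w = k z w"
| "cholesky_residual k v (Suc n) z w = cholesky_residual k v n z w
     - cholesky_residual k v n z (v n) / of_real (sqrt (Re (cholesky_residual k v n (v n) (v n)))) *
       cnj (cholesky_residual k v n w (v n) / of_real (sqrt (Re (cholesky_residual k v n (v n) (v n)))))"

definition cholesky_coord :: "('z \<Rightarrow> 'z \<Rightarrow> complex) \<Rightarrow> (nat \<Rightarrow> 'z) \<Rightarrow> 'z \<Rightarrow> nat \<Rightarrow> complex" where
  "cholesky_coord k v z n =
     cholesky_residual k v n z (v n) / of_real (sqrt (Re (cholesky_residual k v n (v n) (v n))))"

lemma cholesky_residual_eq:
  "cholesky_residual k v n z w = k z w - (\<Sum>m<n. cholesky_coord k v z m * cnj (cholesky_coord k v w m))"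
  by (induction n) (simp_all add: cholesky_coord_def)

context
  fixes k :: "'z \<Rightarrow> 'z \<Rightarrow> complex" and v :: "nat \<Rightarrow> 'z"
  assumes k: "psd_kernel k"
begin

lemma psd_cholesky_residual: "psd_kernel (cholesky_residual k v n)"
proof (induction n)
  case 0
  have "cholesky_residual k v 0 = k" by (simp add: fun_eq_iff)
  then show ?case using k by simp
next
  case (Suc n)
  have "cholesky_residual k v (Suc n) = (\<lambda>z w. cholesky_residual k v n z w
     - cholesky_residual k v n z (v n) / of_real (sqrt (Re (cholesky_residual k v n (v n) (v n)))) *
       cnj (cholesky_residual k v n w (v n) / of_real (sqrt (Re (cholesky_residual k v n (v n) (v n))))))"
    by (simp add: fun_eq_iff)
  then show ?case using psd_kernel_schur_complement(1)[OF Suc refl] by simp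
qed

lemma cholesky_residual_zero: "j < n \<Longrightarrow> cholesky_residual k v n z (v j) = 0"
proof (induction n arbitrary: z)
  case (Suc n)
  show ?case
  proof (cases "j = n")
    case True
    then show ?thesis
      using psd_kernel_schur_complement(2)[OF psd_cholesky_residual refl, of n z "v n"] by simp
  next
    case False
    then have j: "j < n" using Suc by simp
    have "cholesky_residual k v n (v j) (v n) = cnj (cholesky_residual k v n (v n) (v j))"
      by (rule psd_kernel_cnj[OF psd_cholesky_residual, symmetric])
    then show ?thesis using Suc.IH[OF j] by simp
  qed
qed simp

lemma cholesky_coord_eq_0: "j < n \<Longrightarrow> cholesky_coord k v (v j) n = 0"
  using cholesky_residual_zero[of j n "v n"] psd_kernel_cnj[OF psd_cholesky_residual, of n "v n" "v j"]
  by (simp add: cholesky_coord_def)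

lemma cholesky_Bessel: "(\<Sum>n<N. (cmod (cholesky_coord k v z n))\<^sup>2) \<le> Re (k z z)"
proof -
  have "0 \<le> Re (cholesky_residual k v N z z)" by (rule psd_kernel_diag[OF psd_cholesky_residual])
  then show ?thesis
    unfolding cholesky_residual_eq by (simp only: complex_norm_square[symmetric]) simp
qed

lemma cholesky_Parseval:
  "k z (v j) = (\<Sum>n\<le>j. cholesky_coord k v z n * cnj (cholesky_coord k v (v j) n))"
  using cholesky_residual_zero[of j "Suc j" z] unfolding cholesky_residual_eq
  by (simp add: lessThan_Suc_atMost)

end

text \<open>A coordinate depends on \<open>z\<close> only through the numbers \<open>k z (v j)\<close>, and continuously so. Hence it
  is as regular as these, and makes sense for any sequence of numbers in their place.\<close>

lemma cholesky_coord_continuous: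
  "\<exists>r. continuous_on UNIV r \<and> (\<forall>z. cholesky_coord k v z n = r (\<lambda>j. k z (v j)))"
proof (induction n rule: less_induct)
  case (less n)
  then obtain r where r: "\<And>m. m < n \<Longrightarrow> continuous_on UNIV (r m)"
    "\<And>m z. m < n \<Longrightarrow> cholesky_coord k v z m = r m (\<lambda>j. k z (v j))" by metis
  let ?r = "\<lambda>u. (u n - (\<Sum>m<n. r m u * cnj (cholesky_coord k v (v n) m)))
      / of_real (sqrt (Re (cholesky_residual k v n (v n) (v n))))"
  have "cholesky_coord k v z n = ?r (\<lambda>j. k z (v j))" for z
    unfolding cholesky_coord_def[of k v z n] cholesky_residual_eq[of k v n z "v n"] using r(2) by simp
  moreover have "continuous_on UNIV (\<lambda>u. u n - (\<Sum>m<n. r m u * cnj (cholesky_coord k v (v n) m)))"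
    using r(1) by (intro continuous_on_diff continuous_on_sum continuous_on_mult continuous_on_const
        continuous_on_product_coordinates) auto
  then have "continuous_on UNIV ?r"
    unfolding divide_inverse by (rule continuous_on_mult[OF _ continuous_on_const])
  ultimately show ?case by (intro exI[of _ ?r]) blast
qed

lemma power2_sum_le: "(x + y)\<^sup>2 \<le> 2 * x\<^sup>2 + 2 * y\<^sup>2" for x y :: real
  using sum_squares_bound[of x y] by (simp add: power2_sum)

lemma mult_le_power2_sum: "x * y \<le> x\<^sup>2 + y\<^sup>2" for x y :: real
proof -
  have "0 \<le> x\<^sup>2 + y\<^sup>2" by simp
  then show ?thesis using sum_squares_bound[of x y] by linarith
qed

lemma norm_add_power2_le:
  "(norm (x + y))\<^sup>2 \<le> 2 * (norm x)\<^sup>2 + 2 * (norm y)\<^sup>2" for x y :: "'a::real_normed_vector"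
  by (rule order_trans[OF power_mono[OF norm_triangle_ineq] power2_sum_le]) simp

lemma summable_square_bounded:
  fixes f :: "nat \<Rightarrow> complex"
  assumes "\<And>N. (\<Sum>n<N. (cmod (f n))\<^sup>2) \<le> C"
  shows "summable (\<lambda>n. (cmod (f n))\<^sup>2)" "(\<Sum>n. (cmod (f n))\<^sup>2) \<le> C"
proof -
  show "summable (\<lambda>n. (cmod (f n))\<^sup>2)"
  proof (rule bounded_imp_summable[where B = C])
    show "(\<Sum>k\<le>n. (cmod (f k))\<^sup>2) \<le> C" for n
      using assms[of "Suc n"] by (simp only: lessThan_Suc_atMost)
  qed simp
  then show "(\<Sum>n. (cmod (f n))\<^sup>2) \<le> C" by (rule suminf_le_const) (rule assms)
qed

lemma summable_norm_mult_square:
  fixes f g :: "nat \<Rightarrow> complex"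
  assumes "summable (\<lambda>n. (cmod (f n))\<^sup>2)" "summable (\<lambda>n. (cmod (g n))\<^sup>2)"
  shows "summable (\<lambda>n. cmod (f n * g n))"
proof (rule summable_comparison_test')
  show "summable (\<lambda>n. (cmod (f n))\<^sup>2 + (cmod (g n))\<^sup>2)" by (intro summable_add assms)
  fix n
  show "norm (cmod (f n * g n)) \<le> (cmod (f n))\<^sup>2 + (cmod (g n))\<^sup>2"
    using mult_le_power2_sum[of "cmod (f n)" "cmod (g n)"] by (simp add: norm_mult)
qed

lemma Cauchy_Schwarz_suminf:
  fixes f g :: "nat \<Rightarrow> complex"
  assumes f: "summable (\<lambda>n. (cmod (f n))\<^sup>2)" and g: "summable (\<lambda>n. (cmod (g n))\<^sup>2)"
  shows "(cmod (\<Sum>n. f n * g n))\<^sup>2 \<le> (\<Sum>n. (cmod (f n))\<^sup>2) * (\<Sum>n. (cmod (g n))\<^sup>2)"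
proof -
  have "(\<lambda>N. \<Sum>n<N. f n * g n) \<longlonglongrightarrow> (\<Sum>n. f n * g n)"
    by (rule summable_LIMSEQ[OF summable_norm_cancel[OF summable_norm_mult_square[OF f g]]])
  then have "(\<lambda>N. (cmod (\<Sum>n<N. f n * g n))\<^sup>2) \<longlonglongrightarrow> (cmod (\<Sum>n. f n * g n))\<^sup>2"
    by (intro tendsto_intros)
  then show ?thesis
  proof (rule LIMSEQ_le_const2, intro exI allI impI)
    fix N :: nat
    have "cmod (\<Sum>n<N. f n * g n) \<le> (\<Sum>n<N. \<bar>cmod (f n)\<bar> * \<bar>cmod (g n)\<bar>)"
      by (rule order_trans[OF norm_sum]) (simp add: norm_mult)
    also have "\<dots> \<le> L2_set (\<lambda>n. cmod (f n)) {..<N} * L2_set (\<lambda>n. cmod (g n)) {..<N}"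
      by (rule L2_set_mult_ineq)
    finally have "(cmod (\<Sum>n<N. f n * g n))\<^sup>2 \<le> (L2_set (\<lambda>n. cmod (f n)) {..<N} * L2_set (\<lambda>n. cmod (g n)) {..<N})\<^sup>2"
      by (rule power_mono) simp
    also have "\<dots> = (\<Sum>n<N. (cmod (f n))\<^sup>2) * (\<Sum>n<N. (cmod (g n))\<^sup>2)"
      by (simp add: power_mult_distrib L2_set_power2)
    also have "\<dots> \<le> (\<Sum>n. (cmod (f n))\<^sup>2) * (\<Sum>n. (cmod (g n))\<^sup>2)"
      by (intro mult_mono sum_le_suminf f g suminf_nonneg sum_nonneg) auto
    finally show "(cmod (\<Sum>n<N. f n * g n))\<^sup>2 \<le> (\<Sum>n. (cmod (f n))\<^sup>2) * (\<Sum>n. (cmod (g n))\<^sup>2)" .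
  qed
qed

text \<open>By the Cauchy--Schwarz inequality the tails of the series are small uniformly in \<open>x\<close>.\<close>

lemma continuous_on_square_summable_pairing:
  fixes p :: "nat \<Rightarrow> 'a::topological_space \<Rightarrow> complex"
  assumes cont: "\<And>n. continuous_on UNIV (p n)"
    and bound: "\<And>x N. (\<Sum>n<N. (cmod (p n x))\<^sup>2) \<le> C"
    and w: "summable (\<lambda>n. (cmod (w n))\<^sup>2)"
  shows "continuous_on UNIV (\<lambda>x. \<Sum>n. p n x * w n)"
proof (rule uniform_limit_theorem)
  note ps = summable_square_bounded[OF bound]
  have C0: "C \<ge> 0" using bound[where N = 0] by simp
  show "\<forall>\<^sub>F N in sequentially. continuous_on UNIV (\<lambda>x. \<Sum>n<N. p n x * w n)"
    by (intro always_eventually allI continuous_on_sum continuous_on_mult cont continuous_on_const)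
  have w_tail: "summable (\<lambda>n. (cmod (w (n + N)))\<^sup>2)" for N
    by (rule summable_ignore_initial_segment[OF w])
  have tail: "(\<lambda>N. \<Sum>n. (cmod (w (n + N)))\<^sup>2) \<longlonglongrightarrow> 0"
    by (rule suminf_exist_split2[OF w])
  have le: "cmod ((\<Sum>n<N. p n x * w n) - (\<Sum>n. p n x * w n)) \<le> sqrt (C * (\<Sum>n. (cmod (w (n + N)))\<^sup>2))" for x N
  proof -
    have sm: "summable (\<lambda>n. p n x * w n)"
      by (rule summable_norm_cancel[OF summable_norm_mult_square[OF ps(1) w]])
    have sp: "summable (\<lambda>n. (cmod (p (n + N) x))\<^sup>2)" and sw: "summable (\<lambda>n. (cmod (w (n + N)))\<^sup>2)"
      by (rule summable_ignore_initial_segment[OF ps(1)], rule summable_ignore_initial_segment[OF w])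
    have "(\<Sum>n. p n x * w n) - (\<Sum>n<N. p n x * w n) = (\<Sum>n. p (n + N) x * w (n + N))"
      using suminf_split_initial_segment[OF sm, of N] by simp
    moreover have "(cmod (\<Sum>n. p (n + N) x * w (n + N)))\<^sup>2 \<le>
        (\<Sum>n. (cmod (p (n + N) x))\<^sup>2) * (\<Sum>n. (cmod (w (n + N)))\<^sup>2)"
      by (rule Cauchy_Schwarz_suminf[OF sp sw])
    moreover have "(\<Sum>n. (cmod (p (n + N) x))\<^sup>2) \<le> C"
      using suminf_split_initial_segment[OF ps(1), of x N] ps(2)[of x]
        sum_nonneg[of "{..<N}" "\<lambda>n. (cmod (p n x))\<^sup>2"] by simp
    ultimately have "(cmod ((\<Sum>n. p n x * w n) - (\<Sum>n<N. p n x * w n)))\<^sup>2 \<le> C * (\<Sum>n. (cmod (w (n + N)))\<^sup>2)"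
      using order_trans mult_right_mono[OF _ suminf_nonneg[OF sw]]
      by (metis (no_types, lifting) norm_minus_commute zero_le_power2)
    then show ?thesis by (simp add: norm_minus_commute real_le_rsqrt)
  qed
  show "uniform_limit UNIV (\<lambda>N x. \<Sum>n<N. p n x * w n) (\<lambda>x. \<Sum>n. p n x * w n) sequentially"
  proof (rule uniform_limitI)
    fix e :: real assume e: "e > 0"
    have "(\<lambda>N. sqrt (C * (\<Sum>n. (cmod (w (n + N)))\<^sup>2))) \<longlonglongrightarrow> sqrt (C * 0)"
      by (intro tendsto_intros tail)
    then have "\<forall>\<^sub>F N in sequentially. sqrt (C * (\<Sum>n. (cmod (w (n + N)))\<^sup>2)) < e"
      using e by (auto dest: order_tendstoD(2))
    then show "\<forall>\<^sub>F N in sequentially. \<forall>x\<in>UNIV. dist (\<Sum>n<N. p n x * w n) (\<Sum>n. p n x * w n) < e"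
      by eventually_elim (use le in \<open>auto simp: dist_norm intro: le_less_trans\<close>)
  qed
qed simp


lemma psd_kernel_gram:
  fixes t :: "'z \<Rightarrow> nat \<Rightarrow> complex"
  assumes "\<And>z. summable (\<lambda>n. (cmod (t z n))\<^sup>2)"
  shows "psd_kernel (\<lambda>z w. \<Sum>n. t z n * cnj (t w n))"
proof -
  have sm: "summable (\<lambda>n. t z n * cnj (t w n))" for z w
    by (rule summable_norm_cancel[OF summable_norm_mult_square]) (simp_all add: assms)
  have fin: "psd_kernel (\<lambda>z w. \<Sum>n<N. t z n * cnj (t w n))" for N
  proof (induction N)
    case (Suc N)
    show ?case using psd_kernel_add[OF Suc psd_kernel_rank_one[of "\<lambda>z. t z N"]] by simp
  qed (simp add: psd_kernel_zero)
  have "0 \<le> Re (\<Sum>i<n. \<Sum>j<n. c i * cnj (c j) * (\<Sum>l. t (z i) l * cnj (t (z j) l)))" for n :: nat and z c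
  proof (rule LIMSEQ_le_const)
    show "(\<lambda>N. Re (\<Sum>i<n. \<Sum>j<n. c i * cnj (c j) * (\<Sum>l<N. t (z i) l * cnj (t (z j) l))))
        \<longlonglongrightarrow> Re (\<Sum>i<n. \<Sum>j<n. c i * cnj (c j) * (\<Sum>l. t (z i) l * cnj (t (z j) l)))"
      by (intro tendsto_Re tendsto_sum tendsto_mult tendsto_const summable_LIMSEQ sm)
    show "\<exists>N. \<forall>m\<ge>N. 0 \<le> Re (\<Sum>i<n. \<Sum>j<n. c i * cnj (c j) * (\<Sum>l<m. t (z i) l * cnj (t (z j) l)))"
      by (intro exI allI impI psd_kernel_nonneg[OF fin])
  qed
  moreover have "(\<Sum>n. t w n * cnj (t z n)) = cnj (\<Sum>n. t z n * cnj (t w n))" for z w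
    using sums_unique[OF sums_cnj[THEN iffD2, OF summable_sums[OF sm[of z w]]]]
    by (simp add: mult.commute)
  ultimately show ?thesis unfolding psd_kernel_def by blast
qed

text \<open>Write \<open>P x\<close>, \<open>Q y\<close> for vectors with the Gram kernel of the previous section, and let \<open>D\<close> be
  a dense sequence. The coordinates of \<open>P x\<close> along the Gram--Schmidt basis of the \<open>Q(D j)\<close> are
  combinations of values \<open>\<psi> x (D j)\<close>, so they are continuous in \<open>x\<close>; those of \<open>Q y\<close> need not be
  even measurable. The process is therefore repeated with the projected vectors and the basis made
  of the \<open>P(D j)\<close>. This gives continuous coordinates on both sides, but only for \<open>y\<close> in the range
  of \<open>D\<close>, from which they extend by continuity.\<close>

theorem schur_bounded_continuous_factorization:
  fixes \<psi> :: "'x::second_countable_topology \<Rightarrow> 'x \<Rightarrow> complex"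
  assumes sb: "schur_bounded \<psi> C" and C: "C \<ge> 0"
    and cont1: "\<And>y. continuous_on UNIV (\<lambda>x. \<psi> x y)"
    and cont2: "\<And>x. continuous_on UNIV (\<lambda>y. \<psi> x y)"
  obtains p q :: "nat \<Rightarrow> 'x \<Rightarrow> complex" where
    "\<And>n. continuous_on UNIV (p n)" "\<And>n. continuous_on UNIV (q n)"
    "\<And>N x. (\<Sum>n<N. (cmod (p n x))\<^sup>2) \<le> C" "\<And>N y. (\<Sum>n<N. (cmod (q n y))\<^sup>2) \<le> C"
    "\<And>x y. \<psi> x y = (\<Sum>n. p n x * cnj (q n y))"
proof -
  obtain D0 :: "'x set" where D0: "countable D0" "\<And>X. open X \<Longrightarrow> X \<noteq> {} \<Longrightarrow> \<exists>d\<in>D0. d \<in> X"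
    using countable_dense_exists by metis
  define D where "D = from_nat_into D0"
  have "D0 \<noteq> {}" using D0(2)[of UNIV] by auto
  then have rD: "range D = D0" using D0(1) by (simp add: D_def range_from_nat_into)
  have dense: "x \<in> S" if "closed S" "\<And>j. D j \<in> S" for S x
  proof (rule ccontr)
    assume "x \<notin> S"
    then have "open (- S)" "- S \<noteq> {}" using that(1) by auto
    then obtain d where "d \<in> D0" "d \<in> - S" using D0(2) by blast
    then show False using that(2) rD by auto
  qed
  obtain k where k: "psd_kernel k" "\<And>z. Re (k z z) \<le> C" "\<And>x y. k (x, True) (y, False) = \<psi> x y"
    using schur_bounded_kernel[OF sb C] by blast
  define v where "v j = (D j, False)" for j
  define t where "t = cholesky_coord k v"
  have t_bound: "(\<Sum>n<N. (cmod (t z n))\<^sup>2) \<le> C" for N z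
    unfolding t_def using cholesky_Bessel[OF k(1), of v z N] k(2)[of z] by simp
  note t_sum = summable_square_bounded[OF t_bound]
  have t_cont: "continuous_on UNIV (\<lambda>x. t (x, True) n)" for n
  proof -
    obtain r where r: "continuous_on UNIV r" "\<And>z. t z n = r (\<lambda>j. k z (v j))"
      using cholesky_coord_continuous[of k v n] unfolding t_def by auto
    have "continuous_on UNIV (\<lambda>x j. \<psi> x (D j))"
      by (rule continuous_on_coordinatewise_then_product) (rule cont1)
    from continuous_on_compose2[OF r(1) this] show ?thesis by (simp add: r(2) v_def k(3))
  qed
  define k2 where "k2 z w = (\<Sum>n. t z n * cnj (t w n))" for z w
  have pk2: "psd_kernel k2" unfolding k2_def by (rule psd_kernel_gram[OF t_sum(1)])
  have k2_diag: "Re (k2 z z) \<le> C" for z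
  proof -
    have "k2 z z = (\<Sum>n. of_real ((cmod (t z n))\<^sup>2))"
      unfolding k2_def by (simp only: complex_norm_square)
    also have "\<dots> = of_real (\<Sum>n. (cmod (t z n))\<^sup>2)" by (rule suminf_of_real[OF t_sum(1), symmetric])
    finally show ?thesis using t_sum(2)[of z] by simp
  qed
  have k2_k: "k2 z (v j) = k z (v j)" for z j
  proof -
    have "k2 z (v j) = (\<Sum>n\<le>j. t z n * cnj (t (v j) n))"
      unfolding k2_def t_def by (rule suminf_finite) (auto simp: cholesky_coord_eq_0[OF k(1)])
    then show ?thesis using cholesky_Parseval[OF k(1), of z v j] by (simp add: t_def)
  qed
  define v2 where "v2 j = (D j, True)" for j
  define t2 where "t2 = cholesky_coord k2 v2"
  have t2_bound: "(\<Sum>n<N. (cmod (t2 z n))\<^sup>2) \<le> C" for N z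
    unfolding t2_def using cholesky_Bessel[OF pk2, of v2 z N] k2_diag[of z] by simp
  obtain r where r: "\<And>n. continuous_on UNIV (r n)" "\<And>n z. t2 z n = r n (\<lambda>j. k2 z (v2 j))"
    using cholesky_coord_continuous[of k2 v2] unfolding t2_def by metis
  define p where "p n x = t2 (x, True) n" for n x
  (* On the range of D these are the coordinates t2 (y, False), by k2_D below. *)
  define q where "q n y = r n (\<lambda>j. cnj (\<psi> (D j) y))" for n y
  have p_cont: "continuous_on UNIV (p n)" for n
  proof -
    have "continuous_on UNIV (\<lambda>x. k2 (x, True) (v2 j))" for j
      unfolding k2_def by (rule continuous_on_square_summable_pairing[OF t_cont t_bound]) (simp add: t_sum)
    then have "continuous_on UNIV (\<lambda>x j. k2 (x, True) (v2 j))"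
      by (rule continuous_on_coordinatewise_then_product)
    from continuous_on_compose2[OF r(1) this] show ?thesis by (simp add: p_def[abs_def] r(2))
  qed
  have q_cont: "continuous_on UNIV (q n)" for n
  proof -
    have "continuous_on UNIV (\<lambda>y j. cnj (\<psi> (D j) y))"
      by (rule continuous_on_coordinatewise_then_product) (intro continuous_on_cnj cont2)
    from continuous_on_compose2[OF r(1) this] show ?thesis by (simp add: q_def[abs_def])
  qed
  have k2_D: "k2 (D i, False) (v2 j) = cnj (\<psi> (D j) (D i))" for i j
    using k2_k[of "(D j, True)" i] psd_kernel_cnj[OF pk2, of "(D j, True)" "(D i, False)"]
    by (simp add: v_def v2_def k(3))
  have q_D: "q n (D i) = t2 (D i, False) n" for n i
    by (simp add: q_def r(2) k2_D)
  have q_bound: "(\<Sum>n<N. (cmod (q n y))\<^sup>2) \<le> C" for N y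
  proof -
    have "y \<in> {y. (\<Sum>n<N. (cmod (q n y))\<^sup>2) \<le> C}"
      by (rule dense, intro closed_Collect_le continuous_on_sum continuous_on_power continuous_on_norm
          q_cont continuous_on_const) (simp add: q_D t2_bound)
    then show ?thesis by simp
  qed
  have p_bound: "(\<Sum>n<N. (cmod (p n x))\<^sup>2) \<le> C" for N x
    unfolding p_def by (rule t2_bound)
  have p_D: "p n (D j) = 0" if "j < n" for n j
    using cholesky_coord_eq_0[OF pk2 that, of v2] by (simp add: p_def t2_def v2_def)
  have eq_D: "\<psi> (D j) y = (\<Sum>n\<le>j. p n (D j) * cnj (q n y))" for j y
  proof -
    have "y \<in> {y. \<psi> (D j) y = (\<Sum>n\<le>j. p n (D j) * cnj (q n y))}"
    proof (rule dense)
      show "closed {y. \<psi> (D j) y = (\<Sum>n\<le>j. p n (D j) * cnj (q n y))}"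
        by (intro closed_Collect_eq cont2 continuous_on_sum continuous_on_mult continuous_on_cnj
          q_cont continuous_on_const)
      fix i
      have "cnj (\<psi> (D j) (D i)) = (\<Sum>n\<le>j. t2 (D i, False) n * cnj (t2 (v2 j) n))"
        using cholesky_Parseval[OF pk2, of "(D i, False)" v2 j] by (simp add: k2_D t2_def)
      then have "cnj (cnj (\<psi> (D j) (D i))) = cnj (\<Sum>n\<le>j. q n (D i) * cnj (p n (D j)))"
        by (simp add: q_D p_def v2_def)
      then show "D i \<in> {y. \<psi> (D j) y = (\<Sum>n\<le>j. p n (D j) * cnj (q n y))}"
        by (simp add: mult.commute)
    qed
    then show ?thesis by simp
  qed
  have "\<psi> x y = (\<Sum>n. p n x * cnj (q n y))" for x y
  proof -
    have "x \<in> {x. \<psi> x y = (\<Sum>n. p n x * cnj (q n y))}"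
    proof (rule dense)
      have "continuous_on UNIV (\<lambda>x. \<Sum>n. p n x * cnj (q n y))"
        by (rule continuous_on_square_summable_pairing[OF p_cont p_bound])
          (simp add: summable_square_bounded[OF q_bound])
      then show "closed {x. \<psi> x y = (\<Sum>n. p n x * cnj (q n y))}"
        by (intro closed_Collect_eq cont1)
      fix j
      have "(\<Sum>n. p n (D j) * cnj (q n y)) = (\<Sum>n\<le>j. p n (D j) * cnj (q n y))"
        by (rule suminf_finite) (auto simp: p_D)
      then show "D j \<in> {x. \<psi> x y = (\<Sum>n. p n x * cnj (q n y))}" by (simp add: eq_D)
    qed
    then show ?thesis by simp
  qed
  from that[OF p_cont q_cont p_bound q_bound this] show thesis .
qed

section \<open>Schur multipliers of a group are bounded on finite matrices\<close>

text \<open>The bilinear form is tested at the conjugate of the image of \<open>v\<close>.\<close>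

lemma contraction_on_row_bound:
  assumes "contraction_on F a"
  shows "(\<Sum>x\<in>F. (cmod (\<Sum>y\<in>F. a x y * v y))\<^sup>2) \<le> (\<Sum>y\<in>F. (cmod (v y))\<^sup>2)"
proof -
  define w where "w x = (\<Sum>y\<in>F. a x y * v y)" for x
  define S where "S = L2_set (\<lambda>x. cmod (w x)) F"
  define V where "V = L2_set (\<lambda>y. cmod (v y)) F"
  have "(\<Sum>x\<in>F. \<Sum>y\<in>F. a x y * cnj (w x) * v y) = (\<Sum>x\<in>F. w x * cnj (w x))"
    unfolding w_def by (simp add: sum_distrib_right mult_ac)
  also have "\<dots> = of_real (\<Sum>x\<in>F. (cmod (w x))\<^sup>2)"
    unfolding of_real_sum by (simp only: complex_norm_square)
  also have "(\<Sum>x\<in>F. (cmod (w x))\<^sup>2) = S\<^sup>2" by (simp add: S_def L2_set_power2)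
  finally have "cmod (of_real (S\<^sup>2)) \<le> L2_set (\<lambda>x. cmod (cnj (w x))) F * V"
    using assms[unfolded contraction_on_def, rule_format, of "\<lambda>x. cnj (w x)" v] by (simp add: V_def)
  then have "S * S \<le> S * V" by (simp only: norm_of_real abs_power2 complex_mod_cnj S_def[symmetric] power2_eq_square)
  moreover have "0 \<le> S" "0 \<le> V" by (simp_all add: S_def V_def L2_set_nonneg)
  ultimately have "S \<le> V" by (cases "S = 0") auto
  then have "S\<^sup>2 \<le> V\<^sup>2" using \<open>0 \<le> S\<close> by (rule power_mono)
  then show ?thesis by (simp add: S_def V_def L2_set_power2 w_def)
qed

lemma bilinear_le_L2_set:
  "cmod (\<Sum>x\<in>F. \<Sum>y\<in>F. b x y * u x * v y)
     \<le> L2_set (\<lambda>x. cmod (u x)) F * L2_set (\<lambda>x. cmod (\<Sum>y\<in>F. b x y * v y)) F"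
proof -
  have "(\<Sum>x\<in>F. \<Sum>y\<in>F. b x y * u x * v y) = (\<Sum>x\<in>F. u x * (\<Sum>y\<in>F. b x y * v y))"
    by (simp add: sum_distrib_left mult_ac)
  also have "cmod \<dots> \<le> (\<Sum>x\<in>F. \<bar>cmod (u x)\<bar> * \<bar>cmod (\<Sum>y\<in>F. b x y * v y)\<bar>)"
    by (rule order_trans[OF norm_sum]) (simp add: norm_mult)
  also have "\<dots> \<le> L2_set (\<lambda>x. cmod (u x)) F * L2_set (\<lambda>x. cmod (\<Sum>y\<in>F. b x y * v y)) F"
    by (rule L2_set_mult_ineq)
  finally show ?thesis .
qed

lemma ell2_carrier: "f \<in> carrier ell2 \<longleftrightarrow> (\<lambda>y. (cmod (f y))\<^sup>2) summable_on UNIV"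
  by (simp add: ell2_def)

lemma hnorm_ell2: "f \<in> carrier ell2 \<Longrightarrow> hnorm ell2 f = sqrt (\<Sum>\<^sub>\<infinity>y. (cmod (f y))\<^sup>2)"
proof -
  assume "f \<in> carrier ell2"
  then have s: "(\<lambda>y. (cmod (f y))\<^sup>2) summable_on UNIV" by (simp add: ell2_carrier)
  have "(\<Sum>\<^sub>\<infinity>y. f y * cnj (f y)) = (\<Sum>\<^sub>\<infinity>y. of_real ((cmod (f y))\<^sup>2))"
    by (simp only: complex_norm_square)
  also have "\<dots> = of_real (\<Sum>\<^sub>\<infinity>y. (cmod (f y))\<^sup>2)"
    by (rule infsumI, rule has_sum_of_real_iff[THEN iffD2], rule has_sum_infsum[OF s])
  finally show ?thesis by (simp add: hnorm_def ell2_def)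
qed

lemma hnorm_ell2_power2: "f \<in> carrier ell2 \<Longrightarrow> (hnorm ell2 f)\<^sup>2 = (\<Sum>\<^sub>\<infinity>y. (cmod (f y))\<^sup>2)"
  by (simp add: hnorm_ell2 infsum_nonneg)

lemma hnorm_ell2_nonneg: "f \<in> carrier ell2 \<Longrightarrow> 0 \<le> hnorm ell2 f"
  by (simp add: hnorm_ell2 infsum_nonneg)

lemma sum_le_hnorm_ell2:
  "f \<in> carrier ell2 \<Longrightarrow> finite F \<Longrightarrow> (\<Sum>y\<in>F. (cmod (f y))\<^sup>2) \<le> (hnorm ell2 f)\<^sup>2"
  unfolding hnorm_ell2_power2 by (rule finite_sum_le_infsum) (auto simp: ell2_carrier)

lemma ell2_bounded_sums:
  assumes "\<And>F. finite F \<Longrightarrow> (\<Sum>y\<in>F. (cmod (f y))\<^sup>2) \<le> C\<^sup>2" "0 \<le> C"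
  shows "f \<in> carrier ell2" "hnorm ell2 f \<le> C"
proof -
  show f: "f \<in> carrier ell2"
    unfolding ell2_carrier
    by (rule nonneg_bdd_above_summable_on) (use assms(1) in \<open>auto intro!: bdd_aboveI[of _ "C\<^sup>2"]\<close>)
  show "hnorm ell2 f \<le> C"
    by (rule power2_le_imp_le[OF _ assms(2)], unfold hnorm_ell2_power2[OF f], rule infsum_le_finite_sums)
      (use f assms(1) in \<open>auto simp: ell2_carrier\<close>)
qed

lemma ell2_finite_support:
  assumes "finite F"
  shows "(\<lambda>z. if z \<in> F then v z else 0) \<in> carrier ell2"
    and "(hnorm ell2 (\<lambda>z. if z \<in> F then v z else 0))\<^sup>2 = (\<Sum>z\<in>F. (cmod (v z))\<^sup>2)"
proof -
  let ?g = "\<lambda>z. (cmod (if z \<in> F then v z else 0))\<^sup>2"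
  have "?g summable_on UNIV \<longleftrightarrow> ?g summable_on F" by (rule summable_on_cong_neutral) auto
  then show c: "(\<lambda>z. if z \<in> F then v z else 0) \<in> carrier ell2" using assms by (simp add: ell2_carrier)
  have "infsum ?g UNIV = infsum ?g F" by (rule infsum_cong_neutral) auto
  then show "(hnorm ell2 (\<lambda>z. if z \<in> F then v z else 0))\<^sup>2 = (\<Sum>z\<in>F. (cmod (v z))\<^sup>2)"
    unfolding hnorm_ell2_power2[OF c] using assms by simp
qed

lemma bounded_operator_ell2_finite_support:
  assumes B: "B \<in> bounded_operators ell2" and F: "finite F"
  shows "B (\<lambda>z. if z \<in> F then v z else 0) x = (\<Sum>y\<in>F. matrix_entry B x y * v y)"
  using F
proof (induction F arbitrary: x rule: finite_induct)
  case empty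
  have z: "(\<lambda>_. 0) \<in> carrier ell2" by (simp add: ell2_carrier)
  have "B (0 \<odot>\<^bsub>ell2\<^esub> (\<lambda>_. 0)) = 0 \<odot>\<^bsub>ell2\<^esub> B (\<lambda>_. 0)"
    using B z unfolding bounded_operators_def by blast
  then show ?case by (simp add: ell2_def)
next
  case (insert a F)
  let ?\<delta> = "\<lambda>z. if z = a then 1 else (0 :: complex)"
  have \<delta>: "?\<delta> \<in> carrier ell2" using ell2_finite_support(1)[of "{a}" "\<lambda>_. 1"] by simp
  have fF: "(\<lambda>z. if z \<in> F then v z else 0) \<in> carrier ell2"
    by (rule ell2_finite_support(1)) (use insert in simp)
  have v\<delta>: "v a \<odot>\<^bsub>ell2\<^esub> ?\<delta> \<in> carrier ell2"
    using ell2_finite_support(1)[of "{a}" "\<lambda>_. v a"] by (simp add: ell2_def if_distrib cong: if_cong)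
  have "(\<lambda>z. if z \<in> insert a F then v z else 0) = (v a \<odot>\<^bsub>ell2\<^esub> ?\<delta>) \<oplus>\<^bsub>ell2\<^esub> (\<lambda>z. if z \<in> F then v z else 0)"
    using insert(2) by (auto simp: ell2_def fun_eq_iff)
  then have "B (\<lambda>z. if z \<in> insert a F then v z else 0)
      = (v a \<odot>\<^bsub>ell2\<^esub> B ?\<delta>) \<oplus>\<^bsub>ell2\<^esub> B (\<lambda>z. if z \<in> F then v z else 0)"
    using B \<delta> fF v\<delta> unfolding bounded_operators_def by simp
  then have "B (\<lambda>z. if z \<in> insert a F then v z else 0) x = v a * B ?\<delta> x + B (\<lambda>z. if z \<in> F then v z else 0) x"
    by (simp add: ell2_def)
  then show ?case using insert by (simp add: matrix_entry_def mult.commute)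
qed

text \<open>A block diagonal matrix with contractive blocks is a contraction.\<close>

lemma block_diagonal_bounded:
  assumes fin: "\<And>n::nat. finite (F n)" and disj: "\<And>m n. m \<noteq> n \<Longrightarrow> F m \<inter> F n = {}"
    and contr: "\<And>n. contraction_on (F n) (a n)"
  obtains A where "A \<in> bounded_operators ell2"
    "\<And>n x y. x \<in> F n \<Longrightarrow> y \<in> F n \<Longrightarrow> matrix_entry A x y = a n x y"
proof -
  define i where "i x = (THE n. x \<in> F n)" for x
  have i: "i x = n" if "x \<in> F n" for x n
    unfolding i_def using that disj by (intro the_equality) auto
  define A0 where "A0 f x = (if x \<in> \<Union>(range F) then \<Sum>y\<in>F (i x). a (i x) x y * f y else 0)" for f :: "'a \<Rightarrow> complex" and x
  have A0: "A0 f x = (\<Sum>y\<in>F n. a n x y * f y)" if "x \<in> F n" for f x n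
    using that i[OF that] by (auto simp: A0_def)
  have bound: "(\<Sum>x\<in>X. (cmod (A0 f x))\<^sup>2) \<le> (hnorm ell2 f)\<^sup>2" if f: "f \<in> carrier ell2" and X: "finite X" for f X
  proof -
    define I where "I = i ` (X \<inter> \<Union>(range F))"
    have I: "finite I" using X by (simp add: I_def)
    have "(\<Sum>x\<in>X. (cmod (A0 f x))\<^sup>2) = (\<Sum>x\<in>X \<inter> \<Union>(range F). (cmod (A0 f x))\<^sup>2)"
      by (rule sum.mono_neutral_right) (use X in \<open>auto simp: A0_def\<close>)
    also have "\<dots> \<le> (\<Sum>x\<in>(\<Union>n\<in>I. F n). (cmod (A0 f x))\<^sup>2)"
    proof (rule sum_mono2)
      show "finite (\<Union>n\<in>I. F n)" using I fin by blast
      show "X \<inter> \<Union>(range F) \<subseteq> (\<Union>n\<in>I. F n)"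
        using i by (auto simp: I_def)
    qed simp
    also have "\<dots> = (\<Sum>n\<in>I. \<Sum>x\<in>F n. (cmod (A0 f x))\<^sup>2)"
      by (rule sum.UNION_disjoint) (use I fin disj in auto)
    also have "\<dots> \<le> (\<Sum>n\<in>I. \<Sum>y\<in>F n. (cmod (f y))\<^sup>2)"
    proof (rule sum_mono)
      fix n
      have "(\<Sum>x\<in>F n. (cmod (A0 f x))\<^sup>2) = (\<Sum>x\<in>F n. (cmod (\<Sum>y\<in>F n. a n x y * f y))\<^sup>2)"
        by (intro sum.cong refl) (simp add: A0)
      also have "\<dots> \<le> (\<Sum>y\<in>F n. (cmod (f y))\<^sup>2)" by (rule contraction_on_row_bound[OF contr])
      finally show "(\<Sum>x\<in>F n. (cmod (A0 f x))\<^sup>2) \<le> (\<Sum>y\<in>F n. (cmod (f y))\<^sup>2)" .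
    qed
    also have "\<dots> = (\<Sum>y\<in>(\<Union>n\<in>I. F n). (cmod (f y))\<^sup>2)"
      by (rule sum.UNION_disjoint[symmetric]) (use I fin disj in auto)
    also have "\<dots> \<le> (hnorm ell2 f)\<^sup>2" by (rule sum_le_hnorm_ell2[OF f]) (use I fin in blast)
    finally show ?thesis .
  qed
  note A0b = ell2_bounded_sums[OF bound hnorm_ell2_nonneg]
  define A where "A = restrict A0 (carrier ell2)"
  have "A \<in> bounded_operators ell2"
    unfolding bounded_operators_def
  proof (intro CollectI conjI ballI allI exI[of _ 1])
    show "A \<in> carrier ell2 \<rightarrow>\<^sub>E carrier ell2" using A0b(1) by (auto simp: A_def)
    fix f :: "'a \<Rightarrow> complex" assume f: "f \<in> carrier ell2"
    then show "hnorm ell2 (A f) \<le> 1 * hnorm ell2 f" using A0b(2)[OF f] by (simp add: A_def)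
    fix c
    have "c \<odot>\<^bsub>ell2\<^esub> f \<in> carrier ell2"
      using f by (simp add: ell2_def norm_mult power_mult_distrib summable_on_cmult_right)
    then show "A (c \<odot>\<^bsub>ell2\<^esub> f) = c \<odot>\<^bsub>ell2\<^esub> A f"
      using f by (simp add: A_def) (auto simp: A0_def fun_eq_iff ell2_def sum_distrib_left mult_ac)
  next
    fix f g :: "'a \<Rightarrow> complex" assume fg: "f \<in> carrier ell2" "g \<in> carrier ell2"
    have "f \<oplus>\<^bsub>ell2\<^esub> g \<in> carrier ell2"
    proof -
      have "(\<lambda>y. 2 * (cmod (f y))\<^sup>2 + 2 * (cmod (g y))\<^sup>2) summable_on UNIV"
        using fg by (intro summable_on_add summable_on_cmult_right) (simp_all add: ell2_carrier)
      then have "(\<lambda>y. (cmod (f y + g y))\<^sup>2) summable_on UNIV"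
      proof (rule summable_on_comparison_test)
        fix y
        show "(cmod (f y + g y))\<^sup>2 \<le> 2 * (cmod (f y))\<^sup>2 + 2 * (cmod (g y))\<^sup>2"
          by (rule norm_add_power2_le)
      qed simp
      then show ?thesis by (simp add: ell2_def)
    qed
    then show "A (f \<oplus>\<^bsub>ell2\<^esub> g) = A f \<oplus>\<^bsub>ell2\<^esub> A g"
      using fg by (simp add: A_def) (auto simp: A0_def fun_eq_iff ell2_def sum.distrib algebra_simps)
  qed
  moreover have "matrix_entry A x y = a n x y" if "x \<in> F n" "y \<in> F n" for n x y
  proof -
    have "(\<lambda>z. if z = y then 1 else 0) \<in> carrier ell2" using ell2_finite_support(1)[of "{y}" "\<lambda>_. 1"] by simp
    then have "matrix_entry A x y = (\<Sum>z\<in>F n. a n x z * (if z = y then 1 else 0))"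
      by (simp add: matrix_entry_def A_def A0[OF that(1)])
    then show ?thesis using that(2) fin by (simp add: if_distrib cong: if_cong)
  qed
  ultimately show thesis by (rule that)
qed

text \<open>If no bound existed, there would be for every \<open>n\<close> a contractive finite matrix that is blown up by
  more than \<open>n\<close>. In an infinite group these matrices can be translated to disjoint index sets, which
  leaves an invariant \<open>\<psi>\<close> unchanged, and their direct sum is a contraction whose product with
  \<open>\<psi>\<close> is unbounded.\<close>

lemma schur_multiplier_schur_bounded:
  fixes \<psi> :: "'g::group_add \<Rightarrow> 'g \<Rightarrow> complex"
  assumes mult: "schur_multiplier \<psi>" and inv: "\<And>g x y. \<psi> (g + x) (g + y) = \<psi> x y"
  shows "\<exists>C\<ge>0. schur_bounded \<psi> C"
proof (cases "finite (UNIV :: 'g set)")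
  case True
  (* A finite group: the entries of a contraction have modulus at most 1. *)
  define C where "C = (\<Sum>x\<in>UNIV. \<Sum>y\<in>UNIV. cmod (\<psi> x y))"
  have "schur_bounded \<psi> C"
    unfolding schur_bounded_def
  proof (intro allI impI)
    fix F :: "'g set" and a and u v :: "'g \<Rightarrow> complex" assume F: "finite F" and a: "contraction_on F a"
    define U V where "U = L2_set (\<lambda>x. cmod (u x)) F" and "V = L2_set (\<lambda>y. cmod (v y)) F"
    have a1: "cmod (a x y) \<le> 1" if xy: "x \<in> F" "y \<in> F" for x y
    proof -
      have d: "L2_set (\<lambda>z. cmod (if z = w then 1 else 0)) F = 1" if "w \<in> F" for w :: 'g
      proof -
        have "(\<Sum>z\<in>F. (cmod (if z = w then 1 else 0))\<^sup>2) = (\<Sum>z\<in>F. if z = w then 1 else 0)"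
          by (intro sum.cong) auto
        then show ?thesis using F that by (simp add: L2_set_def)
      qed
      have "(\<Sum>x'\<in>F. \<Sum>y'\<in>F. a x' y' * (if x' = x then 1 else 0) * (if y' = y then 1 else 0)) =
          (\<Sum>x'\<in>F. \<Sum>y'\<in>F. if y' = y then if x' = x then a x y else 0 else 0)"
        by (intro sum.cong refl) auto
      also have "\<dots> = a x y" using F xy by simp
      finally have "(\<Sum>x'\<in>F. \<Sum>y'\<in>F. a x' y' * (if x' = x then 1 else 0) * (if y' = y then 1 else 0)) = a x y" .
      then show ?thesis
        using a[unfolded contraction_on_def, rule_format, of "\<lambda>z. if z = x then 1 else 0" "\<lambda>z. if z = y then 1 else 0"]
        by (simp only: d[OF xy(1)] d[OF xy(2)] mult_1)
    qed
    have "cmod (\<Sum>x\<in>F. \<Sum>y\<in>F. \<psi> x y * a x y * u x * v y) \<le> (\<Sum>x\<in>F. \<Sum>y\<in>F. cmod (\<psi> x y * a x y * u x * v y))"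
      by (rule order_trans[OF norm_sum sum_mono[OF norm_sum]])
    also have "\<dots> \<le> (\<Sum>x\<in>F. \<Sum>y\<in>F. cmod (\<psi> x y) * (U * V))"
    proof (intro sum_mono)
      fix x y assume xy: "x \<in> F" "y \<in> F"
      have "cmod (u x) \<le> U" unfolding U_def by (rule member_le_L2_set[OF F xy(1)])
      moreover have "cmod (v y) \<le> V" unfolding V_def by (rule member_le_L2_set[OF F xy(2)])
      ultimately have "cmod (a x y) * (cmod (u x) * cmod (v y)) \<le> 1 * (U * V)"
        using a1[OF xy] by (intro mult_mono) (auto simp: U_def L2_set_nonneg)
      then show "cmod (\<psi> x y * a x y * u x * v y) \<le> cmod (\<psi> x y) * (U * V)"
        by (simp add: norm_mult mult.assoc mult_left_mono)
    qed
    also have "\<dots> = (\<Sum>x\<in>F. \<Sum>y\<in>F. cmod (\<psi> x y)) * (U * V)" by (simp add: sum_distrib_right)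
    also have "(\<Sum>x\<in>F. \<Sum>y\<in>F. cmod (\<psi> x y)) \<le> C"
      unfolding C_def using True
      by (intro order_trans[OF sum_mono[OF sum_mono2] sum_mono2]) (auto intro: sum_nonneg)
    finally show "cmod (\<Sum>x\<in>F. \<Sum>y\<in>F. \<psi> x y * a x y * u x * v y) \<le> C * (U * V)"
      by (simp add: mult_right_mono U_def V_def L2_set_nonneg)
  qed
  moreover have "0 \<le> C" unfolding C_def by (intro sum_nonneg) simp
  ultimately show ?thesis by blast
next
  case False
  show ?thesis
  proof (rule ccontr)
    assume no: "\<not> (\<exists>C\<ge>0. schur_bounded \<psi> C)"
    define bad where "bad n F a u v \<longleftrightarrow> finite F \<and> contraction_on F a \<and>
       real n * (L2_set (\<lambda>x. cmod (u x)) F * L2_set (\<lambda>y. cmod (v y)) F)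
         < cmod (\<Sum>x\<in>F. \<Sum>y\<in>F. \<psi> x y * a x y * u x * v y)" for n :: nat and F a u v
    have "\<exists>p. bad n (fst p) (fst (snd p)) (fst (snd (snd p))) (snd (snd (snd p)))" for n
    proof -
      have "\<not> schur_bounded \<psi> (real n)" using no by auto
      then obtain F a u v where "bad n F a u v"
        unfolding schur_bounded_def bad_def by (auto simp: not_le)
      then show ?thesis by (intro exI[of _ "(F, a, u, v)"]) simp
    qed
    then obtain p where p: "\<And>n. bad n (fst (p n)) (fst (snd (p n))) (fst (snd (snd (p n)))) (snd (snd (snd (p n))))"
      using choice[of "\<lambda>n p. bad n (fst p) (fst (snd p)) (fst (snd (snd p))) (snd (snd (snd p)))"] by blast
    define F a u v where "F n = fst (p n)" and "a n = fst (snd (p n))" and "u n = fst (snd (snd (p n)))"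
      and "v n = snd (snd (snd (p n)))" for n
    have F: "\<And>n::nat. finite (F n)" and a: "\<And>n. contraction_on (F n) (a n)"
      and big: "\<And>n. real n * (L2_set (\<lambda>x. cmod (u n x)) (F n) * L2_set (\<lambda>y. cmod (v n y)) (F n))
         < cmod (\<Sum>x\<in>F n. \<Sum>y\<in>F n. \<psi> x y * a n x y * u n x * v n y)"
      using p unfolding bad_def F_def a_def u_def v_def by blast+
    have free: "\<exists>g. (+) g ` F n \<inter> E = {}" if E: "finite E" for E n
    proof -
      have "finite ((\<lambda>(e, f). e - f) ` (E \<times> F n))" using E F by simp
      then obtain g where g: "g \<notin> (\<lambda>(e, f). e - f) ` (E \<times> F n)" using ex_new_if_finite[OF False] by blast
      have "g + f \<notin> E" if "f \<in> F n" for f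
      proof
        assume "g + f \<in> E"
        then have "(g + f) - f \<in> (\<lambda>(e, f). e - f) ` (E \<times> F n)" using that by force
        then show False using g by simp
      qed
      then show ?thesis by blast
    qed
    define sel where "sel n E = (SOME g. (+) g ` F n \<inter> E = {})" for n E
    define E where "E = rec_nat {} (\<lambda>n E. E \<union> (+) (sel n E) ` F n)"
    have ESuc: "E (Suc n) = E n \<union> (+) (sel n (E n)) ` F n" for n by (simp add: E_def)
    have Efin: "finite (E n)" for n by (induction n) (use F in \<open>simp_all add: ESuc\<close>, simp add: E_def)
    define g where "g n = sel n (E n)" for n
    define G where "G n = (+) (g n) ` F n" for n
    have GE: "G n \<inter> E n = {}" for n
      unfolding G_def g_def sel_def using someI_ex[OF free[OF Efin]] by blast
    have Emono: "E m \<subseteq> E n" if "m \<le> n" for m n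
      using that by (induction rule: dec_induct) (auto simp: ESuc)
    have GsubE: "G m \<subseteq> E n" if "m < n" for m n
      using Emono[of "Suc m" n] that by (auto simp: ESuc G_def g_def)
    have disj: "G m \<inter> G n = {}" if "m \<noteq> n" for m n
      using GsubE[of m n] GsubE[of n m] GE[of m] GE[of n] that by (cases m n rule: linorder_cases) blast+
    have re: "(\<Sum>x\<in>G n. h x) = (\<Sum>x\<in>F n. h (g n + x))" for n and h :: "'g \<Rightarrow> 'c::comm_monoid_add"
      unfolding G_def by (subst sum.reindex) (auto simp: inj_on_def)
    have L2re: "L2_set h (G n) = L2_set (\<lambda>x. h (g n + x)) (F n)" for n h
      by (simp add: L2_set_def re)
    have contr: "contraction_on (G n) (\<lambda>x y. a n (- g n + x) (- g n + y))" for n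
      using a[of n] unfolding contraction_on_def re L2re by (simp add: add.assoc[symmetric])
    have Gfin: "finite (G n)" for n using F by (simp add: G_def)
    obtain A where A: "A \<in> bounded_operators ell2"
      "\<And>n x y. x \<in> G n \<Longrightarrow> y \<in> G n \<Longrightarrow> matrix_entry A x y = a n (- g n + x) (- g n + y)"
      using block_diagonal_bounded[of G "\<lambda>n x y. a n (- g n + x) (- g n + y)", OF Gfin disj contr] by metis
    obtain B where B: "B \<in> bounded_operators ell2" "\<And>x y. matrix_entry B x y = \<psi> x y * matrix_entry A x y"
      using mult A(1) unfolding schur_multiplier_def by blast
    obtain K where K: "\<And>f. f \<in> carrier ell2 \<Longrightarrow> hnorm ell2 (B f) \<le> K * hnorm ell2 f"
      using B(1) unfolding bounded_operators_def by blast
    obtain n where n: "K \<le> real n" using real_arch_simple by blast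
    let ?v = "\<lambda>y. v n (- g n + y)" and ?u = "\<lambda>x. u n (- g n + x)"
    let ?f = "\<lambda>z. if z \<in> G n then ?v z else 0"
    have f: "?f \<in> carrier ell2" by (rule ell2_finite_support(1)[OF Gfin])
    have Bf: "B ?f \<in> carrier ell2" using B(1) f unfolding bounded_operators_def by blast
    have nf: "hnorm ell2 ?f = L2_set (\<lambda>y. cmod (?v y)) (G n)"
    proof (rule power2_eq_imp_eq)
      show "(hnorm ell2 ?f)\<^sup>2 = (L2_set (\<lambda>y. cmod (?v y)) (G n))\<^sup>2"
        unfolding L2_set_power2 by (rule ell2_finite_support(2)[OF Gfin])
    qed (simp_all only: hnorm_ell2_nonneg[OF f] L2_set_nonneg)
    have "L2_set (\<lambda>x. cmod (\<Sum>y\<in>G n. \<psi> x y * a n (- g n + x) (- g n + y) * ?v y)) (G n)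
        = L2_set (\<lambda>x. cmod (B ?f x)) (G n)"
      unfolding bounded_operator_ell2_finite_support[OF B(1) Gfin]
      by (intro L2_set_cong refl arg_cong[where f = cmod] sum.cong) (simp add: B(2) A(2))
    also have "\<dots> \<le> hnorm ell2 (B ?f)"
      by (rule power2_le_imp_le) (simp_all add: L2_set_power2 sum_le_hnorm_ell2[OF Bf Gfin] hnorm_ell2_nonneg[OF Bf])
    also have "\<dots> \<le> K * hnorm ell2 ?f" by (rule K[OF f])
    also have "\<dots> \<le> real n * L2_set (\<lambda>y. cmod (?v y)) (G n)"
      unfolding nf by (rule mult_right_mono[OF n L2_set_nonneg])
    finally have le: "L2_set (\<lambda>x. cmod (\<Sum>y\<in>G n. \<psi> x y * a n (- g n + x) (- g n + y) * ?v y)) (G n)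
        \<le> real n * L2_set (\<lambda>y. cmod (?v y)) (G n)" .
    have "cmod (\<Sum>x\<in>G n. \<Sum>y\<in>G n. (\<psi> x y * a n (- g n + x) (- g n + y)) * ?u x * ?v y)
       \<le> L2_set (\<lambda>x. cmod (?u x)) (G n) * (real n * L2_set (\<lambda>y. cmod (?v y)) (G n))"
      by (rule order_trans[OF bilinear_le_L2_set mult_left_mono[OF le L2_set_nonneg]])
    then show False
      using big[of n] unfolding re L2re by (simp add: add.assoc[symmetric] inv mult_ac)
  qed
qed

section \<open>Inner product spaces with explicit carrier\<close>

lemma complex_ring_simps [simp]:
  "carrier complex_ring = UNIV" "x \<otimes>\<^bsub>complex_ring\<^esub> y = x * y" "\<one>\<^bsub>complex_ring\<^esub> = 1"
  "x \<oplus>\<^bsub>complex_ring\<^esub> y = x + y" "\<zero>\<^bsub>complex_ring\<^esub> = 0"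
  by (simp_all add: complex_ring_def)

lemma cring_complex_ring: "cring complex_ring"
proof (rule cringI)
  show "abelian_group complex_ring"
    by (rule abelian_groupI) (auto simp: algebra_simps intro: exI[of _ "- x" for x])
  show "comm_monoid complex_ring" by (rule comm_monoidI) (auto simp: algebra_simps)
qed (auto simp: algebra_simps)

text \<open>A Hilbert space without its completeness axiom, which is the last thing to be checked in
  each construction.\<close>

locale pre_hilbert = Module.module complex_ring H for H :: "'a hilbert" (structure) +
  assumes hinner_add_left:
      "\<lbrakk>x \<in> carrier H; y \<in> carrier H; z \<in> carrier H\<rbrakk> \<Longrightarrow>
        hinner H (x \<oplus> y) z = hinner H x z + hinner H y z"
    and hinner_smult_left:
      "\<lbrakk>x \<in> carrier H; y \<in> carrier H\<rbrakk> \<Longrightarrow> hinner H (c \<odot> x) y = c * hinner H x y"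
    and hinner_cnj:
      "\<lbrakk>x \<in> carrier H; y \<in> carrier H\<rbrakk> \<Longrightarrow> hinner H y x = cnj (hinner H x y)"
    and hinner_nonneg: "x \<in> carrier H \<Longrightarrow> Re (hinner H x x) \<ge> 0"
    and hinner_definite: "\<lbrakk>x \<in> carrier H; hinner H x x = 0\<rbrakk> \<Longrightarrow> x = \<zero>"
begin

lemma smult_in [simp, intro]: "x \<in> carrier H \<Longrightarrow> c \<odot> x \<in> carrier H"
  using smult_closed[of c x] by simp

lemma smult_zero_left [simp]: "x \<in> carrier H \<Longrightarrow> 0 \<odot> x = \<zero>"
  using smult_l_null[of x] by simp

lemma smult_one_left [simp]: "x \<in> carrier H \<Longrightarrow> 1 \<odot> x = x"
  using smult_one[of x] by simp

lemma minus_eq_smult: "x \<in> carrier H \<Longrightarrow> \<ominus> x = (- 1) \<odot> x"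
proof -
  assume x: "x \<in> carrier H"
  have "(- 1) \<odot> x \<oplus> x = (- 1) \<odot> x \<oplus> 1 \<odot> x" using smult_one[OF x] by simp
  also have "\<dots> = (- 1 + 1) \<odot> x" using smult_l_distr[of "- 1" 1 x] x by simp
  also have "\<dots> = \<zero>" using smult_l_null[OF x] by simp
  finally show ?thesis using x by (metis minus_equality smult_in)
qed

lemma hinner_add_right:
  "\<lbrakk>x \<in> carrier H; y \<in> carrier H; z \<in> carrier H\<rbrakk> \<Longrightarrow>
    hinner H z (x \<oplus> y) = hinner H z x + hinner H z y"
  by (simp add: hinner_cnj[of _ z] hinner_add_left)

lemma hinner_smult_right:
  "\<lbrakk>x \<in> carrier H; y \<in> carrier H\<rbrakk> \<Longrightarrow> hinner H x (c \<odot> y) = cnj c * hinner H x y"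
  by (simp add: hinner_cnj[of _ x] hinner_smult_left)

lemma hinner_self: "x \<in> carrier H \<Longrightarrow> hinner H x x = of_real ((hnorm H x)\<^sup>2)"
  using hinner_cnj[of x x] hinner_nonneg[of x] by (simp add: hnorm_def complex_eq_iff)

lemma hnorm_nonneg [simp]: "x \<in> carrier H \<Longrightarrow> 0 \<le> hnorm H x"
  by (simp add: hnorm_def hinner_nonneg)

lemma hnorm_eq_0_iff: "x \<in> carrier H \<Longrightarrow> hnorm H x = 0 \<longleftrightarrow> x = \<zero>"
proof
  assume x: "x \<in> carrier H"
  { assume "hnorm H x = 0" then show "x = \<zero>" using hinner_self[OF x] hinner_definite[OF x] by simp }
  { assume "x = \<zero>"
    then have "x = 0 \<odot> x" using smult_l_null[OF x] by simp
    then have "hinner H x x = 0 * hinner H x x" using hinner_smult_left[OF x x, of 0] by simp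
    then show "hnorm H x = 0" using hinner_self[OF x] by simp }
qed

lemma hnorm_zero [simp]: "hnorm H \<zero> = 0"
  by (simp add: hnorm_eq_0_iff)

lemma hnorm_smult: "x \<in> carrier H \<Longrightarrow> hnorm H (c \<odot> x) = cmod c * hnorm H x"
proof -
  assume x: "x \<in> carrier H"
  have "hinner H (c \<odot> x) (c \<odot> x) = (c * cnj c) * hinner H x x"
    using x by (simp add: hinner_smult_left hinner_smult_right)
  also have "c * cnj c = of_real ((cmod c)\<^sup>2)" by (rule complex_norm_square[symmetric])
  finally have "(hnorm H (c \<odot> x))\<^sup>2 = (cmod c * hnorm H x)\<^sup>2"
    using x by (simp add: hinner_self power_mult_distrib flip: of_real_mult of_real_power)
  then show ?thesis using x by (simp add: power2_eq_iff_nonneg)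
qed

lemma hnorm_minus: "x \<in> carrier H \<Longrightarrow> hnorm H (\<ominus> x) = hnorm H x"
  by (simp add: minus_eq_smult hnorm_smult)

lemma hnorm_add_power2:
  "\<lbrakk>x \<in> carrier H; y \<in> carrier H\<rbrakk> \<Longrightarrow>
    (hnorm H (x \<oplus> y))\<^sup>2 = (hnorm H x)\<^sup>2 + (hnorm H y)\<^sup>2 + 2 * Re (hinner H x y)"
proof -
  assume xy: "x \<in> carrier H" "y \<in> carrier H"
  have "of_real ((hnorm H (x \<oplus> y))\<^sup>2) = hinner H (x \<oplus> y) (x \<oplus> y)"
    by (rule hinner_self[symmetric]) (use xy in simp)
  also have "\<dots> = hinner H x x + hinner H x y + (hinner H y x + hinner H y y)"
    using xy by (simp add: hinner_add_left hinner_add_right)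
  also have "\<dots> = of_real ((hnorm H x)\<^sup>2) + of_real ((hnorm H y)\<^sup>2) + (hinner H x y + cnj (hinner H x y))"
    unfolding hinner_cnj[OF xy] hinner_self[OF xy(1)] hinner_self[OF xy(2)] by simp
  also have "\<dots> = of_real ((hnorm H x)\<^sup>2 + (hnorm H y)\<^sup>2 + 2 * Re (hinner H x y))"
    by (simp add: complex_add_cnj)
  finally show ?thesis by (simp only: of_real_eq_iff)
qed

lemma Cauchy_Schwarz:
  assumes x: "x \<in> carrier H" and y: "y \<in> carrier H"
  shows "cmod (hinner H x y) \<le> hnorm H x * hnorm H y"
proof -
  define f where "f b = (if b then x else y)" for b
  have "psd_kernel (\<lambda>a b. hinner H (f a) (f b))"
  proof -
    have f: "f b \<in> carrier H" for b using x y by (simp add: f_def)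
    have l: "(\<Oplus>i\<in>{..<n}. c i \<odot> f (z i)) \<in> carrier H \<and>
       hinner H (\<Oplus>i\<in>{..<n}. c i \<odot> f (z i)) w = (\<Sum>i<n. c i * hinner H (f (z i)) w)"
      if w: "w \<in> carrier H" for n :: nat and c z w
    proof (induction n)
      case 0
      have "hinner H \<zero> w = 0" using hinner_smult_left[OF w w, of 0] smult_l_null[OF w] by simp
      then show ?case by simp
    next
      case (Suc n)
      have "(\<Oplus>i\<in>{..<Suc n}. c i \<odot> f (z i)) = c n \<odot> f (z n) \<oplus> (\<Oplus>i\<in>{..<n}. c i \<odot> f (z i))"
        unfolding lessThan_Suc by (rule finsum_insert) (auto simp: f)
      then show ?case using Suc f w by (simp add: hinner_add_left hinner_smult_left)
    qed
    have "0 \<le> Re (\<Sum>i<n. \<Sum>j<n. c i * cnj (c j) * hinner H (f (z i)) (f (z j)))" for n :: nat and c z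
    proof -
      let ?s = "\<Oplus>i\<in>{..<n}. c i \<odot> f (z i)"
      have s: "?s \<in> carrier H" using l[OF x, where n = n and c = c and z = z] by blast
      have "hinner H ?s ?s = (\<Sum>i<n. c i * cnj (hinner H ?s (f (z i))))"
        using l[OF s, where n = n and c = c and z = z] hinner_cnj[OF s f] by simp
      also have "\<dots> = (\<Sum>i<n. \<Sum>j<n. c i * cnj (c j) * hinner H (f (z i)) (f (z j)))"
        using l[OF f, where n = n and c = c and z = z]
        by (simp add: sum_distrib_left hinner_cnj[OF f f, symmetric] mult.assoc)
      finally show ?thesis using hinner_nonneg[OF s] by simp
    qed
    then show ?thesis unfolding psd_kernel_def using hinner_cnj[OF f f] by blast
  qed
  from psd_kernel_Cauchy_Schwarz[OF this, of True False]
  have "(cmod (hinner H x y))\<^sup>2 \<le> (hnorm H x * hnorm H y)\<^sup>2"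
    using x y by (simp add: f_def hinner_self power_mult_distrib)
  then show ?thesis by (rule power2_le_imp_le) (use x y in simp)
qed

lemma hnorm_triangle:
  assumes x: "x \<in> carrier H" and y: "y \<in> carrier H"
  shows "hnorm H (x \<oplus> y) \<le> hnorm H x + hnorm H y"
proof (rule power2_le_imp_le)
  have "Re (hinner H x y) \<le> hnorm H x * hnorm H y"
    using Cauchy_Schwarz[OF x y] complex_Re_le_cmod order_trans by blast
  then show "(hnorm H (x \<oplus> y))\<^sup>2 \<le> (hnorm H x + hnorm H y)\<^sup>2"
    unfolding hnorm_add_power2[OF x y] by (simp add: power2_sum)
qed (use x y in simp)

lemma hdist_eq: "\<lbrakk>x \<in> carrier H; y \<in> carrier H\<rbrakk> \<Longrightarrow> hdist H x y = hnorm H (x \<oplus> (- 1) \<odot> y)"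
  by (simp add: hdist_def a_minus_def minus_eq_smult)

lemma hdist_nonneg [simp]: "\<lbrakk>x \<in> carrier H; y \<in> carrier H\<rbrakk> \<Longrightarrow> 0 \<le> hdist H x y"
  by (simp add: hdist_def)

lemma hdist_eq_0_iff: "\<lbrakk>x \<in> carrier H; y \<in> carrier H\<rbrakk> \<Longrightarrow> hdist H x y = 0 \<longleftrightarrow> x = y"
proof -
  assume xy: "x \<in> carrier H" "y \<in> carrier H"
  then have "x \<ominus> y = \<zero> \<longleftrightarrow> x = y"
    by (metis a_minus_def a_inv_closed minus_equality minus_minus r_neg)
  then show ?thesis using xy by (simp add: hdist_def hnorm_eq_0_iff)
qed

lemma hdist_triangle:
  assumes "x \<in> carrier H" "y \<in> carrier H" "z \<in> carrier H"
  shows "hdist H x z \<le> hdist H x y + hdist H y z"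
proof -
  have "x \<ominus> z = (x \<ominus> y) \<oplus> (y \<ominus> z)"
    using assms by (simp add: a_minus_def a_ac r_neg1 r_neg2)
  then show ?thesis unfolding hdist_def using assms hnorm_triangle[of "x \<ominus> y" "y \<ominus> z"] by simp
qed

lemma hdist_commute:
  assumes "x \<in> carrier H" "y \<in> carrier H"
  shows "hdist H x y = hdist H y x"
proof -
  have "y \<ominus> x = \<ominus> (x \<ominus> y)" using assms by (simp add: a_minus_def minus_add a_comm)
  then show ?thesis unfolding hdist_def using assms hnorm_minus[of "x \<ominus> y"] by simp
qed

lemma hnorm_finsum_le:
  assumes "finite A" "\<And>i. i \<in> A \<Longrightarrow> f i \<in> carrier H"
  shows "(\<Oplus>i\<in>A. f i) \<in> carrier H \<and> hnorm H (\<Oplus>i\<in>A. f i) \<le> (\<Sum>i\<in>A. hnorm H (f i))"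
  using assms
proof (induction A rule: finite_induct)
  case (insert a A)
  have "(\<Oplus>i\<in>insert a A. f i) = f a \<oplus> (\<Oplus>i\<in>A. f i)"
    by (rule finsum_insert) (use insert in auto)
  then show ?case using insert hnorm_triangle[of "f a" "\<Oplus>i\<in>A. f i"] by (simp add: add_left_mono order_trans)
qed simp

end

lemma (in pre_hilbert) bounded_operatorE:
  assumes "T \<in> bounded_operators H"
  obtains K where "K \<ge> 0" "\<And>x. x \<in> carrier H \<Longrightarrow> hnorm H (T x) \<le> K * hnorm H x"
proof -
  obtain C where C: "\<And>x. x \<in> carrier H \<Longrightarrow> hnorm H (T x) \<le> C * hnorm H x"
    using assms unfolding bounded_operators_def by blast
  show thesis
  proof (rule that[of "max C 0"])
    show "hnorm H (T x) \<le> max C 0 * hnorm H x" if "x \<in> carrier H" for x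
      using C[OF that] mult_right_mono[OF max.cobounded1[of C 0] hnorm_nonneg[OF that]] by linarith
  qed simp
qed

context pre_hilbert
begin

lemma bounded_operator_closed: "T \<in> bounded_operators H \<Longrightarrow> x \<in> carrier H \<Longrightarrow> T x \<in> carrier H"
  by (auto simp: bounded_operators_def)

lemma bounded_operator_add:
  "T \<in> bounded_operators H \<Longrightarrow> x \<in> carrier H \<Longrightarrow> y \<in> carrier H \<Longrightarrow> T (x \<oplus> y) = T x \<oplus> T y"
  by (auto simp: bounded_operators_def)

lemma bounded_operator_smult:
  "T \<in> bounded_operators H \<Longrightarrow> x \<in> carrier H \<Longrightarrow> T (c \<odot> x) = c \<odot> T x"
  by (auto simp: bounded_operators_def)

lemma bounded_operator_undefined: "T \<in> bounded_operators H \<Longrightarrow> x \<notin> carrier H \<Longrightarrow> T x = undefined"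
  unfolding bounded_operators_def by (blast dest: PiE_arb)

lemma bounded_operatorI:
  assumes "\<And>x. x \<in> carrier H \<Longrightarrow> T x \<in> carrier H"
    and "\<And>x. x \<notin> carrier H \<Longrightarrow> T x = undefined"
    and "\<And>x y. x \<in> carrier H \<Longrightarrow> y \<in> carrier H \<Longrightarrow> T (x \<oplus> y) = T x \<oplus> T y"
    and "\<And>c x. x \<in> carrier H \<Longrightarrow> T (c \<odot> x) = c \<odot> T x"
    and "\<And>x. x \<in> carrier H \<Longrightarrow> hnorm H (T x) \<le> C * hnorm H x"
  shows "T \<in> bounded_operators H"
proof -
  have "T \<in> carrier H \<rightarrow>\<^sub>E carrier H" using assms(1,2) by (simp add: PiE_iff extensional_def)
  then show ?thesis
    unfolding bounded_operators_def by (intro CollectI conjI ballI allI exI[of _ C] assms(3-5))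
qed

lemma op_add_closed:
  assumes S: "S \<in> bounded_operators H" and T: "T \<in> bounded_operators H"
  shows "S \<oplus>\<^bsub>op_algebra H\<^esub> T \<in> bounded_operators H"
proof -
  obtain K L where K: "\<And>x. x \<in> carrier H \<Longrightarrow> hnorm H (S x) \<le> K * hnorm H x"
    and L: "\<And>x. x \<in> carrier H \<Longrightarrow> hnorm H (T x) \<le> L * hnorm H x"
    using bounded_operatorE[OF S] bounded_operatorE[OF T] by metis
  note c = bounded_operator_closed[OF S] bounded_operator_closed[OF T]
  show ?thesis
  proof (rule bounded_operatorI)
    fix x assume x: "x \<in> carrier H"
    show "hnorm H ((S \<oplus>\<^bsub>op_algebra H\<^esub> T) x) \<le> (K + L) * hnorm H x"
      using hnorm_triangle[of "S x" "T x"] K[OF x] L[OF x] x c by (simp add: op_algebra_def distrib_right)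
    fix c' show "(S \<oplus>\<^bsub>op_algebra H\<^esub> T) (c' \<odot> x) = c' \<odot> (S \<oplus>\<^bsub>op_algebra H\<^esub> T) x"
      using x c smult_r_distr[of c' "S x" "T x"]
      by (simp add: op_algebra_def bounded_operator_smult[OF S] bounded_operator_smult[OF T])
  next
    fix x y assume xy: "x \<in> carrier H" "y \<in> carrier H"
    then show "(S \<oplus>\<^bsub>op_algebra H\<^esub> T) (x \<oplus> y) = (S \<oplus>\<^bsub>op_algebra H\<^esub> T) x \<oplus> (S \<oplus>\<^bsub>op_algebra H\<^esub> T) y"
      using c by (simp add: op_algebra_def bounded_operator_add[OF S] bounded_operator_add[OF T] a_ac)
  qed (use c in \<open>auto simp: op_algebra_def\<close>)
qed

lemma op_smult_closed:
  assumes T: "T \<in> bounded_operators H"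
  shows "c \<odot>\<^bsub>op_algebra H\<^esub> T \<in> bounded_operators H"
proof -
  obtain L where L: "\<And>x. x \<in> carrier H \<Longrightarrow> hnorm H (T x) \<le> L * hnorm H x"
    using bounded_operatorE[OF T] by metis
  note cl = bounded_operator_closed[OF T]
  show ?thesis
  proof (rule bounded_operatorI)
    fix x assume x: "x \<in> carrier H"
    show "hnorm H ((c \<odot>\<^bsub>op_algebra H\<^esub> T) x) \<le> (cmod c * L) * hnorm H x"
      using mult_left_mono[OF L[OF x], of "cmod c"] x cl by (simp add: op_algebra_def hnorm_smult)
    fix c' show "(c \<odot>\<^bsub>op_algebra H\<^esub> T) (c' \<odot> x) = c' \<odot> (c \<odot>\<^bsub>op_algebra H\<^esub> T) x"
      using x cl smult_assoc1[of c c' "T x"] smult_assoc1[of c' c "T x"]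
      by (simp add: op_algebra_def bounded_operator_smult[OF T] mult.commute)
  next
    fix x y assume xy: "x \<in> carrier H" "y \<in> carrier H"
    then show "(c \<odot>\<^bsub>op_algebra H\<^esub> T) (x \<oplus> y) = (c \<odot>\<^bsub>op_algebra H\<^esub> T) x \<oplus> (c \<odot>\<^bsub>op_algebra H\<^esub> T) y"
      using cl smult_r_distr[of c "T x" "T y"] by (simp add: op_algebra_def bounded_operator_add[OF T])
  qed (use cl in \<open>auto simp: op_algebra_def\<close>)
qed

lemma op_zero_closed: "\<zero>\<^bsub>op_algebra H\<^esub> \<in> bounded_operators H"
proof (rule bounded_operatorI[where C = 0])
  fix c x assume "x \<in> carrier H"
  then show "\<zero>\<^bsub>op_algebra H\<^esub> (c \<odot> x) = c \<odot> \<zero>\<^bsub>op_algebra H\<^esub> x"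
    using smult_r_null[of c] by (simp add: op_algebra_def)
qed (auto simp: op_algebra_def)

lemma op_algebra_abelian_monoid: "abelian_monoid (op_algebra H)"
proof (rule abelian_monoidI)
  fix S T U
  assume S: "S \<in> carrier (op_algebra H)" and T: "T \<in> carrier (op_algebra H)"
  then have ST: "S \<in> bounded_operators H" "T \<in> bounded_operators H" by (simp_all add: op_algebra_def)
  note c = ST[THEN bounded_operator_closed]
  show "S \<oplus>\<^bsub>op_algebra H\<^esub> T \<in> carrier (op_algebra H)"
    using op_add_closed[OF ST] by (simp add: op_algebra_def)
  show "S \<oplus>\<^bsub>op_algebra H\<^esub> T = T \<oplus>\<^bsub>op_algebra H\<^esub> S"
    using c by (auto simp: op_algebra_def fun_eq_iff a_comm restrict_def)
  assume "U \<in> carrier (op_algebra H)"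
  then have "U \<in> bounded_operators H" by (simp add: op_algebra_def)
  note c' = this[THEN bounded_operator_closed]
  show "S \<oplus>\<^bsub>op_algebra H\<^esub> T \<oplus>\<^bsub>op_algebra H\<^esub> U = S \<oplus>\<^bsub>op_algebra H\<^esub> (T \<oplus>\<^bsub>op_algebra H\<^esub> U)"
    using c c' by (auto simp: op_algebra_def fun_eq_iff a_assoc restrict_def)
next
  fix T assume "T \<in> carrier (op_algebra H)"
  then have T: "T \<in> bounded_operators H" by (simp add: op_algebra_def)
  show "\<zero>\<^bsub>op_algebra H\<^esub> \<oplus>\<^bsub>op_algebra H\<^esub> T = T"
    using bounded_operator_closed[OF T] bounded_operator_undefined[OF T]
    by (auto simp: op_algebra_def fun_eq_iff restrict_def)
next
  show "\<zero>\<^bsub>op_algebra H\<^esub> \<in> carrier (op_algebra H)" using op_zero_closed by (simp add: op_algebra_def)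
qed

lemma matrix_op_norm_bdd_above:
  fixes n :: nat
  assumes A: "\<And>i j. i < n \<Longrightarrow> j < n \<Longrightarrow> A i j \<in> bounded_operators H"
  shows "bdd_above {sqrt (\<Sum>i<n. (hnorm H (finsum H (\<lambda>j. A i j (\<xi> j)) {..<n}))\<^sup>2) |\<xi>.
           (\<forall>j<n. \<xi> j \<in> carrier H) \<and> (\<Sum>j<n. (hnorm H (\<xi> j))\<^sup>2) \<le> 1}"
proof -
  have "\<exists>K. i < n \<longrightarrow> j < n \<longrightarrow> K \<ge> 0 \<and> (\<forall>x\<in>carrier H. hnorm H (A i j x) \<le> K * hnorm H x)" for i j
    using bounded_operatorE[OF A, of i j] by metis
  then obtain K0 where K0: "\<And>i j. i < n \<longrightarrow> j < n \<longrightarrow> K0 i j \<ge> 0 \<and>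
      (\<forall>x\<in>carrier H. hnorm H (A i j x) \<le> K0 i j * hnorm H x)"
    by metis
  then obtain K where K: "\<And>i j. i < n \<Longrightarrow> j < n \<Longrightarrow> K i j \<ge> 0"
    "\<And>i j x. i < n \<Longrightarrow> j < n \<Longrightarrow> x \<in> carrier H \<Longrightarrow> hnorm H (A i j x) \<le> K i j * hnorm H x"
    by blast
  have "sqrt (\<Sum>i<n. (hnorm H (finsum H (\<lambda>j. A i j (\<xi> j)) {..<n}))\<^sup>2) \<le> sqrt (\<Sum>i<n. (\<Sum>j<n. K i j)\<^sup>2)"
    if \<xi>: "\<forall>j<n. \<xi> j \<in> carrier H" "(\<Sum>j<n. (hnorm H (\<xi> j))\<^sup>2) \<le> 1" for \<xi>
  proof (intro real_sqrt_le_mono sum_mono power_mono)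
    fix i assume "i \<in> {..<n}"
    then have i: "i < n" by simp
    have cl: "A i j (\<xi> j) \<in> carrier H" if "j < n" for j
      using bounded_operator_closed[OF A[OF i that]] \<xi>(1) that by blast
    have "hnorm H (\<Oplus>j\<in>{..<n}. A i j (\<xi> j)) \<le> (\<Sum>j<n. hnorm H (A i j (\<xi> j)))"
      using hnorm_finsum_le[of "{..<n}" "\<lambda>j. A i j (\<xi> j)"] cl by simp
    also have "\<dots> \<le> (\<Sum>j<n. K i j)"
    proof (rule sum_mono)
      fix j assume "j \<in> {..<n}"
      then have j: "j < n" by simp
      have "(hnorm H (\<xi> j))\<^sup>2 \<le> (\<Sum>j<n. (hnorm H (\<xi> j))\<^sup>2)" by (rule member_le_sum) (use j in auto)
      then have "(hnorm H (\<xi> j))\<^sup>2 \<le> 1\<^sup>2" using \<xi>(2) by simp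
      then have "hnorm H (\<xi> j) \<le> 1" by (rule power2_le_imp_le) simp
      then have "K i j * hnorm H (\<xi> j) \<le> K i j * 1" using K(1)[OF i j] by (rule mult_left_mono)
      then show "hnorm H (A i j (\<xi> j)) \<le> K i j" using K(2)[OF i j, of "\<xi> j"] \<xi>(1) j by simp
    qed
    finally show "hnorm H (\<Oplus>j\<in>{..<n}. A i j (\<xi> j)) \<le> (\<Sum>j<n. K i j)" .
    show "0 \<le> hnorm H (\<Oplus>j\<in>{..<n}. A i j (\<xi> j))"
      using hnorm_finsum_le[of "{..<n}" "\<lambda>j. A i j (\<xi> j)"] cl by simp
  qed
  then show ?thesis by (intro bdd_aboveI[of _ "sqrt (\<Sum>i<n. (\<Sum>j<n. K i j)\<^sup>2)"]) blast
qed

lemma matrix_op_norm_nonneg: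
  fixes n :: nat
  assumes A: "\<And>i j. i < n \<Longrightarrow> j < n \<Longrightarrow> A i j \<in> bounded_operators H"
  shows "0 \<le> matrix_op_norm H n A"
proof -
  have "sqrt (\<Sum>i<n. (hnorm H (finsum H (\<lambda>j. A i j ((\<lambda>_. \<zero>) j)) {..<n}))\<^sup>2) \<le> matrix_op_norm H n A"
    unfolding matrix_op_norm_def
    by (rule cSup_upper[OF _ matrix_op_norm_bdd_above[OF A]]) (auto intro!: exI[of _ "\<lambda>_. \<zero>"])
  then show ?thesis by (meson order_trans real_sqrt_ge_zero sum_nonneg zero_le_power2)
qed

lemma matrix_op_norm_bound:
  fixes n :: nat
  assumes A: "\<And>i j. i < n \<Longrightarrow> j < n \<Longrightarrow> A i j \<in> bounded_operators H"
    and \<xi>: "\<And>j. j < n \<Longrightarrow> \<xi> j \<in> carrier H"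
  shows "(\<Sum>i<n. (hnorm H (\<Oplus>j\<in>{..<n}. A i j (\<xi> j)))\<^sup>2)
     \<le> (matrix_op_norm H n A)\<^sup>2 * (\<Sum>j<n. (hnorm H (\<xi> j))\<^sup>2)"
proof -
  define s where "s = sqrt (\<Sum>j<n. (hnorm H (\<xi> j))\<^sup>2)"
  have s2: "s\<^sup>2 = (\<Sum>j<n. (hnorm H (\<xi> j))\<^sup>2)" by (simp add: s_def sum_nonneg)
  have cl: "A i j (\<xi> j) \<in> carrier H" if "i < n" "j < n" for i j
    using bounded_operator_closed[OF A[OF that] \<xi>] that by blast
  have scale: "(\<Oplus>j\<in>{..<n}. A i j (of_real t \<odot> \<xi> j)) = of_real t \<odot> (\<Oplus>j\<in>{..<n}. A i j (\<xi> j))" if i: "i < n" for i t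
  proof -
    have "(\<Oplus>j\<in>{..<n}. A i j (of_real t \<odot> \<xi> j)) = (\<Oplus>j\<in>{..<n}. of_real t \<odot> A i j (\<xi> j))"
      by (rule finsum_cong') (use i \<xi> cl bounded_operator_smult[OF A] in auto)
    also have "\<dots> = of_real t \<odot> (\<Oplus>j\<in>{..<n}. A i j (\<xi> j))"
      by (rule finsum_smult_ldistr[symmetric]) (use i cl in auto)
    finally show ?thesis .
  qed
  have fin: "(\<Oplus>j\<in>{..<n}. A i j (\<xi> j)) \<in> carrier H" if "i < n" for i
    using hnorm_finsum_le[of "{..<n}" "\<lambda>j. A i j (\<xi> j)"] cl that by simp
  show ?thesis
  proof (cases "s = 0")
    case True
    then have "\<forall>j<n. hnorm H (\<xi> j) = 0" using s2 by (simp add: sum_nonneg_eq_0_iff)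
    then have z: "of_real 0 \<odot> \<xi> j = \<xi> j" if "j < n" for j
      using \<xi>[OF that] that by (metis hnorm_eq_0_iff of_real_0 smult_zero_left)
    have "hnorm H (\<Oplus>j\<in>{..<n}. A i j (\<xi> j)) = 0" if "i < n" for i
    proof -
      have "(\<Oplus>j\<in>{..<n}. A i j (\<xi> j)) = (\<Oplus>j\<in>{..<n}. A i j (of_real 0 \<odot> \<xi> j))"
        by (rule finsum_cong') (use z cl that in auto)
      then show ?thesis using scale[OF that, of 0] fin[OF that] by (simp add: hnorm_smult)
    qed
    then show ?thesis using True s2 by simp
  next
    case False
    then have s: "s > 0" using s2 by (simp add: s_def sum_nonneg less_le)
    let ?\<xi> = "\<lambda>j. of_real (1 / s) \<odot> \<xi> j"
    have "(\<Sum>j<n. (hnorm H (?\<xi> j))\<^sup>2) = (\<Sum>j<n. (hnorm H (\<xi> j))\<^sup>2 / s\<^sup>2)"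
      using s \<xi> by (intro sum.cong refl) (simp add: hnorm_smult norm_divide power_divide)
    also have "\<dots> = 1" using s by (simp add: sum_divide_distrib[symmetric] s2[symmetric])
    finally have n1: "(\<Sum>j<n. (hnorm H (?\<xi> j))\<^sup>2) = 1" .
    have "sqrt (\<Sum>i<n. (hnorm H (\<Oplus>j\<in>{..<n}. A i j (?\<xi> j)))\<^sup>2) \<le> matrix_op_norm H n A"
      unfolding matrix_op_norm_def
      by (rule cSup_upper[OF _ matrix_op_norm_bdd_above[OF A]])
        (use n1 \<xi> in \<open>auto intro!: exI[of _ ?\<xi>]\<close>)
    then have "(sqrt (\<Sum>i<n. (hnorm H (\<Oplus>j\<in>{..<n}. A i j (?\<xi> j)))\<^sup>2))\<^sup>2 \<le> (matrix_op_norm H n A)\<^sup>2"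
      by (rule power_mono) (simp add: sum_nonneg)
    then have "(\<Sum>i<n. (hnorm H (\<Oplus>j\<in>{..<n}. A i j (?\<xi> j)))\<^sup>2) \<le> (matrix_op_norm H n A)\<^sup>2"
      by (simp add: sum_nonneg)
    moreover have "(\<Sum>i<n. (hnorm H (\<Oplus>j\<in>{..<n}. A i j (?\<xi> j)))\<^sup>2) =
        (\<Sum>i<n. (hnorm H (\<Oplus>j\<in>{..<n}. A i j (\<xi> j)))\<^sup>2) / s\<^sup>2"
      unfolding sum_divide_distrib
      using s fin by (intro sum.cong refl) (simp only: lessThan_iff scale, simp add: hnorm_smult norm_divide power_divide)
    ultimately show ?thesis using s by (simp add: s2[symmetric] divide_le_eq)
  qed
qed

end

text \<open>A subspace of \<open>H\<close>. The distance of a metric space with explicit carrier is required to be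
  nonnegative and symmetric on the whole type. For that reason addition first
  sends all elements outside \<open>S\<close> to zero; then \<open>hdist\<close> of the subspace is the distance in \<open>H\<close> of the
  retracted points.\<close>

definition restrict_hilbert :: "'a hilbert \<Rightarrow> 'a set \<Rightarrow> 'a hilbert" where
  "restrict_hilbert H S =
    \<lparr>carrier = S, mult = mult H, one = one H, zero = zero H,
     add = (\<lambda>x y. (if x \<in> S then x else \<zero>\<^bsub>H\<^esub>) \<oplus>\<^bsub>H\<^esub> (if y \<in> S then y else \<zero>\<^bsub>H\<^esub>)),
     smult = smult H, hinner = hinner H\<rparr>"

lemma restrict_hilbert_simps [simp]:
  "carrier (restrict_hilbert H S) = S" "\<zero>\<^bsub>restrict_hilbert H S\<^esub> = \<zero>\<^bsub>H\<^esub>"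
  "c \<odot>\<^bsub>restrict_hilbert H S\<^esub> x = c \<odot>\<^bsub>H\<^esub> x" "hinner (restrict_hilbert H S) = hinner H"
  "\<lbrakk>x \<in> S; y \<in> S\<rbrakk> \<Longrightarrow> x \<oplus>\<^bsub>restrict_hilbert H S\<^esub> y = x \<oplus>\<^bsub>H\<^esub> y"
  by (simp_all add: restrict_hilbert_def)

lemma hnorm_restrict_hilbert [simp]: "hnorm (restrict_hilbert H S) x = hnorm H x"
  by (simp add: hnorm_def)

locale closed_subspace = pre_hilbert H for H :: "'a hilbert" (structure) +
  fixes S :: "'a set"
  assumes subset: "S \<subseteq> carrier H" and zero_in: "\<zero> \<in> S"
    and add_in: "\<lbrakk>x \<in> S; y \<in> S\<rbrakk> \<Longrightarrow> x \<oplus> y \<in> S"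
    and smult_in_S: "x \<in> S \<Longrightarrow> c \<odot> x \<in> S"
    and Cauchy_convergent: "\<lbrakk>range \<sigma> \<subseteq> S; \<And>e. e > 0 \<Longrightarrow> \<exists>N. \<forall>m\<ge>N. \<forall>n\<ge>N. hdist H (\<sigma> m) (\<sigma> n) < e\<rbrakk>
       \<Longrightarrow> \<exists>x\<in>S. (\<lambda>n::nat. hdist H (\<sigma> n) x) \<longlonglongrightarrow> 0"
begin

lemma in_carrier: "x \<in> S \<Longrightarrow> x \<in> carrier H"
  using subset by blast

abbreviation "HS \<equiv> restrict_hilbert H S"

lemma abelian_group_restrict: "abelian_group HS"
proof (rule abelian_groupI)
  fix x assume x: "x \<in> carrier HS"
  then have "(- 1) \<odot> x \<in> carrier HS" "(- 1) \<odot> x \<oplus>\<^bsub>HS\<^esub> x = \<zero>\<^bsub>HS\<^esub>"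
    using smult_in_S[of x "- 1"] minus_eq_smult[OF in_carrier, of x] l_neg[OF in_carrier, of x] by simp_all
  then show "\<exists>y\<in>carrier HS. y \<oplus>\<^bsub>HS\<^esub> x = \<zero>\<^bsub>HS\<^esub>" by blast
qed (use in_carrier zero_in add_in in \<open>simp_all add: a_ac\<close>)

lemma module_restrict: "Module.module complex_ring HS"
  by (rule moduleI[OF cring_complex_ring abelian_group_restrict])
    (use in_carrier smult_in_S add_in smult_l_distr smult_r_distr smult_assoc1 in simp_all)

lemma pre_hilbert_restrict: "pre_hilbert HS"
proof (intro pre_hilbert.intro module_restrict pre_hilbert_axioms.intro)
  fix x y assume "x \<in> carrier HS" "y \<in> carrier HS"
  then show "hinner HS y x = cnj (hinner HS x y)" using in_carrier by (simp add: hinner_cnj[of x y])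
qed (use in_carrier hinner_add_left hinner_smult_left hinner_nonneg hinner_definite in simp_all)

lemma hdist_restrict_total:
  "hdist HS x y = hdist H (if x \<in> S then x else \<zero>) (if y \<in> S then y else \<zero>)"
proof -
  interpret HS: pre_hilbert HS by (rule pre_hilbert_restrict)
  let ?r = "\<lambda>x. if x \<in> S then x else \<zero>"
  have r: "?r x \<in> S" "?r x \<in> carrier H" for x using zero_in in_carrier by auto
  have "\<ominus>\<^bsub>HS\<^esub> y = (- 1) \<odot> ?r y"
  proof (cases "y \<in> S")
    case True then show ?thesis using HS.minus_eq_smult[of y] by simp
  next
    case False
    have "\<ominus>\<^bsub>HS\<^esub> y = \<ominus>\<^bsub>HS\<^esub> \<zero>"
      unfolding a_inv_def m_inv_def using False zero_in by (simp add: restrict_hilbert_def)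
    then show ?thesis using HS.minus_eq_smult[of "\<zero>"] zero_in False by simp
  qed
  then have "x \<ominus>\<^bsub>HS\<^esub> y = ?r x \<oplus> (- 1) \<odot> ?r y"
    using smult_in_S[OF r(1), of "- 1" y] by (simp add: a_minus_def restrict_hilbert_def)
  then show ?thesis unfolding hdist_eq[OF r(2) r(2)] by (simp add: hdist_def)
qed

lemma hdist_restrict: "\<lbrakk>x \<in> S; y \<in> S\<rbrakk> \<Longrightarrow> hdist HS x y = hdist H x y"
  by (simp add: hdist_restrict_total)

lemma Metric_space_restrict: "Metric_space S (hdist HS)"
proof
  have r: "(if x \<in> S then x else \<zero>) \<in> carrier H" for x using zero_in in_carrier by auto
  fix x y
  show "0 \<le> hdist HS x y" unfolding hdist_restrict_total by (rule hdist_nonneg[OF r r])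
  show "hdist HS x y = hdist HS y x" unfolding hdist_restrict_total by (rule hdist_commute[OF r r])
  { assume "x \<in> S" "y \<in> S"
    then show "hdist HS x y = 0 \<longleftrightarrow> x = y"
      using in_carrier by (simp add: hdist_restrict hdist_eq_0_iff) }
  fix z
  assume "x \<in> S" "y \<in> S" "z \<in> S"
  then show "hdist HS x z \<le> hdist HS x y + hdist HS y z"
    using in_carrier hdist_triangle by (simp add: hdist_restrict)
qed

lemma hilbert_space_restrict: "hilbert_space HS"
proof -
  interpret HS: pre_hilbert HS by (rule pre_hilbert_restrict)
  interpret D: Metric_space S "hdist HS" by (rule Metric_space_restrict)
  have "D.mcomplete"
    unfolding D.mcomplete_def
  proof (intro allI impI)
    fix \<sigma> assume "D.MCauchy \<sigma>"
    then have \<sigma>: "range \<sigma> \<subseteq> S" and ca: "\<And>e. e > 0 \<Longrightarrow> \<exists>N. \<forall>n n'. N \<le> n \<longrightarrow> N \<le> n' \<longrightarrow> hdist HS (\<sigma> n) (\<sigma> n') < e"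
      by (auto simp: D.MCauchy_def)
    have \<sigma>S: "\<sigma> n \<in> S" for n using \<sigma> by blast
    have "\<exists>N. \<forall>m\<ge>N. \<forall>n\<ge>N. hdist H (\<sigma> m) (\<sigma> n) < e" if "e > 0" for e
      using ca[OF that] \<sigma>S by (auto simp: hdist_restrict)
    from Cauchy_convergent[OF \<sigma> this] obtain x where x: "x \<in> S" "(\<lambda>n. hdist H (\<sigma> n) x) \<longlonglongrightarrow> 0" by blast
    have "limitin D.mtopology \<sigma> x sequentially"
      unfolding D.limitin_metric_dist_null using x \<sigma>S by (simp add: hdist_restrict)
    then show "\<exists>x. limitin D.mtopology \<sigma> x sequentially" by blast
  qed
  then show ?thesis
    by (intro hilbert_space.intro module_restrict hilbert_space_axioms.intro HS.hinner_add_left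
        HS.hinner_smult_left HS.hinner_cnj HS.hinner_nonneg HS.hinner_definite) simp_all
qed

end

section \<open>Spaces of square integrable functions\<close>

lemma square_integrable_measurable: "f \<in> square_integrable M \<Longrightarrow> f \<in> borel_measurable M"
  by (simp add: square_integrable_def)

lemma square_integrable_iff_nn_integral:
  "f \<in> square_integrable M \<longleftrightarrow> f \<in> borel_measurable M \<and> (\<integral>\<^sup>+x. ennreal ((cmod (f x))\<^sup>2) \<partial>M) < \<infinity>"
proof (cases "f \<in> borel_measurable M")
  case True
  then have "(\<lambda>x. (cmod (f x))\<^sup>2) \<in> borel_measurable M" by measurable
  then show ?thesis using True by (simp add: square_integrable_def integrable_iff_bounded)
qed (simp add: square_integrable_def)

lemma square_integrable_zero: "(\<lambda>x. 0) \<in> square_integrable M"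
  by (simp add: square_integrable_def)

lemma square_integrable_bound:
  assumes "f \<in> borel_measurable M" "integrable M g" "\<And>x. x \<in> space M \<Longrightarrow> (cmod (f x))\<^sup>2 \<le> g x"
  shows "f \<in> square_integrable M"
  unfolding square_integrable_def
proof (intro CollectI conjI assms(1))
  show "integrable M (\<lambda>x. (cmod (f x))\<^sup>2)"
    by (rule Bochner_Integration.integrable_bound[OF assms(2)])
      (use assms(1,3) in \<open>auto intro!: AE_I2 intro: order_trans[OF _ abs_ge_self]\<close>)
qed

lemma square_integrable_scale: "f \<in> square_integrable M \<Longrightarrow> (\<lambda>x. c * f x) \<in> square_integrable M"
  by (auto simp: square_integrable_def norm_mult power_mult_distrib)

lemma square_integrable_add:
  assumes f: "f \<in> square_integrable M" and g: "g \<in> square_integrable M"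
  shows "(\<lambda>x. f x + g x) \<in> square_integrable M"
proof (rule square_integrable_bound)
  show "(\<lambda>x. f x + g x) \<in> borel_measurable M"
    using f g by (auto simp: square_integrable_def)
  show "integrable M (\<lambda>x. 2 * (cmod (f x))\<^sup>2 + 2 * (cmod (g x))\<^sup>2)"
    using f g by (auto simp: square_integrable_def)
  fix x
  show "(cmod (f x + g x))\<^sup>2 \<le> 2 * (cmod (f x))\<^sup>2 + 2 * (cmod (g x))\<^sup>2"
    by (rule norm_add_power2_le)
qed

lemma square_integrable_diff:
  assumes f: "f \<in> square_integrable M" and g: "g \<in> square_integrable M"
  shows "(\<lambda>x. f x - g x) \<in> square_integrable M"
  using square_integrable_add[OF f square_integrable_scale[OF g, of "- 1"]] by simp

lemma square_integrable_sum:
  "(\<And>i. i \<in> A \<Longrightarrow> f i \<in> square_integrable M) \<Longrightarrow> (\<lambda>x. \<Sum>i\<in>A. f i x) \<in> square_integrable M"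
  by (induction A rule: infinite_finite_induct) (auto intro: square_integrable_zero square_integrable_add)

lemma integrable_mult_cnj:
  assumes f: "f \<in> square_integrable M" and g: "g \<in> square_integrable M"
  shows "integrable M (\<lambda>x. f x * cnj (g x))"
proof (rule Bochner_Integration.integrable_bound)
  show "integrable M (\<lambda>x. (cmod (f x))\<^sup>2 + (cmod (g x))\<^sup>2)"
    using f g by (auto simp: square_integrable_def)
  have "f \<in> borel_measurable M" "(\<lambda>x. cnj (g x)) \<in> borel_measurable M"
    using f g by (auto simp: square_integrable_def intro: borel_measurable_continuous_on[OF continuous_on_cnj[OF continuous_on_id]])
  then show "(\<lambda>x. f x * cnj (g x)) \<in> borel_measurable M" by measurable
  show "AE x in M. norm (f x * cnj (g x)) \<le> norm ((cmod (f x))\<^sup>2 + (cmod (g x))\<^sup>2)"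
  proof (rule AE_I2)
    fix x
    show "norm (f x * cnj (g x)) \<le> norm ((cmod (f x))\<^sup>2 + (cmod (g x))\<^sup>2)"
      using mult_le_power2_sum[of "cmod (f x)" "cmod (g x)"] by (simp add: norm_mult)
  qed
qed

lemma ae_class_cong: "AE x in M. f x = g x \<Longrightarrow> ae_class M f = ae_class M g"
  unfolding ae_class_def by (auto elim: AE_mp[OF _ AE_I2] eventually_elim2)

lemma rep_ae_class:
  assumes "f \<in> borel_measurable M"
  shows "rep (ae_class M f) \<in> borel_measurable M" "AE x in M. rep (ae_class M f) x = f x"
proof -
  have "f \<in> ae_class M f" using assms by (simp add: ae_class_def)
  then have "rep (ae_class M f) \<in> ae_class M f" unfolding rep_def by (rule someI[of "\<lambda>h. h \<in> ae_class M f"])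
  then show "rep (ae_class M f) \<in> borel_measurable M" "AE x in M. rep (ae_class M f) x = f x"
    by (simp_all add: ae_class_def)
qed

lemma square_integrable_AE_cong:
  assumes f: "f \<in> square_integrable M" and g: "g \<in> borel_measurable M" and eq: "AE x in M. g x = f x"
  shows "g \<in> square_integrable M"
proof -
  have "(\<integral>\<^sup>+x. ennreal ((cmod (g x))\<^sup>2) \<partial>M) = (\<integral>\<^sup>+x. ennreal ((cmod (f x))\<^sup>2) \<partial>M)"
    using eq by (intro nn_integral_cong_AE) auto
  then show ?thesis using f g by (simp add: square_integrable_iff_nn_integral)
qed

lemma L2_carrier_simp: "carrier (L2 M) = ae_class M ` square_integrable M"
  by (simp add: L2_def)

lemma ae_class_in_L2 [simp]: "f \<in> square_integrable M \<Longrightarrow> ae_class M f \<in> carrier (L2 M)"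
  by (simp add: L2_carrier_simp)

lemma L2_rep:
  assumes "F \<in> carrier (L2 M)"
  shows "rep F \<in> square_integrable M" "ae_class M (rep F) = F"
proof -
  obtain f where f: "f \<in> square_integrable M" "F = ae_class M f" using assms by (auto simp: L2_carrier_simp)
  note r = rep_ae_class[OF square_integrable_measurable[OF f(1)]]
  show "rep F \<in> square_integrable M" unfolding f(2) by (rule square_integrable_AE_cong[OF f(1) r])
  show "ae_class M (rep F) = F" unfolding f(2) by (rule ae_class_cong[OF r(2)])
qed

lemma L2_zero: "\<zero>\<^bsub>L2 M\<^esub> = ae_class M (\<lambda>x. 0)"
  by (simp add: L2_def)

lemma L2_add:
  assumes f: "f \<in> square_integrable M" and g: "g \<in> square_integrable M"
  shows "ae_class M f \<oplus>\<^bsub>L2 M\<^esub> ae_class M g = ae_class M (\<lambda>x. f x + g x)"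
proof -
  have "AE x in M. rep (ae_class M f) x + rep (ae_class M g) x = f x + g x"
    using rep_ae_class(2)[OF square_integrable_measurable[OF f]] rep_ae_class(2)[OF square_integrable_measurable[OF g]]
    by eventually_elim simp
  then show ?thesis by (simp add: L2_def ae_class_cong)
qed

lemma L2_smult:
  assumes f: "f \<in> square_integrable M"
  shows "c \<odot>\<^bsub>L2 M\<^esub> ae_class M f = ae_class M (\<lambda>x. c * f x)"
proof -
  have "AE x in M. c * rep (ae_class M f) x = c * f x"
    using rep_ae_class(2)[OF square_integrable_measurable[OF f]] by eventually_elim simp
  then show ?thesis by (simp add: L2_def ae_class_cong)
qed

lemma L2_hinner:
  assumes f: "f \<in> square_integrable M" and g: "g \<in> square_integrable M"
  shows "hinner (L2 M) (ae_class M f) (ae_class M g) = (\<integral>x. f x * cnj (g x) \<partial>M)"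
proof -
  note rf = rep_ae_class[OF square_integrable_measurable[OF f]] and rg = rep_ae_class[OF square_integrable_measurable[OF g]]
  have "AE x in M. rep (ae_class M f) x * cnj (rep (ae_class M g) x) = f x * cnj (g x)"
    using rf(2) rg(2) by eventually_elim simp
  moreover have "rep (ae_class M f) \<in> square_integrable M" "rep (ae_class M g) \<in> square_integrable M"
    by (rule L2_rep(1)[OF ae_class_in_L2[OF f]], rule L2_rep(1)[OF ae_class_in_L2[OF g]])
  ultimately show ?thesis
    unfolding L2_def using integrable_mult_cnj f g
    by (auto intro!: integral_cong_AE borel_measurable_integrable)
qed

lemma pre_hilbert_L2: "pre_hilbert (L2 M)"
proof (intro pre_hilbert.intro pre_hilbert_axioms.intro moduleI[OF cring_complex_ring])
  note [simp] = square_integrable_add square_integrable_scale square_integrable_zero L2_add L2_smult L2_zero L2_hinner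
  have ex: "\<exists>f\<in>square_integrable M. F = ae_class M f" if "F \<in> carrier (L2 M)" for F
    using that by (auto simp: L2_carrier_simp)
  show "abelian_group (L2 M)"
  proof (rule abelian_groupI)
    fix F assume "F \<in> carrier (L2 M)"
    then obtain f where f: "f \<in> square_integrable M" "F = ae_class M f" using ex by blast
    then show "\<exists>G\<in>carrier (L2 M). G \<oplus>\<^bsub>L2 M\<^esub> F = \<zero>\<^bsub>L2 M\<^esub>"
      using square_integrable_scale[OF f(1), of "- 1"]
      by (intro bexI[of _ "ae_class M (\<lambda>x. - f x)"]) simp_all
  qed (auto dest!: ex simp: add_ac)
  fix F G
  assume "F \<in> carrier (L2 M)" "G \<in> carrier (L2 M)"
  then obtain f g where fg: "f \<in> square_integrable M" "F = ae_class M f"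
    "g \<in> square_integrable M" "G = ae_class M g" using ex by blast
  show "hinner (L2 M) G F = cnj (hinner (L2 M) F G)"
    using fg Bochner_Integration.integral_cnj[of M "\<lambda>x. f x * cnj (g x)"] by (simp add: mult.commute)
  fix c show "hinner (L2 M) (c \<odot>\<^bsub>L2 M\<^esub> F) G = c * hinner (L2 M) F G"
    using fg integrable_mult_cnj[of f M g] by (simp add: mult.assoc)
  fix E assume "E \<in> carrier (L2 M)"
  then obtain e where e: "e \<in> square_integrable M" "E = ae_class M e" using ex by blast
  show "hinner (L2 M) (F \<oplus>\<^bsub>L2 M\<^esub> G) E = hinner (L2 M) F E + hinner (L2 M) G E"
    using fg e integrable_mult_cnj[of f M e] integrable_mult_cnj[of g M e] by (simp add: distrib_right)
next
  note [simp] = square_integrable_add square_integrable_scale square_integrable_zero L2_add L2_smult L2_zero L2_hinner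
  fix F assume "F \<in> carrier (L2 M)"
  then obtain f where f: "f \<in> square_integrable M" "F = ae_class M f" by (auto simp: L2_carrier_simp)
  have "hinner (L2 M) F F = (\<integral>x. of_real ((cmod (f x))\<^sup>2) \<partial>M)"
    using f by (simp only: L2_hinner complex_norm_square)
  also have "\<dots> = of_real (\<integral>x. (cmod (f x))\<^sup>2 \<partial>M)" by (rule integral_complex_of_real)
  finally have i: "hinner (L2 M) F F = of_real (\<integral>x. (cmod (f x))\<^sup>2 \<partial>M)" .
  then show "0 \<le> Re (hinner (L2 M) F F)" by simp
  { assume "hinner (L2 M) F F = 0"
    then have "(\<integral>x. (cmod (f x))\<^sup>2 \<partial>M) = 0" using i by simp
    then have "AE x in M. (cmod (f x))\<^sup>2 = 0"
      using integral_nonneg_eq_0_iff_AE[of M "\<lambda>x. (cmod (f x))\<^sup>2"] f(1) by (simp add: square_integrable_def)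
    then have "AE x in M. f x = 0" by simp
    then show "F = \<zero>\<^bsub>L2 M\<^esub>" unfolding f(2) L2_zero by (rule ae_class_cong) }
qed (auto simp: L2_carrier_simp square_integrable_add square_integrable_scale L2_add L2_smult algebra_simps)

interpretation L2: pre_hilbert "L2 M" for M :: "'x measure"
  by (rule pre_hilbert_L2)

lemma hnorm_L2_power2: "f \<in> square_integrable M \<Longrightarrow> (hnorm (L2 M) (ae_class M f))\<^sup>2 = (\<integral>x. (cmod (f x))\<^sup>2 \<partial>M)"
proof -
  assume f: "f \<in> square_integrable M"
  have "complex_of_real ((hnorm (L2 M) (ae_class M f))\<^sup>2) = (\<integral>x. f x * cnj (f x) \<partial>M)"
    using L2.hinner_self[of "ae_class M f" M] L2_hinner[OF f f] f by simp
  also have "\<dots> = (\<integral>x. of_real ((cmod (f x))\<^sup>2) \<partial>M)" by (simp only: complex_norm_square)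
  also have "\<dots> = of_real (\<integral>x. (cmod (f x))\<^sup>2 \<partial>M)" by (rule integral_complex_of_real)
  finally show ?thesis by (simp only: of_real_eq_iff)
qed

lemma nn_integral_hnorm_L2:
  "f \<in> square_integrable M \<Longrightarrow> (\<integral>\<^sup>+x. ennreal ((cmod (f x))\<^sup>2) \<partial>M) = ennreal ((hnorm (L2 M) (ae_class M f))\<^sup>2)"
  unfolding hnorm_L2_power2 by (rule nn_integral_eq_integral) (auto simp: square_integrable_def)

lemma hnorm_L2_le:
  assumes f: "f \<in> square_integrable M" and le: "(\<integral>\<^sup>+x. ennreal ((cmod (f x))\<^sup>2) \<partial>M) \<le> ennreal (c\<^sup>2)" and c: "0 \<le> c"
  shows "hnorm (L2 M) (ae_class M f) \<le> c"
proof (rule power2_le_imp_le[OF _ c])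
  show "(hnorm (L2 M) (ae_class M f))\<^sup>2 \<le> c\<^sup>2" using le unfolding nn_integral_hnorm_L2[OF f] by simp
qed

lemma hdist_L2:
  assumes f: "f \<in> square_integrable M" and g: "g \<in> square_integrable M"
  shows "hdist (L2 M) (ae_class M f) (ae_class M g) = hnorm (L2 M) (ae_class M (\<lambda>x. f x - g x))"
  using L2.hdist_eq[of "ae_class M f" M "ae_class M g"] f g
  by (simp add: L2_smult L2_add square_integrable_scale[of g M "- 1", simplified])

lemma finsum_L2:
  assumes "finite A" "\<And>i. i \<in> A \<Longrightarrow> f i \<in> square_integrable M"
  shows "(\<Oplus>\<^bsub>L2 M\<^esub>i\<in>A. ae_class M (f i)) = ae_class M (\<lambda>x. \<Sum>i\<in>A. f i x)"
  using assms
proof (induction A rule: finite_induct)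
  case empty
  then show ?case by (simp add: L2_zero)
next
  case (insert a A)
  have "(\<Oplus>\<^bsub>L2 M\<^esub>i\<in>insert a A. ae_class M (f i)) = ae_class M (f a) \<oplus>\<^bsub>L2 M\<^esub> (\<Oplus>\<^bsub>L2 M\<^esub>i\<in>A. ae_class M (f i))"
    by (rule L2.finsum_insert) (use insert in auto)
  then show ?case using insert by (simp add: L2_add square_integrable_sum)
qed

text \<open>Riesz--Fischer. Along a subsequence with increments \<open>\<Delta>\<^sub>k\<close> of norm at most \<open>2\<^sup>-\<^sup>k\<close>, the integral of
  \<open>\<Sum>\<^sub>k 2\<^sup>k |\<Delta>\<^sub>k|\<^sup>2\<close> is finite, and \<open>2|\<Delta>\<^sub>k| \<le> 2\<^sup>k|\<Delta>\<^sub>k|\<^sup>2 + 2\<^sup>-\<^sup>k\<close> makes the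
  subsequence converge almost everywhere. Fatou's lemma turns this into convergence in norm.\<close>

lemma L2_Cauchy_convergent:
  assumes \<sigma>: "range \<sigma> \<subseteq> carrier (L2 M)"
    and Cau: "\<And>e. e > 0 \<Longrightarrow> \<exists>N. \<forall>m\<ge>N. \<forall>n\<ge>N. hdist (L2 M) (\<sigma> m) (\<sigma> n) < e"
  shows "\<exists>F\<in>carrier (L2 M). (\<lambda>n::nat. hdist (L2 M) (\<sigma> n) F) \<longlonglongrightarrow> 0"
proof -
  define f where "f n = rep (\<sigma> n)" for n
  have \<sigma>c: "\<sigma> n \<in> carrier (L2 M)" for n using \<sigma> by blast
  have f: "f n \<in> square_integrable M" and \<sigma>f: "\<sigma> n = ae_class M (f n)" for n
    using L2_rep[OF \<sigma>c[of n]] by (simp_all add: f_def)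
  note [measurable] = square_integrable_measurable[OF f]
  have hd: "(\<integral>\<^sup>+x. ennreal ((cmod (f m x - f n x))\<^sup>2) \<partial>M) = ennreal ((hdist (L2 M) (\<sigma> m) (\<sigma> n))\<^sup>2)" for m n
    unfolding \<sigma>f hdist_L2[OF f f] by (rule nn_integral_hnorm_L2[OF square_integrable_diff[OF f f]])
  have hd0: "0 \<le> hdist (L2 M) (\<sigma> m) (\<sigma> n)" for m n using \<sigma>c by simp
  have "\<exists>N. \<forall>m\<ge>N. \<forall>n\<ge>N. hdist (L2 M) (\<sigma> m) (\<sigma> n) < (1/2) ^ k" for k :: nat
    by (rule Cau) simp
  then obtain N where N: "\<And>k m n. m \<ge> N k \<Longrightarrow> n \<ge> N k \<Longrightarrow> hdist (L2 M) (\<sigma> m) (\<sigma> n) < (1/2) ^ k"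
    by metis
  (* The partial sum r m dominates N k for every k up to m. *)
  define r where "r k = (\<Sum>i\<le>k. N i)" for k
  have rN: "r m \<ge> N k" if "m \<ge> k" for m k
    unfolding r_def using that by (intro member_le_sum) auto
  define \<Delta> where "\<Delta> k x = f (r (Suc k)) x - f (r k) x" for k x
  have [measurable]: "\<Delta> k \<in> borel_measurable M" for k unfolding \<Delta>_def by measurable
  have \<Delta>_int: "(\<integral>\<^sup>+x. ennreal (2 ^ k * (cmod (\<Delta> k x))\<^sup>2) \<partial>M) \<le> ennreal ((1/2) ^ k)" for k
  proof -
    have "(\<integral>\<^sup>+x. ennreal (2 ^ k * (cmod (\<Delta> k x))\<^sup>2) \<partial>M) = ennreal (2 ^ k) * (\<integral>\<^sup>+x. ennreal ((cmod (\<Delta> k x))\<^sup>2) \<partial>M)"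
      by (simp add: ennreal_mult nn_integral_cmult)
    also have "\<dots> = ennreal (2 ^ k * (hdist (L2 M) (\<sigma> (r (Suc k))) (\<sigma> (r k)))\<^sup>2)"
      unfolding \<Delta>_def hd by (simp add: ennreal_mult)
    also have "\<dots> \<le> ennreal (2 ^ k * ((1/2) ^ k)\<^sup>2)"
      using N[of k "r (Suc k)" "r k"] rN hd0
      by (intro ennreal_leI mult_left_mono power_mono) (auto intro: less_imp_le)
    also have "2 ^ k * ((1/2) ^ k)\<^sup>2 = (1/2 :: real) ^ k"
      by (simp add: power2_eq_square power_one_over field_simps)
    finally show ?thesis .
  qed
  have "(\<integral>\<^sup>+x. (\<Sum>k. ennreal (2 ^ k * (cmod (\<Delta> k x))\<^sup>2)) \<partial>M) = (\<Sum>k. \<integral>\<^sup>+x. ennreal (2 ^ k * (cmod (\<Delta> k x))\<^sup>2) \<partial>M)"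
    by (rule nn_integral_suminf) measurable
  also have "\<dots> \<le> (\<Sum>k. ennreal ((1/2) ^ k))" by (intro suminf_le \<Delta>_int) auto
  also have "\<dots> = ennreal (\<Sum>k. (1/2) ^ k)" by (rule suminf_ennreal2) (auto simp: summable_geometric)
  also have "\<dots> < \<infinity>" by simp
  finally have "AE x in M. (\<Sum>k. ennreal (2 ^ k * (cmod (\<Delta> k x))\<^sup>2)) \<noteq> \<infinity>"
    by (intro nn_integral_PInf_AE) auto
  then have conv: "AE x in M. convergent (\<lambda>k. f (r k) x)"
  proof eventually_elim
    fix x assume "(\<Sum>k. ennreal (2 ^ k * (cmod (\<Delta> k x))\<^sup>2)) \<noteq> \<infinity>"
    then have s: "summable (\<lambda>k. 2 ^ k * (cmod (\<Delta> k x))\<^sup>2)"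
      by (intro summable_suminf_not_top) auto
    have "summable (\<lambda>k. 2 ^ k * (cmod (\<Delta> k x))\<^sup>2 + (1/2) ^ k)"
      by (intro summable_add s summable_geometric) simp
    then have "summable (\<lambda>k. \<Delta> k x)"
    proof (rule summable_comparison_test')
      fix k
      have "2 * ((sqrt 2 ^ k * cmod (\<Delta> k x)) * (sqrt (1/2) ^ k)) \<le> (sqrt 2 ^ k * cmod (\<Delta> k x))\<^sup>2 + (sqrt (1/2) ^ k)\<^sup>2"
        using sum_squares_bound[of "sqrt 2 ^ k * cmod (\<Delta> k x)" "sqrt (1/2) ^ k"] by simp
      also have "\<dots> = 2 ^ k * (cmod (\<Delta> k x))\<^sup>2 + (1/2) ^ k"
        by (simp only: power_mult_distrib power_even_eq[symmetric] power_mult[symmetric] mult.commute[of k 2])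
          (simp add: power_mult)
      also have "(sqrt 2 ^ k * cmod (\<Delta> k x)) * (sqrt (1/2) ^ k) = (sqrt 2 * sqrt (1/2)) ^ k * cmod (\<Delta> k x)"
        by (simp add: power_mult_distrib)
      also have "sqrt 2 * sqrt (1/2) = 1" by (simp add: real_sqrt_mult[symmetric])
      finally have "2 * cmod (\<Delta> k x) \<le> 2 ^ k * (cmod (\<Delta> k x))\<^sup>2 + (1/2) ^ k" by simp
      moreover have "0 \<le> cmod (\<Delta> k x)" by simp
      ultimately show "norm (\<Delta> k x) \<le> 2 ^ k * (cmod (\<Delta> k x))\<^sup>2 + (1/2) ^ k" by linarith
    qed
    then have "convergent (\<lambda>n. \<Sum>k<n. \<Delta> k x)" by (simp add: summable_iff_convergent)
    then have "convergent (\<lambda>n. f (r 0) x + (\<Sum>k<n. \<Delta> k x))"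
      by (intro convergent_add convergent_const)
    moreover have "f (r 0) x + (\<Sum>k<n. \<Delta> k x) = f (r n) x" for n
      unfolding \<Delta>_def using sum_lessThan_telescope[of "\<lambda>k. f (r k) x" n] by simp
    ultimately show "convergent (\<lambda>k. f (r k) x)" by simp
  qed
  define g where "g x = lim (\<lambda>k. f (r k) x)" for x
  have [measurable]: "g \<in> borel_measurable M" unfolding g_def by measurable
  have Fatou: "(\<integral>\<^sup>+x. ennreal ((cmod (f n x - g x))\<^sup>2) \<partial>M) \<le> ennreal (((1/2) ^ k)\<^sup>2)" if n: "n \<ge> N k" for n k
  proof -
    have "(\<integral>\<^sup>+x. ennreal ((cmod (f n x - g x))\<^sup>2) \<partial>M)
        = (\<integral>\<^sup>+x. liminf (\<lambda>j. ennreal ((cmod (f n x - f (r j) x))\<^sup>2)) \<partial>M)"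
    proof (rule nn_integral_cong_AE)
      show "AE x in M. ennreal ((cmod (f n x - g x))\<^sup>2) = liminf (\<lambda>j. ennreal ((cmod (f n x - f (r j) x))\<^sup>2))"
        using conv
      proof eventually_elim
        fix x assume "convergent (\<lambda>k. f (r k) x)"
        then have "(\<lambda>k. f (r k) x) \<longlonglongrightarrow> g x" by (simp add: convergent_LIMSEQ_iff g_def)
        then have "(\<lambda>j. ennreal ((cmod (f n x - f (r j) x))\<^sup>2)) \<longlonglongrightarrow> ennreal ((cmod (f n x - g x))\<^sup>2)"
          by (intro tendsto_ennrealI tendsto_intros)
        then show "ennreal ((cmod (f n x - g x))\<^sup>2) = liminf (\<lambda>j. ennreal ((cmod (f n x - f (r j) x))\<^sup>2))"
          using lim_imp_Liminf trivial_limit_sequentially by metis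
      qed
    qed
    also have "\<dots> \<le> liminf (\<lambda>j. \<integral>\<^sup>+x. ennreal ((cmod (f n x - f (r j) x))\<^sup>2) \<partial>M)"
      by (rule nn_integral_liminf) measurable
    also have "\<dots> \<le> limsup (\<lambda>j. \<integral>\<^sup>+x. ennreal ((cmod (f n x - f (r j) x))\<^sup>2) \<partial>M)"
      by (rule Liminf_le_Limsup) simp
    also have "\<dots> \<le> ennreal (((1/2) ^ k)\<^sup>2)"
    proof (rule Limsup_bounded)
      show "\<forall>\<^sub>F j in sequentially. (\<integral>\<^sup>+x. ennreal ((cmod (f n x - f (r j) x))\<^sup>2) \<partial>M) \<le> ennreal (((1/2) ^ k)\<^sup>2)"
        using eventually_ge_at_top[of k]
      proof eventually_elim
        case (elim j)
        show ?case unfolding hd using N[OF n rN[OF elim]] hd0 by (intro ennreal_leI power_mono) auto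
      qed
    qed
    finally show ?thesis .
  qed
  have g: "g \<in> square_integrable M"
  proof -
    have "(\<lambda>x. f (N 0) x - g x) \<in> square_integrable M"
      using le_less_trans[OF Fatou[of 0 "N 0"]] by (simp add: square_integrable_iff_nn_integral)
    from square_integrable_diff[OF f[of "N 0"] this] show ?thesis by simp
  qed
  have "hdist (L2 M) (\<sigma> n) (ae_class M g) \<le> (1/2) ^ k" if "n \<ge> N k" for n k
    unfolding \<sigma>f hdist_L2[OF f g]
    by (rule hnorm_L2_le[OF square_integrable_diff[OF f g] Fatou[OF that]]) simp
  moreover have "0 \<le> hdist (L2 M) (\<sigma> n) (ae_class M g)" for n using \<sigma>c g by simp
  ultimately have "(\<lambda>n. hdist (L2 M) (\<sigma> n) (ae_class M g)) \<longlonglongrightarrow> 0"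
  proof -
    assume le: "\<And>k n. n \<ge> N k \<Longrightarrow> hdist (L2 M) (\<sigma> n) (ae_class M g) \<le> (1/2) ^ k"
      and nn: "\<And>n. 0 \<le> hdist (L2 M) (\<sigma> n) (ae_class M g)"
    show ?thesis
    proof (rule LIMSEQ_I)
      fix e :: real assume e: "e > 0"
      then obtain k where "(1/2 :: real) ^ k < e" using real_arch_pow_inv[of e "1/2"] by auto
      then show "\<exists>no. \<forall>n\<ge>no. norm (hdist (L2 M) (\<sigma> n) (ae_class M g) - 0) < e"
        using le nn by (intro exI[of _ "N k"]) (auto intro: le_less_trans)
    qed
  qed
  then show ?thesis using g by (intro bexI[of _ "ae_class M g"]) auto
qed

text \<open>For \<open>u\<close> the indicator of \<open>A\<close> this says that the preimage of \<open>A\<close> has measure at most \<open>K\<close> times that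
  of \<open>A\<close>; so composition with \<open>T\<close> respects null sets and is bounded by \<open>\<surd>K\<close> on \<open>L\<^sup>2\<close>. The regular
  representation and the representation to be constructed are both of this form.\<close>

definition quasi_invariant :: "'x measure \<Rightarrow> ('x \<Rightarrow> 'x) \<Rightarrow> real \<Rightarrow> bool" where
  "quasi_invariant M T K \<longleftrightarrow> T \<in> measurable M M \<and> 0 \<le> K \<and>
     (\<forall>u\<in>borel_measurable M. (\<integral>\<^sup>+x. u (T x) \<partial>M) \<le> ennreal K * (\<integral>\<^sup>+x. u x \<partial>M))"

definition composition_op :: "'x measure \<Rightarrow> ('x \<Rightarrow> 'x) \<Rightarrow> ('x \<Rightarrow> complex) set \<Rightarrow> ('x \<Rightarrow> complex) set" where
  "composition_op M T F = ae_class M (\<lambda>x. rep F (T x))"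

context
  fixes M :: "'x measure" and T K
  assumes T: "quasi_invariant M T K"
begin

lemma quasi_invariant_measurable: "T \<in> measurable M M" and quasi_invariant_nonneg: "0 \<le> K"
  and quasi_invariant_nn_integral:
    "u \<in> borel_measurable M \<Longrightarrow> (\<integral>\<^sup>+x. u (T x) \<partial>M) \<le> ennreal K * (\<integral>\<^sup>+x. u x \<partial>M)"
  using T by (auto simp: quasi_invariant_def)

lemma quasi_invariant_AE:
  assumes f: "f \<in> borel_measurable M" and g: "g \<in> borel_measurable M" and ae: "AE x in M. f x = (g x :: complex)"
  shows "AE x in M. f (T x) = g (T x)"
proof -
  note [measurable] = f g quasi_invariant_measurable
  let ?u = "\<lambda>x. ennreal (cmod (f x - g x))"
  have "(\<integral>\<^sup>+x. ?u x \<partial>M) = (\<integral>\<^sup>+x. 0 \<partial>M)" using ae by (intro nn_integral_cong_AE) auto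
  then have "(\<integral>\<^sup>+x. ?u (T x) \<partial>M) \<le> 0" using quasi_invariant_nn_integral[of ?u] by simp
  then have "AE x in M. ?u (T x) = 0" by (subst (asm) le_zero_eq, subst (asm) nn_integral_0_iff_AE) simp_all
  then show ?thesis by simp
qed

lemma square_integrable_compose:
  assumes f: "f \<in> square_integrable M"
  shows "(\<lambda>x. f (T x)) \<in> square_integrable M"
    and "(hnorm (L2 M) (ae_class M (\<lambda>x. f (T x))))\<^sup>2 \<le> K * (hnorm (L2 M) (ae_class M f))\<^sup>2"
proof -
  note [measurable] = square_integrable_measurable[OF f] quasi_invariant_measurable
  have le: "(\<integral>\<^sup>+x. ennreal ((cmod (f (T x)))\<^sup>2) \<partial>M) \<le> ennreal K * (\<integral>\<^sup>+x. ennreal ((cmod (f x))\<^sup>2) \<partial>M)"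
    by (rule quasi_invariant_nn_integral) measurable
  also have "\<dots> = ennreal (K * (hnorm (L2 M) (ae_class M f))\<^sup>2)"
    using quasi_invariant_nonneg by (simp add: nn_integral_hnorm_L2[OF f] ennreal_mult)
  finally have le': "(\<integral>\<^sup>+x. ennreal ((cmod (f (T x)))\<^sup>2) \<partial>M) \<le> ennreal (K * (hnorm (L2 M) (ae_class M f))\<^sup>2)" .
  then show sq: "(\<lambda>x. f (T x)) \<in> square_integrable M"
    unfolding square_integrable_iff_nn_integral by (auto intro: le_less_trans)
  show "(hnorm (L2 M) (ae_class M (\<lambda>x. f (T x))))\<^sup>2 \<le> K * (hnorm (L2 M) (ae_class M f))\<^sup>2"
    using le' quasi_invariant_nonneg unfolding nn_integral_hnorm_L2[OF sq] by simp
qed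

lemma composition_op_class:
  assumes f: "f \<in> square_integrable M"
  shows "composition_op M T (ae_class M f) = ae_class M (\<lambda>x. f (T x))"
  unfolding composition_op_def
  by (rule ae_class_cong, rule quasi_invariant_AE)
    (use rep_ae_class[OF square_integrable_measurable[OF f]] square_integrable_measurable[OF f] in auto)

lemma composition_op_closed: "F \<in> carrier (L2 M) \<Longrightarrow> composition_op M T F \<in> carrier (L2 M)"
  using L2_rep(1)[of F M] square_integrable_compose(1)[of "rep F"] by (simp add: composition_op_def)

lemma composition_op_add:
  "F \<in> carrier (L2 M) \<Longrightarrow> G \<in> carrier (L2 M) \<Longrightarrow>
    composition_op M T (F \<oplus>\<^bsub>L2 M\<^esub> G) = composition_op M T F \<oplus>\<^bsub>L2 M\<^esub> composition_op M T G"
  by (auto simp: L2_carrier_simp composition_op_class L2_add square_integrable_add square_integrable_compose)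

lemma composition_op_smult:
  "F \<in> carrier (L2 M) \<Longrightarrow>
    composition_op M T (c \<odot>\<^bsub>L2 M\<^esub> F) = c \<odot>\<^bsub>L2 M\<^esub> composition_op M T F"
  by (auto simp: L2_carrier_simp composition_op_class L2_smult square_integrable_scale square_integrable_compose)

lemma composition_op_norm:
  "F \<in> carrier (L2 M) \<Longrightarrow> hnorm (L2 M) (composition_op M T F) \<le> sqrt K * hnorm (L2 M) F"
proof -
  assume "F \<in> carrier (L2 M)"
  then obtain f where f: "f \<in> square_integrable M" "F = ae_class M f" by (auto simp: L2_carrier_simp)
  then have "(hnorm (L2 M) (composition_op M T F))\<^sup>2 \<le> (sqrt K * hnorm (L2 M) F)\<^sup>2"
    using square_integrable_compose(2)[OF f(1)] quasi_invariant_nonneg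
    by (simp add: composition_op_class power_mult_distrib)
  then show ?thesis by (rule power2_le_imp_le) (use f quasi_invariant_nonneg in simp)
qed

lemma composition_op_bounded: "restrict (composition_op M T) (carrier (L2 M)) \<in> bounded_operators (L2 M)"
  by (rule L2.bounded_operatorI[where C = "sqrt K"])
    (auto simp: composition_op_closed composition_op_add composition_op_smult composition_op_norm)

end

section \<open>The completely bounded norm controls Schur multiplication\<close>

lemma contraction_on_transpose: "contraction_on F a \<Longrightarrow> contraction_on F (\<lambda>x y. a y x)"
  unfolding contraction_on_def
proof (intro allI)
  fix u v
  assume a: "\<forall>u v. cmod (\<Sum>x\<in>F. \<Sum>y\<in>F. a x y * u x * v y)
       \<le> L2_set (\<lambda>x. cmod (u x)) F * L2_set (\<lambda>y. cmod (v y)) F"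
  have "(\<Sum>x\<in>F. \<Sum>y\<in>F. a y x * u x * v y) = (\<Sum>y\<in>F. \<Sum>x\<in>F. a y x * v y * u x)"
    by (subst sum.swap) (simp add: mult_ac)
  then show "cmod (\<Sum>x\<in>F. \<Sum>y\<in>F. a y x * u x * v y)
       \<le> L2_set (\<lambda>x. cmod (u x)) F * L2_set (\<lambda>y. cmod (v y)) F"
    using a[rule_format, of v u] by (simp add: mult.commute)
qed

lemma contraction_on_bij:
  assumes a: "contraction_on F a" and h: "bij_betw h I F"
  shows "contraction_on I (\<lambda>i j. a (h i) (h j))"
  unfolding contraction_on_def
proof (intro allI)
  fix u v
  let ?g = "inv_into I h"
  have g: "?g (h i) = i" if "i \<in> I" for i
    using h that by (simp add: bij_betw_def inv_into_f_f)
  have "(\<Sum>x\<in>F. \<Sum>y\<in>F. a x y * u (?g x) * v (?g y)) = (\<Sum>i\<in>I. \<Sum>j\<in>I. a (h i) (h j) * u i * v j)"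
    by (simp add: sum.reindex_bij_betw[OF h, symmetric] g)
  moreover have "L2_set (\<lambda>x. cmod (w (?g x))) F = L2_set (\<lambda>i. cmod (w i)) I" for w :: "_ \<Rightarrow> complex"
    by (simp add: L2_set_def sum.reindex_bij_betw[OF h, symmetric] g)
  ultimately show "cmod (\<Sum>i\<in>I. \<Sum>j\<in>I. a (h i) (h j) * u i * v j)
       \<le> L2_set (\<lambda>i. cmod (u i)) I * L2_set (\<lambda>j. cmod (v j)) I"
    using a[unfolded contraction_on_def, rule_format, of "\<lambda>x. u (?g x)" "\<lambda>x. v (?g x)"] by (simp only:)
qed

lemma op_algebra_simps:
  "carrier (op_algebra H) = bounded_operators H"
  "c \<odot>\<^bsub>op_algebra H\<^esub> T = (\<lambda>x\<in>carrier H. c \<odot>\<^bsub>H\<^esub> T x)"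
  "S \<oplus>\<^bsub>op_algebra H\<^esub> T = (\<lambda>x\<in>carrier H. S x \<oplus>\<^bsub>H\<^esub> T x)"
  "\<zero>\<^bsub>op_algebra H\<^esub> = (\<lambda>x\<in>carrier H. \<zero>\<^bsub>H\<^esub>)"
  by (simp_all add: op_algebra_def)

lemma topspace_sigma_weak: "topspace (sigma_weak_topology H) = bounded_operators H"
  by (auto simp: sigma_weak_topology_def Let_def topspace_pullback_topology PiE_def)

context
  fixes \<mu> :: "('g::{topological_group_add, second_countable_topology}) measure"
  assumes haar: "left_haar_measure \<mu>"
begin

lemma haar_sets [measurable_cong, simp]: "sets \<mu> = sets borel"
  using haar by (simp add: left_haar_measure_def)

lemma haar_space [simp]: "space \<mu> = UNIV"
  using sets_eq_imp_space_eq[OF haar_sets] by simp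

lemma measurable_translation: "(\<lambda>x. g + x) \<in> measurable \<mu> \<mu>"
proof -
  have "(\<lambda>x. g + x) \<in> borel_measurable borel"
    by (intro borel_measurable_continuous_onI continuous_intros)
  then show ?thesis by (simp cong: measurable_cong_sets)
qed

lemma nn_integral_translation:
  assumes u: "u \<in> borel_measurable \<mu>"
  shows "(\<integral>\<^sup>+x. u (g + x) \<partial>\<mu>) = (\<integral>\<^sup>+x. u x \<partial>\<mu>)"
proof -
  have "distr \<mu> \<mu> (\<lambda>x. g + x) = \<mu>"
  proof (rule measure_eqI)
    fix A assume "A \<in> sets (distr \<mu> \<mu> (\<lambda>x. g + x))"
    then have A: "A \<in> sets borel" by simp
    have "(\<lambda>x. g + x) -` A = (+) (- g) ` A"
    proof
      show "(\<lambda>x. g + x) -` A \<subseteq> (+) (- g) ` A"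
      proof
        fix x assume "x \<in> (\<lambda>x. g + x) -` A"
        then have "- g + (g + x) \<in> (+) (- g) ` A" by blast
        then show "x \<in> (+) (- g) ` A" by (simp add: add.assoc[symmetric])
      qed
    qed (auto simp: add.assoc[symmetric])
    then show "emeasure (distr \<mu> \<mu> (\<lambda>x. g + x)) A = emeasure \<mu> A"
      using haar A by (simp add: emeasure_distr[OF measurable_translation] left_haar_measure_def)
  qed simp
  then show ?thesis using nn_integral_distr[OF measurable_translation[of g], of u] u by simp
qed

lemma quasi_invariant_translation: "quasi_invariant \<mu> (\<lambda>x. g + x) 1"
  unfolding quasi_invariant_def using measurable_translation nn_integral_translation by auto

lemma left_regular_eq: "left_regular \<mu> g = restrict (composition_op \<mu> (\<lambda>x. - g + x)) (carrier (L2 \<mu>))"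
  by (simp add: left_regular_def composition_op_def fun_eq_iff)

lemma left_regular_class:
  "f \<in> square_integrable \<mu> \<Longrightarrow> left_regular \<mu> g (ae_class \<mu> f) = ae_class \<mu> (\<lambda>x. f (- g + x))"
  by (simp add: left_regular_eq composition_op_class[OF quasi_invariant_translation])

lemma square_integrable_translate:
  "f \<in> square_integrable \<mu> \<Longrightarrow> (\<lambda>x. f (g + x)) \<in> square_integrable \<mu>"
  by (rule square_integrable_compose(1)[OF quasi_invariant_translation])

lemma hnorm_translate:
  assumes f: "f \<in> square_integrable \<mu>"
  shows "hnorm (L2 \<mu>) (ae_class \<mu> (\<lambda>x. f (g + x))) = hnorm (L2 \<mu>) (ae_class \<mu> f)"
proof -
  note [measurable] = square_integrable_measurable[OF f]
  have "(\<integral>\<^sup>+x. ennreal ((cmod (f (g + x)))\<^sup>2) \<partial>\<mu>) = (\<integral>\<^sup>+x. ennreal ((cmod (f x))\<^sup>2) \<partial>\<mu>)"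
    by (rule nn_integral_translation) measurable
  then have "(hnorm (L2 \<mu>) (ae_class \<mu> (\<lambda>x. f (g + x))))\<^sup>2 = (hnorm (L2 \<mu>) (ae_class \<mu> f))\<^sup>2"
    using f by (simp add: nn_integral_hnorm_L2 square_integrable_translate)
  then show ?thesis using f by (simp add: square_integrable_translate power2_eq_iff_nonneg)
qed

lemma left_regular_bounded: "left_regular \<mu> g \<in> bounded_operators (L2 \<mu>)"
  unfolding left_regular_eq by (rule composition_op_bounded[OF quasi_invariant_translation])

definition "regular_span = {finsum (op_algebra (L2 \<mu>)) (\<lambda>g. c g \<odot>\<^bsub>op_algebra (L2 \<mu>)\<^esub> left_regular \<mu> g) F |c F. finite F}"

lemma group_vN_eq: "group_vN \<mu> = sigma_weak_topology (L2 \<mu>) closure_of regular_span"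
  by (simp add: group_vN_def regular_span_def)

lemma regular_span_bounded: "regular_span \<subseteq> bounded_operators (L2 \<mu>)"
proof -
  interpret op: abelian_monoid "op_algebra (L2 \<mu>)" by (rule L2.op_algebra_abelian_monoid)
  show ?thesis
    unfolding regular_span_def
    by (auto intro!: op.finsum_closed[unfolded op_algebra_simps(1)] L2.op_smult_closed[OF left_regular_bounded])
qed

lemma group_vN_bounded: "group_vN \<mu> \<subseteq> bounded_operators (L2 \<mu>)"
  using closure_of_subset_topspace[of "sigma_weak_topology (L2 \<mu>)" regular_span]
  by (simp add: group_vN_eq topspace_sigma_weak)

lemma regular_span_subset_group_vN: "regular_span \<subseteq> group_vN \<mu>"
  unfolding group_vN_eq by (rule closure_of_subset) (simp add: topspace_sigma_weak regular_span_bounded)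

lemma smult_left_regular_in_span: "c \<odot>\<^bsub>op_algebra (L2 \<mu>)\<^esub> left_regular \<mu> g \<in> regular_span"
proof -
  interpret op: abelian_monoid "op_algebra (L2 \<mu>)" by (rule L2.op_algebra_abelian_monoid)
  have c: "c \<odot>\<^bsub>op_algebra (L2 \<mu>)\<^esub> left_regular \<mu> g \<in> carrier (op_algebra (L2 \<mu>))"
    using L2.op_smult_closed[OF left_regular_bounded] by (simp add: op_algebra_simps(1))
  have "finsum (op_algebra (L2 \<mu>)) (\<lambda>g. c \<odot>\<^bsub>op_algebra (L2 \<mu>)\<^esub> left_regular \<mu> g) (insert g {})
     = c \<odot>\<^bsub>op_algebra (L2 \<mu>)\<^esub> left_regular \<mu> g \<oplus>\<^bsub>op_algebra (L2 \<mu>)\<^esub>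
       finsum (op_algebra (L2 \<mu>)) (\<lambda>g. c \<odot>\<^bsub>op_algebra (L2 \<mu>)\<^esub> left_regular \<mu> g) {}"
    by (rule op.finsum_insert) (use c in auto)
  also have "\<dots> = c \<odot>\<^bsub>op_algebra (L2 \<mu>)\<^esub> left_regular \<mu> g" using c by simp
  finally show ?thesis
    unfolding regular_span_def by (intro CollectI exI[of _ "\<lambda>_. c"] exI[of _ "{g}"]) simp
qed

lemma left_regular_in_group_vN: "left_regular \<mu> g \<in> group_vN \<mu>"
proof -
  have "1 \<odot>\<^bsub>op_algebra (L2 \<mu>)\<^esub> left_regular \<mu> g = left_regular \<mu> g"
    using L2.bounded_operator_closed[OF left_regular_bounded] L2.bounded_operator_undefined[OF left_regular_bounded]
    by (auto simp: op_algebra_simps fun_eq_iff)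
  then show ?thesis using smult_left_regular_in_span[of 1 g] regular_span_subset_group_vN by auto
qed

lemma smult_left_regular_class:
  assumes f: "f \<in> square_integrable \<mu>"
  shows "(c \<odot>\<^bsub>op_algebra (L2 \<mu>)\<^esub> left_regular \<mu> g) (ae_class \<mu> f) = ae_class \<mu> (\<lambda>x. c * f (- g + x))"
  using f by (simp add: op_algebra_simps left_regular_class L2_smult square_integrable_translate)

text \<open>The matrix is \<open>D\<^sup>*(a \<otimes> 1)D\<close> with the unitary diagonal matrix \<open>D\<close> of entries \<open>\<lambda>(h j)\<close>. So it
  suffices to apply the contraction \<open>a\<close> pointwise to the translated functions.\<close>

lemma matrix_op_norm_translations_le_1:
  assumes a: "contraction_on {..<n} a"
  shows "matrix_op_norm (L2 \<mu>) n
    (\<lambda>i j. a i j \<odot>\<^bsub>op_algebra (L2 \<mu>)\<^esub> left_regular \<mu> (- h i + h j)) \<le> 1"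
  unfolding matrix_op_norm_def
proof (rule cSup_least)
  show "{sqrt (\<Sum>i<n. (hnorm (L2 \<mu>) (finsum (L2 \<mu>) (\<lambda>j. (a i j \<odot>\<^bsub>op_algebra (L2 \<mu>)\<^esub> left_regular \<mu> (- h i + h j)) (\<xi> j)) {..<n}))\<^sup>2) |\<xi>.
           (\<forall>j<n. \<xi> j \<in> carrier (L2 \<mu>)) \<and> (\<Sum>j<n. (hnorm (L2 \<mu>) (\<xi> j))\<^sup>2) \<le> 1} \<noteq> {}"
    by (auto intro!: exI[of _ "\<lambda>_. \<zero>\<^bsub>L2 \<mu>\<^esub>"])
  fix s
  assume "s \<in> {sqrt (\<Sum>i<n. (hnorm (L2 \<mu>) (finsum (L2 \<mu>) (\<lambda>j. (a i j \<odot>\<^bsub>op_algebra (L2 \<mu>)\<^esub> left_regular \<mu> (- h i + h j)) (\<xi> j)) {..<n}))\<^sup>2) |\<xi>.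
           (\<forall>j<n. \<xi> j \<in> carrier (L2 \<mu>)) \<and> (\<Sum>j<n. (hnorm (L2 \<mu>) (\<xi> j))\<^sup>2) \<le> 1}"
  then obtain \<xi> where s: "s = sqrt (\<Sum>i<n. (hnorm (L2 \<mu>) (finsum (L2 \<mu>) (\<lambda>j. (a i j \<odot>\<^bsub>op_algebra (L2 \<mu>)\<^esub> left_regular \<mu> (- h i + h j)) (\<xi> j)) {..<n}))\<^sup>2)"
    and \<xi>: "\<forall>j<n. \<xi> j \<in> carrier (L2 \<mu>)" and le: "(\<Sum>j<n. (hnorm (L2 \<mu>) (\<xi> j))\<^sup>2) \<le> 1" by blast
  define f where "f j = rep (\<xi> j)" for j
  have f: "f j \<in> square_integrable \<mu>" and \<xi>f: "\<xi> j = ae_class \<mu> (f j)" if "j < n" for j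
    using L2_rep[of "\<xi> j" \<mu>] \<xi> that by (auto simp: f_def)
  define k where "k j x = f j (- h j + x)" for j x
  have k: "k j \<in> square_integrable \<mu>" if "j < n" for j
    unfolding k_def by (rule square_integrable_translate[OF f[OF that]])
  define w where "w i x = (\<Sum>j<n. a i j * k j x)" for i x
  have w: "w i \<in> square_integrable \<mu>" for i
    unfolding w_def by (intro square_integrable_sum square_integrable_scale k) simp
  note [measurable] = square_integrable_measurable[OF w]
  have row: "finsum (L2 \<mu>) (\<lambda>j. (a i j \<odot>\<^bsub>op_algebra (L2 \<mu>)\<^esub> left_regular \<mu> (- h i + h j)) (\<xi> j)) {..<n}
     = ae_class \<mu> (\<lambda>x. w i (h i + x))" for i
  proof -
    have e: "- (- h i + h j) + x = - h j + (h i + x)" for j x by (simp add: minus_add add.assoc)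
    have sq: "(\<lambda>x. a i j * k j (h i + x)) \<in> square_integrable \<mu>" if "j < n" for j
      by (intro square_integrable_scale square_integrable_translate k that)
    have "finsum (L2 \<mu>) (\<lambda>j. (a i j \<odot>\<^bsub>op_algebra (L2 \<mu>)\<^esub> left_regular \<mu> (- h i + h j)) (\<xi> j)) {..<n}
       = finsum (L2 \<mu>) (\<lambda>j. ae_class \<mu> (\<lambda>x. a i j * k j (h i + x))) {..<n}"
      by (rule L2.finsum_cong') (use sq in \<open>auto simp: \<xi>f smult_left_regular_class f k_def e\<close>)
    also have "\<dots> = ae_class \<mu> (\<lambda>x. \<Sum>j<n. a i j * k j (h i + x))"
      by (rule finsum_L2) (use sq in auto)
    finally show ?thesis by (simp add: w_def)
  qed
  have "ennreal (\<Sum>i<n. (hnorm (L2 \<mu>) (ae_class \<mu> (\<lambda>x. w i (h i + x))))\<^sup>2)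
      = (\<Sum>i<n. \<integral>\<^sup>+x. ennreal ((cmod (w i x))\<^sup>2) \<partial>\<mu>)"
    by (simp add: hnorm_translate[OF w] nn_integral_hnorm_L2[OF w] sum_ennreal)
  also have "\<dots> = (\<integral>\<^sup>+x. (\<Sum>i<n. ennreal ((cmod (w i x))\<^sup>2)) \<partial>\<mu>)"
    by (rule nn_integral_sum[symmetric]) measurable
  also have "\<dots> \<le> (\<integral>\<^sup>+x. (\<Sum>j<n. ennreal ((cmod (k j x))\<^sup>2)) \<partial>\<mu>)"
  proof (rule nn_integral_mono)
    fix x
    show "(\<Sum>i<n. ennreal ((cmod (w i x))\<^sup>2)) \<le> (\<Sum>j<n. ennreal ((cmod (k j x))\<^sup>2))"
      using contraction_on_row_bound[OF a, of "\<lambda>j. k j x"] by (simp add: w_def sum_ennreal ennreal_leI)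
  qed
  also have "\<dots> = (\<Sum>j<n. \<integral>\<^sup>+x. ennreal ((cmod (k j x))\<^sup>2) \<partial>\<mu>)"
  proof (rule nn_integral_sum)
    fix j assume "j \<in> {..<n}"
    then have [measurable]: "k j \<in> borel_measurable \<mu>" using k square_integrable_measurable by blast
    show "(\<lambda>x. ennreal ((cmod (k j x))\<^sup>2)) \<in> borel_measurable \<mu>" by measurable
  qed
  also have "\<dots> = (\<Sum>j<n. ennreal ((hnorm (L2 \<mu>) (\<xi> j))\<^sup>2))"
  proof (rule sum.cong[OF refl])
    fix j assume "j \<in> {..<n}"
    then have j: "j < n" by simp
    show "(\<integral>\<^sup>+x. ennreal ((cmod (k j x))\<^sup>2) \<partial>\<mu>) = ennreal ((hnorm (L2 \<mu>) (\<xi> j))\<^sup>2)"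
      unfolding nn_integral_hnorm_L2[OF k[OF j]] unfolding k_def hnorm_translate[OF f[OF j]] \<xi>f[OF j] ..
  qed
  also have "\<dots> = ennreal (\<Sum>j<n. (hnorm (L2 \<mu>) (\<xi> j))\<^sup>2)" by (simp add: sum_ennreal)
  also have "\<dots> \<le> ennreal 1" by (rule ennreal_leI[OF le])
  finally show "s \<le> 1" unfolding s row by (simp flip: ennreal_1)
qed

text \<open>Apply \<open>\<Phi>\<close> to the entries of the preceding matrix, with \<open>h\<close> an enumeration of a finite subset of
  the group. The result is \<open>D\<^sup>*((\<psi>a) \<otimes> 1)D\<close>, which acts on the vectors \<open>u\<^sub>j \<lambda>(h j)\<inverse>f\<^sub>0\<close> as
  the scalar matrix \<open>\<psi>a\<close> acts on \<open>u\<close>. The indices are transposed since \<open>\<psi>\<close> is evaluated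
  at the pair (column, row).\<close>

lemma fourier_multiplier_schur_bounded:
  assumes \<Phi>: "fourier_multiplier_map \<mu> \<phi> \<Phi>"
    and f0: "f0 \<in> square_integrable \<mu>" "hnorm (L2 \<mu>) (ae_class \<mu> f0) = 1"
  shows "schur_bounded (\<lambda>x y. \<phi> (- y + x)) (cb_norm (L2 \<mu>) (group_vN \<mu>) \<Phi>)"
    and "0 \<le> cb_norm (L2 \<mu>) (group_vN \<mu>) \<Phi>"
proof -
  define V where "V = group_vN \<mu>"
  define C where "C = cb_norm (L2 \<mu>) V \<Phi>"
  have \<Phi>V: "\<Phi> T \<in> V" if "T \<in> V" for T
    using \<Phi> that unfolding fourier_multiplier_map_def V_def by blast
  have V_bd: "T \<in> bounded_operators (L2 \<mu>)" if "T \<in> V" for T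
    using that group_vN_bounded unfolding V_def by blast
  have \<Phi>_smult: "\<Phi> (c \<odot>\<^bsub>op_algebra (L2 \<mu>)\<^esub> T) = c \<odot>\<^bsub>op_algebra (L2 \<mu>)\<^esub> \<Phi> T" if "T \<in> V" for c T
    using \<Phi> that unfolding fourier_multiplier_map_def completely_bounded_def linear_on_ops_def V_def by blast
  have \<Phi>_reg: "\<Phi> (left_regular \<mu> g) = \<phi> g \<odot>\<^bsub>op_algebra (L2 \<mu>)\<^esub> left_regular \<mu> g" for g
    using \<Phi> unfolding fourier_multiplier_map_def by blast
  obtain K where K: "\<And>n A. (\<forall>i<n. \<forall>j<n. A i j \<in> V) \<Longrightarrow>
       matrix_op_norm (L2 \<mu>) n (\<lambda>i j. \<Phi> (A i j)) \<le> K * matrix_op_norm (L2 \<mu>) n A"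
    using \<Phi> unfolding fourier_multiplier_map_def completely_bounded_def V_def by blast
  have bdd: "bdd_above {matrix_op_norm (L2 \<mu>) n (\<lambda>i j. \<Phi> (A i j)) |n A.
           (\<forall>i<n. \<forall>j<n. A i j \<in> V) \<and> matrix_op_norm (L2 \<mu>) n A \<le> 1}"
  proof (rule bdd_aboveI[of _ "\<bar>K\<bar>"])
    fix s assume "s \<in> {matrix_op_norm (L2 \<mu>) n (\<lambda>i j. \<Phi> (A i j)) |n A.
           (\<forall>i<n. \<forall>j<n. A i j \<in> V) \<and> matrix_op_norm (L2 \<mu>) n A \<le> 1}"
    then obtain n A where A: "\<forall>i<n. \<forall>j<n. A i j \<in> V" "matrix_op_norm (L2 \<mu>) n A \<le> 1"
      and s: "s = matrix_op_norm (L2 \<mu>) n (\<lambda>i j. \<Phi> (A i j))" by blast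
    have nn: "0 \<le> matrix_op_norm (L2 \<mu>) n A"
      by (rule L2.matrix_op_norm_nonneg) (use A(1) V_bd in blast)
    have "s \<le> K * matrix_op_norm (L2 \<mu>) n A" unfolding s by (rule K[OF A(1)])
    also have "\<dots> \<le> \<bar>K\<bar> * matrix_op_norm (L2 \<mu>) n A" using nn by (intro mult_right_mono) auto
    also have "\<dots> \<le> \<bar>K\<bar> * 1" using A(2) by (rule mult_left_mono) simp
    finally show "s \<le> \<bar>K\<bar>" by simp
  qed
  have C_upper: "matrix_op_norm (L2 \<mu>) n (\<lambda>i j. \<Phi> (A i j)) \<le> C"
    if "\<forall>i<n. \<forall>j<n. A i j \<in> V" "matrix_op_norm (L2 \<mu>) n A \<le> 1" for n A
    unfolding C_def cb_norm_def by (rule cSup_upper[OF _ bdd]) (use that in blast)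
  show C0: "0 \<le> cb_norm (L2 \<mu>) (group_vN \<mu>) \<Phi>"
  proof -
    have "matrix_op_norm (L2 \<mu>) 0 (\<lambda>i j. \<Phi> undefined) = 0" "matrix_op_norm (L2 \<mu>) 0 (\<lambda>i j. undefined) = 0"
      by (simp_all add: matrix_op_norm_def)
    then show ?thesis using C_upper[of 0 "\<lambda>i j. undefined"] by (simp add: C_def V_def)
  qed
  show "schur_bounded (\<lambda>x y. \<phi> (- y + x)) (cb_norm (L2 \<mu>) (group_vN \<mu>) \<Phi>)"
    unfolding schur_bounded_def V_def[symmetric] C_def[symmetric]
  proof (intro allI impI)
    fix F :: "'g set" and a and u v :: "'g \<Rightarrow> complex"
    assume F: "finite F" and a: "contraction_on F a"
    obtain h where h: "bij_betw h {..<card F} F"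
      using ex_bij_betw_nat_finite[OF F] by (auto simp: lessThan_atLeast0)
    define n where "n = card F"
    note h = h[folded n_def]
    define b where "b i j = a (h j) (h i)" for i j
    have b: "contraction_on {..<n} b"
      unfolding b_def by (rule contraction_on_bij[OF contraction_on_transpose[OF a] h])
    define A where "A i j = b i j \<odot>\<^bsub>op_algebra (L2 \<mu>)\<^esub> left_regular \<mu> (- h i + h j)" for i j
    have AV: "A i j \<in> V" for i j
      using smult_left_regular_in_span regular_span_subset_group_vN by (auto simp: A_def V_def)
    have \<Phi>A: "\<Phi> (A i j) (ae_class \<mu> f) = ae_class \<mu> (\<lambda>x. b i j * \<phi> (- h i + h j) * f (- (- h i + h j) + x))"
      if f: "f \<in> square_integrable \<mu>" for i j f
    proof -
      have "\<Phi> (A i j) = b i j \<odot>\<^bsub>op_algebra (L2 \<mu>)\<^esub> (\<phi> (- h i + h j) \<odot>\<^bsub>op_algebra (L2 \<mu>)\<^esub> left_regular \<mu> (- h i + h j))"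
        unfolding A_def using \<Phi>_smult left_regular_in_group_vN by (simp add: V_def \<Phi>_reg)
      then have "\<Phi> (A i j) (ae_class \<mu> f) = b i j \<odot>\<^bsub>L2 \<mu>\<^esub>
          ((\<phi> (- h i + h j) \<odot>\<^bsub>op_algebra (L2 \<mu>)\<^esub> left_regular \<mu> (- h i + h j)) (ae_class \<mu> f))"
        using f by (simp add: op_algebra_simps)
      then show ?thesis
        using f by (simp add: smult_left_regular_class L2_smult square_integrable_scale square_integrable_translate mult.assoc)
    qed
    have norm_le: "matrix_op_norm (L2 \<mu>) n (\<lambda>i j. \<Phi> (A i j)) \<le> C"
      by (rule C_upper) (use AV matrix_op_norm_translations_le_1[OF b, of h] in \<open>auto simp: A_def\<close>)
    have norm_0: "0 \<le> matrix_op_norm (L2 \<mu>) n (\<lambda>i j. \<Phi> (A i j))"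
      by (rule L2.matrix_op_norm_nonneg) (use AV \<Phi>V V_bd in blast)
    let ?B = "\<lambda>i j. \<phi> (- h i + h j) * b i j"
    let ?u = "\<lambda>j. u (h j)" and ?v = "\<lambda>i. v (h i)"
    have rows: "(\<Sum>i<n. (cmod (\<Sum>j<n. ?B i j * ?u j))\<^sup>2) \<le> C\<^sup>2 * (\<Sum>j<n. (cmod (?u j))\<^sup>2)"
    proof -
      define \<xi> where "\<xi> j = ae_class \<mu> (\<lambda>x. ?u j * f0 (h j + x))" for j
      have sq: "(\<lambda>x. c * f0 (g + x)) \<in> square_integrable \<mu>" for c g
        by (intro square_integrable_scale square_integrable_translate f0(1))
      have nrm: "hnorm (L2 \<mu>) (ae_class \<mu> (\<lambda>x. c * f0 (g + x))) = cmod c" for c g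
        using L2.hnorm_smult[of "ae_class \<mu> (\<lambda>x. f0 (g + x))" \<mu> c] hnorm_translate[OF f0(1), of g] f0
        by (simp add: L2_smult square_integrable_translate)
      have "finsum (L2 \<mu>) (\<lambda>j. \<Phi> (A i j) (\<xi> j)) {..<n} = ae_class \<mu> (\<lambda>x. (\<Sum>j<n. ?B i j * ?u j) * f0 (h i + x))" for i
      proof -
        have e: "h j + (- (- h i + h j) + x) = h i + x" for j x
          by (simp add: minus_add add.assoc[symmetric])
        have "finsum (L2 \<mu>) (\<lambda>j. \<Phi> (A i j) (\<xi> j)) {..<n}
            = finsum (L2 \<mu>) (\<lambda>j. ae_class \<mu> (\<lambda>x. ?B i j * ?u j * f0 (h i + x))) {..<n}"
          unfolding \<xi>_def \<Phi>A[OF sq] e by (simp add: mult_ac)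
        also have "\<dots> = ae_class \<mu> (\<lambda>x. \<Sum>j<n. ?B i j * ?u j * f0 (h i + x))"
          by (rule finsum_L2) (use sq in auto)
        finally show ?thesis by (simp add: sum_distrib_right)
      qed
      then have "(\<Sum>i<n. (cmod (\<Sum>j<n. ?B i j * ?u j))\<^sup>2)
          = (\<Sum>i<n. (hnorm (L2 \<mu>) (finsum (L2 \<mu>) (\<lambda>j. \<Phi> (A i j) (\<xi> j)) {..<n}))\<^sup>2)"
        by (simp add: nrm)
      also have "\<dots> \<le> (matrix_op_norm (L2 \<mu>) n (\<lambda>i j. \<Phi> (A i j)))\<^sup>2 * (\<Sum>j<n. (hnorm (L2 \<mu>) (\<xi> j))\<^sup>2)"
        by (rule L2.matrix_op_norm_bound) (use AV \<Phi>V V_bd sq in \<open>auto simp: \<xi>_def\<close>)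
      also have "\<dots> \<le> C\<^sup>2 * (\<Sum>j<n. (hnorm (L2 \<mu>) (\<xi> j))\<^sup>2)"
        by (intro mult_right_mono power_mono norm_le norm_0 sum_nonneg) simp
      finally show ?thesis by (simp add: \<xi>_def nrm)
    qed
    have "(L2_set (\<lambda>i. cmod (\<Sum>j<n. ?B i j * ?u j)) {..<n})\<^sup>2 \<le> (C * L2_set (\<lambda>j. cmod (?u j)) {..<n})\<^sup>2"
      using rows by (simp add: L2_set_power2 power_mult_distrib)
    then have L: "L2_set (\<lambda>i. cmod (\<Sum>j<n. ?B i j * ?u j)) {..<n} \<le> C * L2_set (\<lambda>j. cmod (?u j)) {..<n}"
      by (rule power2_le_imp_le) (use C0 in \<open>simp add: C_def V_def L2_set_nonneg\<close>)
    have reL: "L2_set (\<lambda>x. cmod (w x)) F = L2_set (\<lambda>i. cmod (w (h i))) {..<n}" for w :: "'g \<Rightarrow> complex"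
      by (simp add: L2_set_def sum.reindex_bij_betw[OF h, symmetric])
    have "(\<Sum>x\<in>F. \<Sum>y\<in>F. \<phi> (- y + x) * a x y * u x * v y) = (\<Sum>i<n. \<Sum>j<n. ?B i j * ?v i * ?u j)"
      unfolding sum.reindex_bij_betw[OF h, symmetric] b_def
      by (subst sum.swap) (simp add: mult_ac)
    also have "cmod \<dots> \<le> L2_set (\<lambda>i. cmod (?v i)) {..<n} * (C * L2_set (\<lambda>j. cmod (?u j)) {..<n})"
      by (rule order_trans[OF bilinear_le_L2_set mult_left_mono[OF L L2_set_nonneg]])
    finally show "cmod (\<Sum>x\<in>F. \<Sum>y\<in>F. \<phi> (- y + x) * a x y * u x * v y)
        \<le> C * (L2_set (\<lambda>x. cmod (u x)) F * L2_set (\<lambda>y. cmod (v y)) F)"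
      unfolding reL by (simp add: mult_ac)
  qed
qed

end

section \<open>Existence of the multiplier map\<close>

lemma summable_prod_decode:
  fixes f :: "nat \<times> nat \<Rightarrow> real"
  assumes nonneg: "\<And>q. 0 \<le> f q" and le: "\<And>k N. (\<Sum>n<N. f (k, n)) \<le> B k" and B: "summable B"
  shows "summable (\<lambda>m. f (prod_decode m))"
proof (rule bounded_imp_summable)
  fix N
  have "(\<Sum>m\<le>N. f (prod_decode m)) = (\<Sum>q\<in>prod_decode ` {..N}. f q)"
    by (subst sum.reindex) (auto intro: inj_on_subset[OF inj_prod_decode])
  also have "\<dots> \<le> (\<Sum>q\<in>{..<Suc N} \<times> {..<Suc N}. f q)"
  proof (rule sum_mono2)
    have le: "fst (prod_decode m) \<le> m \<and> snd (prod_decode m) \<le> m" for m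
      using le_prod_encode_1[of "fst (prod_decode m)" "snd (prod_decode m)"]
        le_prod_encode_2[of "snd (prod_decode m)" "fst (prod_decode m)"] by simp
    have "prod_decode m \<in> {..<Suc N} \<times> {..<Suc N}" if "m \<le> N" for m
      using le[of m] that by (simp add: mem_Times_iff)
    then show "prod_decode ` {..N} \<subseteq> {..<Suc N} \<times> {..<Suc N}"
      by (intro image_subsetI) (simp only: atMost_iff)
  qed (use nonneg in auto)
  also have "\<dots> = (\<Sum>k<Suc N. \<Sum>n<Suc N. f (k, n))" by (simp only: sum.cartesian_product case_prod_eta)
  also have "\<dots> \<le> (\<Sum>k<Suc N. B k)" by (rule sum_mono[OF le])
  also have "\<dots> \<le> (\<Sum>k. B k)"
    by (rule sum_le_suminf[OF B]) (use le[of _ 0] in auto)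
  finally show "(\<Sum>m\<le>N. f (prod_decode m)) \<le> (\<Sum>k. B k)" .
qed (rule nonneg)

lemma infsum_nat_eq_suminf:
  fixes f :: "nat \<Rightarrow> complex"
  shows "f summable_on UNIV \<Longrightarrow> infsum f UNIV = suminf f"
  by (rule sums_unique[OF has_sum_imp_sums[OF has_sum_infsum]])

lemma suminf_prod_decode:
  fixes g :: "nat \<times> nat \<Rightarrow> complex"
  assumes "summable (\<lambda>m. cmod (g (prod_decode m)))"
  shows "(\<Sum>m. g (prod_decode m)) = (\<Sum>k. \<Sum>n. g (k, n))"
proof -
  have s: "(\<lambda>m. g (prod_decode m)) summable_on UNIV" by (rule norm_summable_imp_summable_on[OF assms])
  have gs: "g summable_on UNIV"
    using s summable_on_reindex_bij_betw[OF bij_prod_decode, of g] by simp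
  have row: "(\<lambda>n. g (k, n)) summable_on UNIV" for k
  proof -
    have "g summable_on Pair k ` UNIV" by (rule summable_on_subset_banach[OF gs]) simp
    then show ?thesis by (simp add: summable_on_reindex inj_on_def o_def)
  qed
  have gs': "g summable_on (UNIV \<times> UNIV)" using gs by simp
  have outer: "(\<lambda>k. infsum (\<lambda>n. g (k, n)) UNIV) summable_on UNIV"
    using summable_on_Sigma_banach[of "\<lambda>k n. g (k, n)" UNIV "\<lambda>_. UNIV"] gs' by simp
  have "(\<Sum>m. g (prod_decode m)) = infsum g UNIV"
    using infsum_nat_eq_suminf[OF s] infsum_reindex_bij_betw[OF bij_prod_decode, of g] by simp
  also have "\<dots> = infsum (\<lambda>k. infsum (\<lambda>n. g (k, n)) UNIV) UNIV"
    using infsum_Sigma_banach[of g UNIV "\<lambda>_. UNIV"] gs' by simp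
  also have "\<dots> = (\<Sum>k. \<Sum>n. g (k, n))"
    using infsum_nat_eq_suminf[OF outer] infsum_nat_eq_suminf[OF row] by simp
  finally show ?thesis .
qed

definition mult_op :: "'x measure \<Rightarrow> ('x \<Rightarrow> complex) \<Rightarrow> ('x \<Rightarrow> complex) set \<Rightarrow> ('x \<Rightarrow> complex) set" where
  "mult_op M a F = ae_class M (\<lambda>x. a x * rep F x)"

text \<open>The adjoint of the column \<open>h \<mapsto> (b\<^sub>n h)\<^sub>n\<close> of multiplication operators. The series converges
  absolutely almost everywhere when the norms of the \<open>G n\<close> are square summable, so that the adjoint can
  be written down pointwise.\<close>

definition row_op :: "'x measure \<Rightarrow> (nat \<Rightarrow> 'x \<Rightarrow> complex) \<Rightarrow> (nat \<Rightarrow> ('x \<Rightarrow> complex) set) \<Rightarrow> ('x \<Rightarrow> complex) set" where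
  "row_op M b G = ae_class M (\<lambda>x. \<Sum>n. cnj (b n x) * rep (G n) x)"

text \<open>The operators of multiplication by the \<open>a n\<close> form a column of norm at most \<open>\<surd>C\<close>.\<close>

locale bounded_column =
  fixes M :: "'x measure" and a :: "nat \<Rightarrow> 'x \<Rightarrow> complex" and C :: real
  assumes meas [measurable]: "\<And>n. a n \<in> borel_measurable M"
    and bound: "\<And>N x. (\<Sum>n<N. (cmod (a n x))\<^sup>2) \<le> C"
begin

lemma C_nonneg: "0 \<le> C" using bound[where N = 0] by simp

lemma coeff_bound: "(cmod (a n x))\<^sup>2 \<le> C"
proof -
  have "(cmod (a n x))\<^sup>2 \<le> (\<Sum>i<Suc n. (cmod (a i x))\<^sup>2)" by (rule member_le_sum) auto
  then show ?thesis using bound[where N = "Suc n"] order_trans by blast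
qed

lemma square_integrable_mult: "f \<in> square_integrable M \<Longrightarrow> (\<lambda>x. a n x * f x) \<in> square_integrable M"
proof (rule square_integrable_bound)
  assume f: "f \<in> square_integrable M"
  note [measurable] = square_integrable_measurable[OF f]
  show "(\<lambda>x. a n x * f x) \<in> borel_measurable M" by measurable
  show "integrable M (\<lambda>x. C * (cmod (f x))\<^sup>2)" using f by (simp add: square_integrable_def)
  show "(cmod (a n x * f x))\<^sup>2 \<le> C * (cmod (f x))\<^sup>2" for x
    by (simp add: norm_mult power_mult_distrib mult_right_mono coeff_bound)
qed

lemma mult_op_class: "f \<in> square_integrable M \<Longrightarrow> mult_op M (a n) (ae_class M f) = ae_class M (\<lambda>x. a n x * f x)"
proof -
  assume f: "f \<in> square_integrable M"
  have "AE x in M. a n x * rep (ae_class M f) x = a n x * f x"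
    using rep_ae_class(2)[OF square_integrable_measurable[OF f]] by eventually_elim simp
  then show ?thesis unfolding mult_op_def by (rule ae_class_cong)
qed

lemma mult_op_closed: "F \<in> carrier (L2 M) \<Longrightarrow> mult_op M (a n) F \<in> carrier (L2 M)"
  using L2_rep(1)[of F M] by (simp add: mult_op_def square_integrable_mult)

lemma mult_op_add: "F \<in> carrier (L2 M) \<Longrightarrow> G \<in> carrier (L2 M) \<Longrightarrow>
    mult_op M (a n) (F \<oplus>\<^bsub>L2 M\<^esub> G) = mult_op M (a n) F \<oplus>\<^bsub>L2 M\<^esub> mult_op M (a n) G"
  by (auto simp: L2_carrier_simp mult_op_class L2_add square_integrable_add square_integrable_mult distrib_left)

lemma mult_op_smult: "F \<in> carrier (L2 M) \<Longrightarrow>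
    mult_op M (a n) (c \<odot>\<^bsub>L2 M\<^esub> F) = c \<odot>\<^bsub>L2 M\<^esub> mult_op M (a n) F"
proof -
  assume "F \<in> carrier (L2 M)"
  then obtain f where "f \<in> square_integrable M" "F = ae_class M f" by (auto simp: L2_carrier_simp)
  then show ?thesis
    by (simp add: mult_op_class L2_smult square_integrable_scale square_integrable_mult mult.left_commute)
qed

lemma sum_mult_op_le:
  assumes F: "F \<in> carrier (L2 M)"
  shows "(\<Sum>n<N. (hnorm (L2 M) (mult_op M (a n) F))\<^sup>2) \<le> C * (hnorm (L2 M) F)\<^sup>2"
proof -
  obtain f where f: "f \<in> square_integrable M" and Ff: "F = ae_class M f" using F by (auto simp: L2_carrier_simp)
  note [measurable] = square_integrable_measurable[OF f]
  have "ennreal (\<Sum>n<N. (hnorm (L2 M) (mult_op M (a n) F))\<^sup>2) = (\<Sum>n<N. \<integral>\<^sup>+x. ennreal ((cmod (a n x * f x))\<^sup>2) \<partial>M)"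
    by (simp add: Ff mult_op_class[OF f] nn_integral_hnorm_L2[OF square_integrable_mult[OF f]] sum_ennreal)
  also have "\<dots> = (\<integral>\<^sup>+x. (\<Sum>n<N. ennreal ((cmod (a n x * f x))\<^sup>2)) \<partial>M)"
    by (rule nn_integral_sum[symmetric]) measurable
  also have "\<dots> \<le> (\<integral>\<^sup>+x. ennreal C * ennreal ((cmod (f x))\<^sup>2) \<partial>M)"
  proof (rule nn_integral_mono)
    fix x
    have "(\<Sum>n<N. (cmod (a n x * f x))\<^sup>2) \<le> C * (cmod (f x))\<^sup>2"
      using mult_right_mono[OF bound[of x N], of "(cmod (f x))\<^sup>2"]
      by (simp add: norm_mult power_mult_distrib sum_distrib_right)
    then show "(\<Sum>n<N. ennreal ((cmod (a n x * f x))\<^sup>2)) \<le> ennreal C * ennreal ((cmod (f x))\<^sup>2)"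
      by (simp add: sum_ennreal ennreal_leI C_nonneg flip: ennreal_mult)
  qed
  also have "\<dots> = ennreal (C * (hnorm (L2 M) F)\<^sup>2)"
    by (simp add: nn_integral_cmult nn_integral_hnorm_L2[OF f] Ff C_nonneg ennreal_mult)
  finally show ?thesis by (simp add: C_nonneg)
qed

lemma summable_mult_op:
  assumes F: "F \<in> carrier (L2 M)"
  shows "summable (\<lambda>n. (hnorm (L2 M) (mult_op M (a n) F))\<^sup>2)"
    and "(\<Sum>n. (hnorm (L2 M) (mult_op M (a n) F))\<^sup>2) \<le> C * (hnorm (L2 M) F)\<^sup>2"
proof -
  have "(\<Sum>n<N. (cmod (of_real (hnorm (L2 M) (mult_op M (a n) F))))\<^sup>2) \<le> C * (hnorm (L2 M) F)\<^sup>2" for N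
    using sum_mult_op_le[OF F] by simp
  from summable_square_bounded[OF this]
  show "summable (\<lambda>n. (hnorm (L2 M) (mult_op M (a n) F))\<^sup>2)"
    and "(\<Sum>n. (hnorm (L2 M) (mult_op M (a n) F))\<^sup>2) \<le> C * (hnorm (L2 M) F)\<^sup>2" by simp_all
qed

lemma AE_summable_square:
  assumes G: "\<And>n. G n \<in> carrier (L2 M)" and s: "summable (\<lambda>n. (hnorm (L2 M) (G n))\<^sup>2)"
  shows "AE x in M. summable (\<lambda>n. (cmod (rep (G n) x))\<^sup>2)"
    and "(\<integral>\<^sup>+x. (\<Sum>n. ennreal ((cmod (rep (G n) x))\<^sup>2)) \<partial>M) = ennreal (\<Sum>n. (hnorm (L2 M) (G n))\<^sup>2)"
proof -
  note [measurable] = square_integrable_measurable[OF L2_rep(1)[OF G]]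
  have "(\<integral>\<^sup>+x. (\<Sum>n. ennreal ((cmod (rep (G n) x))\<^sup>2)) \<partial>M) = (\<Sum>n. \<integral>\<^sup>+x. ennreal ((cmod (rep (G n) x))\<^sup>2) \<partial>M)"
    by (rule nn_integral_suminf) measurable
  also have "\<dots> = (\<Sum>n. ennreal ((hnorm (L2 M) (G n))\<^sup>2))"
    by (simp add: nn_integral_hnorm_L2[OF L2_rep(1)[OF G]] L2_rep(2)[OF G])
  also have "\<dots> = ennreal (\<Sum>n. (hnorm (L2 M) (G n))\<^sup>2)" by (rule suminf_ennreal2[OF _ s]) simp
  finally show i: "(\<integral>\<^sup>+x. (\<Sum>n. ennreal ((cmod (rep (G n) x))\<^sup>2)) \<partial>M) = ennreal (\<Sum>n. (hnorm (L2 M) (G n))\<^sup>2)" .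
  have "AE x in M. (\<Sum>n. ennreal ((cmod (rep (G n) x))\<^sup>2)) \<noteq> \<infinity>"
    by (rule nn_integral_PInf_AE) (simp_all add: i)
  then show "AE x in M. summable (\<lambda>n. (cmod (rep (G n) x))\<^sup>2)"
    by eventually_elim (rule summable_suminf_not_top, auto)
qed

lemma summable_coeff: "summable (\<lambda>n. (cmod (cnj (a n x)))\<^sup>2)" "(\<Sum>n. (cmod (cnj (a n x)))\<^sup>2) \<le> C"
  using summable_square_bounded[of "\<lambda>n. a n x", OF bound] by simp_all

lemma row_op_square_integrable:
  assumes G: "\<And>n. G n \<in> carrier (L2 M)" and s: "summable (\<lambda>n. (hnorm (L2 M) (G n))\<^sup>2)"
  shows "(\<lambda>x. \<Sum>n. cnj (a n x) * rep (G n) x) \<in> square_integrable M"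
    and "(hnorm (L2 M) (row_op M a G))\<^sup>2 \<le> C * (\<Sum>n. (hnorm (L2 M) (G n))\<^sup>2)"
proof -
  note [measurable] = square_integrable_measurable[OF L2_rep(1)[OF G]]
  have [measurable]: "(\<lambda>x. cnj (a n x)) \<in> borel_measurable M" for n
    by (rule borel_measurable_continuous_on[OF continuous_on_cnj[OF continuous_on_id] meas])
  let ?S = "\<lambda>x. \<Sum>n. cnj (a n x) * rep (G n) x"
  have m: "?S \<in> borel_measurable M" by measurable
  have "(\<integral>\<^sup>+x. ennreal ((cmod (?S x))\<^sup>2) \<partial>M) \<le> (\<integral>\<^sup>+x. ennreal C * (\<Sum>n. ennreal ((cmod (rep (G n) x))\<^sup>2)) \<partial>M)"
  proof (rule nn_integral_mono_AE)
    show "AE x in M. ennreal ((cmod (?S x))\<^sup>2) \<le> ennreal C * (\<Sum>n. ennreal ((cmod (rep (G n) x))\<^sup>2))"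
      using AE_summable_square(1)[OF G s]
    proof eventually_elim
      fix x assume x: "summable (\<lambda>n. (cmod (rep (G n) x))\<^sup>2)"
      have "(cmod (?S x))\<^sup>2 \<le> (\<Sum>n. (cmod (cnj (a n x)))\<^sup>2) * (\<Sum>n. (cmod (rep (G n) x))\<^sup>2)"
        by (rule Cauchy_Schwarz_suminf[OF summable_coeff(1) x])
      also have "\<dots> \<le> C * (\<Sum>n. (cmod (rep (G n) x))\<^sup>2)"
        by (rule mult_right_mono[OF summable_coeff(2) suminf_nonneg[OF x]]) simp
      finally have "ennreal ((cmod (?S x))\<^sup>2) \<le> ennreal C * ennreal (\<Sum>n. (cmod (rep (G n) x))\<^sup>2)"
        by (simp add: C_nonneg ennreal_leI suminf_nonneg[OF x] flip: ennreal_mult)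
      then show "ennreal ((cmod (?S x))\<^sup>2) \<le> ennreal C * (\<Sum>n. ennreal ((cmod (rep (G n) x))\<^sup>2))"
        by (simp add: suminf_ennreal2[OF _ x])
    qed
  qed
  also have "\<dots> = ennreal C * ennreal (\<Sum>n. (hnorm (L2 M) (G n))\<^sup>2)"
    by (simp add: nn_integral_cmult AE_summable_square(2)[OF G s])
  also have "\<dots> = ennreal (C * (\<Sum>n. (hnorm (L2 M) (G n))\<^sup>2))"
    by (simp add: ennreal_mult C_nonneg suminf_nonneg[OF s])
  finally have le: "(\<integral>\<^sup>+x. ennreal ((cmod (?S x))\<^sup>2) \<partial>M) \<le> ennreal (C * (\<Sum>n. (hnorm (L2 M) (G n))\<^sup>2))" .
  then show sq: "?S \<in> square_integrable M"
    using m unfolding square_integrable_iff_nn_integral by (auto intro: le_less_trans)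
  show "(hnorm (L2 M) (row_op M a G))\<^sup>2 \<le> C * (\<Sum>n. (hnorm (L2 M) (G n))\<^sup>2)"
    using le C_nonneg suminf_nonneg[OF s]
    unfolding nn_integral_hnorm_L2[OF sq] row_op_def by (simp add: mult_nonneg_nonneg)
qed

lemma row_op_closed:
  assumes "\<And>n. G n \<in> carrier (L2 M)" "summable (\<lambda>n. (hnorm (L2 M) (G n))\<^sup>2)"
  shows "row_op M a G \<in> carrier (L2 M)"
  unfolding row_op_def by (rule ae_class_in_L2[OF row_op_square_integrable(1)[OF assms]])

lemma AE_summable_row:
  assumes G: "\<And>n. G n \<in> carrier (L2 M)" and s: "summable (\<lambda>n. (hnorm (L2 M) (G n))\<^sup>2)"
  shows "AE x in M. summable (\<lambda>n. cnj (a n x) * rep (G n) x)"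
  using AE_summable_square(1)[OF G s]
  by eventually_elim (rule summable_norm_cancel[OF summable_norm_mult_square[OF summable_coeff(1)]])

lemma summable_hnorm_add:
  assumes G: "\<And>n. G n \<in> carrier (L2 M)" "summable (\<lambda>n. (hnorm (L2 M) (G n))\<^sup>2)"
    and G': "\<And>n. G' n \<in> carrier (L2 M)" "summable (\<lambda>n. (hnorm (L2 M) (G' n))\<^sup>2)"
  shows "summable (\<lambda>n. (hnorm (L2 M) (G n \<oplus>\<^bsub>L2 M\<^esub> G' n))\<^sup>2)"
proof (rule summable_comparison_test')
  show "summable (\<lambda>n. 2 * (hnorm (L2 M) (G n))\<^sup>2 + 2 * (hnorm (L2 M) (G' n))\<^sup>2)"
    by (intro summable_add summable_mult G G')
  fix n
  have "(hnorm (L2 M) (G n \<oplus>\<^bsub>L2 M\<^esub> G' n))\<^sup>2 \<le> (hnorm (L2 M) (G n) + hnorm (L2 M) (G' n))\<^sup>2"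
    by (rule power_mono[OF L2.hnorm_triangle[OF G(1) G'(1)]]) (simp add: G G')
  also have "\<dots> \<le> 2 * (hnorm (L2 M) (G n))\<^sup>2 + 2 * (hnorm (L2 M) (G' n))\<^sup>2"
    by (rule power2_sum_le)
  finally show "norm ((hnorm (L2 M) (G n \<oplus>\<^bsub>L2 M\<^esub> G' n))\<^sup>2) \<le> 2 * (hnorm (L2 M) (G n))\<^sup>2 + 2 * (hnorm (L2 M) (G' n))\<^sup>2"
    by simp
qed

lemma row_op_add:
  assumes G: "\<And>n. G n \<in> carrier (L2 M)" "summable (\<lambda>n. (hnorm (L2 M) (G n))\<^sup>2)"
    and G': "\<And>n. G' n \<in> carrier (L2 M)" "summable (\<lambda>n. (hnorm (L2 M) (G' n))\<^sup>2)"
  shows "row_op M a (\<lambda>n. G n \<oplus>\<^bsub>L2 M\<^esub> G' n) = row_op M a G \<oplus>\<^bsub>L2 M\<^esub> row_op M a G'"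
proof -
  have "AE x in M. rep (G n \<oplus>\<^bsub>L2 M\<^esub> G' n) x = rep (G n) x + rep (G' n) x" for n
  proof -
    have "G n \<oplus>\<^bsub>L2 M\<^esub> G' n = ae_class M (\<lambda>x. rep (G n) x + rep (G' n) x)"
      using L2_add[OF L2_rep(1)[OF G(1)] L2_rep(1)[OF G'(1)]] by (simp add: L2_rep(2) G(1) G'(1))
    then show ?thesis
      using rep_ae_class(2)[OF square_integrable_measurable[OF square_integrable_add[OF L2_rep(1)[OF G(1)] L2_rep(1)[OF G'(1)]]]]
      by simp
  qed
  then have all: "AE x in M. \<forall>n. rep (G n \<oplus>\<^bsub>L2 M\<^esub> G' n) x = rep (G n) x + rep (G' n) x"
    by (simp add: AE_all_countable)
  have "AE x in M. (\<Sum>n. cnj (a n x) * rep (G n \<oplus>\<^bsub>L2 M\<^esub> G' n) x)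
      = (\<Sum>n. cnj (a n x) * rep (G n) x) + (\<Sum>n. cnj (a n x) * rep (G' n) x)"
    using all AE_summable_row[OF G] AE_summable_row[OF G']
    by eventually_elim (simp add: distrib_left suminf_add)
  then have "row_op M a (\<lambda>n. G n \<oplus>\<^bsub>L2 M\<^esub> G' n)
     = ae_class M (\<lambda>x. (\<Sum>n. cnj (a n x) * rep (G n) x) + (\<Sum>n. cnj (a n x) * rep (G' n) x))"
    unfolding row_op_def by (rule ae_class_cong)
  also have "\<dots> = row_op M a G \<oplus>\<^bsub>L2 M\<^esub> row_op M a G'"
    unfolding row_op_def by (rule L2_add[symmetric]) (rule row_op_square_integrable(1)[OF G], rule row_op_square_integrable(1)[OF G'])
  finally show ?thesis .
qed

lemma row_op_smult:
  assumes G: "\<And>n. G n \<in> carrier (L2 M)" "summable (\<lambda>n. (hnorm (L2 M) (G n))\<^sup>2)"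
  shows "row_op M a (\<lambda>n. c \<odot>\<^bsub>L2 M\<^esub> G n) = c \<odot>\<^bsub>L2 M\<^esub> row_op M a G"
proof -
  have "AE x in M. rep (c \<odot>\<^bsub>L2 M\<^esub> G n) x = c * rep (G n) x" for n
  proof -
    have "c \<odot>\<^bsub>L2 M\<^esub> G n = ae_class M (\<lambda>x. c * rep (G n) x)"
      using L2_smult[OF L2_rep(1)[OF G(1)]] by (simp add: L2_rep(2) G(1))
    then show ?thesis
      using rep_ae_class(2)[OF square_integrable_measurable[OF square_integrable_scale[OF L2_rep(1)[OF G(1)]]]] by simp
  qed
  then have all: "AE x in M. \<forall>n. rep (c \<odot>\<^bsub>L2 M\<^esub> G n) x = c * rep (G n) x" by (simp add: AE_all_countable)
  have "AE x in M. (\<Sum>n. cnj (a n x) * rep (c \<odot>\<^bsub>L2 M\<^esub> G n) x) = c * (\<Sum>n. cnj (a n x) * rep (G n) x)"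
    using all AE_summable_row[OF G]
  proof eventually_elim
    fix x assume "\<forall>n. rep (c \<odot>\<^bsub>L2 M\<^esub> G n) x = c * rep (G n) x" "summable (\<lambda>n. cnj (a n x) * rep (G n) x)"
    then show "(\<Sum>n. cnj (a n x) * rep (c \<odot>\<^bsub>L2 M\<^esub> G n) x) = c * (\<Sum>n. cnj (a n x) * rep (G n) x)"
      using suminf_mult[of "\<lambda>n. cnj (a n x) * rep (G n) x" c] by (simp add: mult_ac)
  qed
  then have "row_op M a (\<lambda>n. c \<odot>\<^bsub>L2 M\<^esub> G n) = ae_class M (\<lambda>x. c * (\<Sum>n. cnj (a n x) * rep (G n) x))"
    unfolding row_op_def by (rule ae_class_cong)
  also have "\<dots> = c \<odot>\<^bsub>L2 M\<^esub> row_op M a G"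
    unfolding row_op_def by (rule L2_smult[symmetric, OF row_op_square_integrable(1)[OF G]])
  finally show ?thesis .
qed

text \<open>The duality of rows and columns; integration and summation may be exchanged because both sides
  are square summable.\<close>

lemma row_op_hinner:
  assumes G: "\<And>n. G n \<in> carrier (L2 M)" "summable (\<lambda>n. (hnorm (L2 M) (G n))\<^sup>2)"
    and E: "E \<in> carrier (L2 M)"
  shows "hinner (L2 M) (row_op M a G) E = (\<Sum>n. hinner (L2 M) (G n) (mult_op M (a n) E))"
proof -
  define e where "e = rep E"
  have e: "e \<in> square_integrable M" and Ee: "E = ae_class M e" using L2_rep[OF E] by (simp_all add: e_def)
  define g where "g n = rep (G n)" for n
  have g: "g n \<in> square_integrable M" and Gg: "G n = ae_class M (g n)" for n
    using L2_rep[OF G(1)] by (simp_all add: g_def)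
  let ?f = "\<lambda>n x. g n x * cnj (a n x * e x)"
  have int: "integrable M (?f n)" for n
    by (rule integrable_mult_cnj[OF g square_integrable_mult[OF e]])
  have le: "norm (?f n x) \<le> (cmod (g n x))\<^sup>2 + (cmod (a n x * e x))\<^sup>2" for n x
    using mult_le_power2_sum[of "cmod (g n x)" "cmod (a n x * e x)"] by (simp add: norm_mult)
  have "hinner (L2 M) (row_op M a G) E = (\<integral>x. (\<Sum>n. cnj (a n x) * g n x) * cnj (e x) \<partial>M)"
    unfolding row_op_def Ee g_def by (rule L2_hinner[OF row_op_square_integrable(1)[OF G] e])
  also have "\<dots> = (\<integral>x. (\<Sum>n. ?f n x) \<partial>M)"
  proof (rule integral_cong_AE)
    have 1: "(\<lambda>x. (\<Sum>n. cnj (a n x) * g n x) * cnj (e x)) \<in> borel_measurable M"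
      using integrable_mult_cnj[OF row_op_square_integrable(1)[OF G] e] by (simp add: g_def borel_measurable_integrable)
    then show "(\<lambda>x. (\<Sum>n. cnj (a n x) * g n x) * cnj (e x)) \<in> borel_measurable M" .
    show "(\<lambda>x. \<Sum>n. ?f n x) \<in> borel_measurable M"
      by (rule borel_measurable_suminf) (rule borel_measurable_integrable[OF int])
    show "AE x in M. (\<Sum>n. cnj (a n x) * g n x) * cnj (e x) = (\<Sum>n. ?f n x)"
      using AE_summable_row[OF G]
    proof eventually_elim
      fix x assume "summable (\<lambda>n. cnj (a n x) * rep (G n) x)"
      then show "(\<Sum>n. cnj (a n x) * g n x) * cnj (e x) = (\<Sum>n. ?f n x)"
        using suminf_mult2[of "\<lambda>n. cnj (a n x) * g n x" "cnj (e x)"] by (simp add: g_def mult_ac)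
    qed
  qed
  also have "\<dots> = (\<Sum>n. \<integral>x. ?f n x \<partial>M)"
  proof (rule integral_suminf[OF int])
    have "AE x in M. summable (\<lambda>n. (cmod (g n x))\<^sup>2)" using AE_summable_square(1)[OF G] by (simp add: g_def)
    then show "AE x in M. summable (\<lambda>n. norm (?f n x))"
    proof eventually_elim
      fix x assume x: "summable (\<lambda>n. (cmod (g n x))\<^sup>2)"
      have "summable (\<lambda>n. (cmod (g n x))\<^sup>2 + (cmod (cnj (a n x)))\<^sup>2 * (cmod (e x))\<^sup>2)"
        by (intro summable_add x summable_mult2 summable_coeff(1))
      then show "summable (\<lambda>n. norm (?f n x))"
        by (rule summable_comparison_test') (use le[of _ x] in \<open>simp add: norm_mult power_mult_distrib\<close>)
    qed
    have "summable (\<lambda>n. (hnorm (L2 M) (G n))\<^sup>2 + (hnorm (L2 M) (mult_op M (a n) E))\<^sup>2)"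
      by (intro summable_add G summable_mult_op(1) E)
    then show "summable (\<lambda>n. \<integral>x. norm (?f n x) \<partial>M)"
    proof (rule summable_comparison_test')
      fix n
      have "(\<integral>x. norm (?f n x) \<partial>M) \<le> (\<integral>x. (cmod (g n x))\<^sup>2 + (cmod (a n x * e x))\<^sup>2 \<partial>M)"
        using g square_integrable_mult[OF e] int le
        by (intro integral_mono) (auto simp: square_integrable_def)
      also have "\<dots> = (hnorm (L2 M) (G n))\<^sup>2 + (hnorm (L2 M) (mult_op M (a n) E))\<^sup>2"
        using g square_integrable_mult[OF e]
        by (simp add: Gg hnorm_L2_power2 Ee mult_op_class[OF e]) (simp add: square_integrable_def)
      finally show "norm (\<integral>x. norm (?f n x) \<partial>M) \<le> (hnorm (L2 M) (G n))\<^sup>2 + (hnorm (L2 M) (mult_op M (a n) E))\<^sup>2"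
        by simp
    qed
  qed
  also have "\<dots> = (\<Sum>n. hinner (L2 M) (G n) (mult_op M (a n) E))"
    by (simp add: Gg Ee mult_op_class[OF e] L2_hinner[OF g square_integrable_mult[OF e]])
  finally show ?thesis .
qed

lemma row_op_finsum:
  assumes "finite J" "\<And>j n. j \<in> J \<Longrightarrow> G j n \<in> carrier (L2 M)"
    "\<And>j. j \<in> J \<Longrightarrow> summable (\<lambda>n. (hnorm (L2 M) (G j n))\<^sup>2)"
  shows "(\<Oplus>\<^bsub>L2 M\<^esub>j\<in>J. row_op M a (G j)) = row_op M a (\<lambda>n. \<Oplus>\<^bsub>L2 M\<^esub>j\<in>J. G j n) \<and>
    summable (\<lambda>n. (hnorm (L2 M) (\<Oplus>\<^bsub>L2 M\<^esub>j\<in>J. G j n))\<^sup>2)"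
  using assms
proof (induction J rule: finite_induct)
  case empty
  have "AE x in M. \<forall>n::nat. rep (ae_class M (\<lambda>_. 0)) x = (0::complex)"
    using rep_ae_class(2)[of "\<lambda>_. 0" M] by simp
  then have "AE x in M. 0 = (\<Sum>n. cnj (a n x) * rep (ae_class M (\<lambda>_. 0)) x)"
    by eventually_elim simp
  then have "ae_class M (\<lambda>x. 0) = ae_class M (\<lambda>x. \<Sum>n. cnj (a n x) * rep (ae_class M (\<lambda>_. 0)) x)"
    by (rule ae_class_cong)
  then show ?case unfolding row_op_def L2_zero[symmetric] by simp
next
  case (insert j J)
  have c: "(\<Oplus>\<^bsub>L2 M\<^esub>i\<in>J. G i n) \<in> carrier (L2 M)" for n
    by (rule L2.finsum_closed) (use insert in auto)
  have e: "(\<Oplus>\<^bsub>L2 M\<^esub>i\<in>insert j J. G i n) = G j n \<oplus>\<^bsub>L2 M\<^esub> (\<Oplus>\<^bsub>L2 M\<^esub>i\<in>J. G i n)" for n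
    by (rule L2.finsum_insert) (use insert in auto)
  have r: "(\<Oplus>\<^bsub>L2 M\<^esub>i\<in>insert j J. row_op M a (G i)) = row_op M a (G j) \<oplus>\<^bsub>L2 M\<^esub> (\<Oplus>\<^bsub>L2 M\<^esub>i\<in>J. row_op M a (G i))"
    by (rule L2.finsum_insert) (use insert in \<open>auto intro!: row_op_closed\<close>)
  have IH: "(\<Oplus>\<^bsub>L2 M\<^esub>i\<in>J. row_op M a (G i)) = row_op M a (\<lambda>n. \<Oplus>\<^bsub>L2 M\<^esub>i\<in>J. G i n)"
    "summable (\<lambda>n. (hnorm (L2 M) (\<Oplus>\<^bsub>L2 M\<^esub>i\<in>J. G i n))\<^sup>2)" using insert by auto
  have j: "\<And>n. G j n \<in> carrier (L2 M)" "summable (\<lambda>n. (hnorm (L2 M) (G j n))\<^sup>2)" using insert by auto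
  show ?case unfolding e r IH(1) using row_op_add[OF j c IH(2)] summable_hnorm_add[OF j c IH(2)] by simp
qed

end

locale two_columns = A: bounded_column M a C + B: bounded_column M b C
  for M :: "'x measure" and a b :: "nat \<Rightarrow> 'x \<Rightarrow> complex" and C :: real
begin

text \<open>The map \<open>T \<mapsto> \<Sum>\<^sub>n b\<^sub>n\<^sup>* T a\<^sub>n\<close>.\<close>

definition column_map :: "(('x \<Rightarrow> complex) set \<Rightarrow> ('x \<Rightarrow> complex) set) \<Rightarrow> ('x \<Rightarrow> complex) set \<Rightarrow> ('x \<Rightarrow> complex) set" where
  "column_map T = (\<lambda>F\<in>carrier (L2 M). row_op M b (\<lambda>n. T (mult_op M (a n) F)))"

lemma image_summable:
  assumes T: "T \<in> bounded_operators (L2 M)" and F: "F \<in> carrier (L2 M)"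
  shows "T (mult_op M (a n) F) \<in> carrier (L2 M)"
    and "summable (\<lambda>n. (hnorm (L2 M) (T (mult_op M (a n) F)))\<^sup>2)"
    and "\<lbrakk>\<And>F. F \<in> carrier (L2 M) \<Longrightarrow> hnorm (L2 M) (T F) \<le> K * hnorm (L2 M) F\<rbrakk> \<Longrightarrow>
       (\<Sum>n. (hnorm (L2 M) (T (mult_op M (a n) F)))\<^sup>2) \<le> K\<^sup>2 * (C * (hnorm (L2 M) F)\<^sup>2)"
proof -
  have c: "T (mult_op M (a n) F) \<in> carrier (L2 M)" for n
    by (rule L2.bounded_operator_closed[OF T A.mult_op_closed[OF F]])
  then show "T (mult_op M (a n) F) \<in> carrier (L2 M)" .
  have le: "(hnorm (L2 M) (T (mult_op M (a n) F)))\<^sup>2 \<le> K\<^sup>2 * (hnorm (L2 M) (mult_op M (a n) F))\<^sup>2"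
    if K: "\<And>F. F \<in> carrier (L2 M) \<Longrightarrow> hnorm (L2 M) (T F) \<le> K * hnorm (L2 M) F" for K n
    unfolding power_mult_distrib[symmetric]
    by (rule power_mono[OF K[OF A.mult_op_closed[OF F]]]) (simp add: c)
  have sK: "summable (\<lambda>n. K\<^sup>2 * (hnorm (L2 M) (mult_op M (a n) F))\<^sup>2)" for K
    by (intro summable_mult A.summable_mult_op(1) F)
  obtain L where "\<And>F. F \<in> carrier (L2 M) \<Longrightarrow> hnorm (L2 M) (T F) \<le> L * hnorm (L2 M) F"
    using L2.bounded_operatorE[OF T] by metis
  from le[OF this] show s: "summable (\<lambda>n. (hnorm (L2 M) (T (mult_op M (a n) F)))\<^sup>2)"
    by (intro summable_comparison_test'[OF sK[of L]]) auto
  assume K: "\<And>F. F \<in> carrier (L2 M) \<Longrightarrow> hnorm (L2 M) (T F) \<le> K * hnorm (L2 M) F"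
  have "(\<Sum>n. (hnorm (L2 M) (T (mult_op M (a n) F)))\<^sup>2) \<le> (\<Sum>n. K\<^sup>2 * (hnorm (L2 M) (mult_op M (a n) F))\<^sup>2)"
    by (rule suminf_le[OF le[OF K] s sK])
  also have "\<dots> = K\<^sup>2 * (\<Sum>n. (hnorm (L2 M) (mult_op M (a n) F))\<^sup>2)"
    by (rule suminf_mult[OF A.summable_mult_op(1)[OF F]])
  also have "\<dots> \<le> K\<^sup>2 * (C * (hnorm (L2 M) F)\<^sup>2)"
    by (rule mult_left_mono[OF A.summable_mult_op(2)[OF F]]) simp
  finally show "(\<Sum>n. (hnorm (L2 M) (T (mult_op M (a n) F)))\<^sup>2) \<le> K\<^sup>2 * (C * (hnorm (L2 M) F)\<^sup>2)" .
qed

lemma column_map_bounded: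
  assumes T: "T \<in> bounded_operators (L2 M)"
  shows "column_map T \<in> bounded_operators (L2 M)"
proof -
  obtain K where K: "K \<ge> 0" "\<And>F. F \<in> carrier (L2 M) \<Longrightarrow> hnorm (L2 M) (T F) \<le> K * hnorm (L2 M) F"
    using L2.bounded_operatorE[OF T] by metis
  note im = image_summable[OF T]
  have cl: "row_op M b (\<lambda>n. T (mult_op M (a n) F)) \<in> carrier (L2 M)" if "F \<in> carrier (L2 M)" for F
    by (rule B.row_op_closed[OF im(1)[OF that] im(2)[OF that]])
  show ?thesis
  proof (rule L2.bounded_operatorI[where C = "C * K"])
    fix F assume F: "F \<in> carrier (L2 M)"
    show "column_map T F \<in> carrier (L2 M)" using cl[OF F] F by (simp add: column_map_def)
    have "(hnorm (L2 M) (row_op M b (\<lambda>n. T (mult_op M (a n) F))))\<^sup>2 \<le> C * (\<Sum>n. (hnorm (L2 M) (T (mult_op M (a n) F)))\<^sup>2)"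
      by (rule B.row_op_square_integrable(2)[OF im(1)[OF F] im(2)[OF F]])
    also have "\<dots> \<le> C * (K\<^sup>2 * (C * (hnorm (L2 M) F)\<^sup>2))"
      by (rule mult_left_mono[OF im(3)[OF F K(2)] A.C_nonneg])
    also have "\<dots> = (C * K * hnorm (L2 M) F)\<^sup>2" by (simp add: power2_eq_square)
    finally have "hnorm (L2 M) (row_op M b (\<lambda>n. T (mult_op M (a n) F))) \<le> C * K * hnorm (L2 M) F"
      by (rule power2_le_imp_le) (use A.C_nonneg K(1) F in simp)
    then show "hnorm (L2 M) (column_map T F) \<le> C * K * hnorm (L2 M) F" using F by (simp add: column_map_def)
    fix c show "column_map T (c \<odot>\<^bsub>L2 M\<^esub> F) = c \<odot>\<^bsub>L2 M\<^esub> column_map T F"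
      using F B.row_op_smult[OF im(1)[OF F] im(2)[OF F], of c]
      by (simp add: column_map_def A.mult_op_smult L2.bounded_operator_smult[OF T] A.mult_op_closed)
    fix G assume G: "G \<in> carrier (L2 M)"
    show "column_map T (F \<oplus>\<^bsub>L2 M\<^esub> G) = column_map T F \<oplus>\<^bsub>L2 M\<^esub> column_map T G"
      using F G B.row_op_add[OF im(1)[OF F] im(2)[OF F] im(1)[OF G] im(2)[OF G]]
      by (simp add: column_map_def A.mult_op_add L2.bounded_operator_add[OF T] A.mult_op_closed)
  qed (simp add: column_map_def)
qed

lemma column_map_add:
  assumes S: "S \<in> bounded_operators (L2 M)" and T: "T \<in> bounded_operators (L2 M)"
  shows "column_map (S \<oplus>\<^bsub>op_algebra (L2 M)\<^esub> T) = column_map S \<oplus>\<^bsub>op_algebra (L2 M)\<^esub> column_map T"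
  using B.row_op_add[OF image_summable(1)[OF S] image_summable(2)[OF S] image_summable(1)[OF T] image_summable(2)[OF T]]
  by (auto simp: op_algebra_simps column_map_def fun_eq_iff A.mult_op_closed)

lemma column_map_smult:
  assumes T: "T \<in> bounded_operators (L2 M)"
  shows "column_map (c \<odot>\<^bsub>op_algebra (L2 M)\<^esub> T) = c \<odot>\<^bsub>op_algebra (L2 M)\<^esub> column_map T"
  using B.row_op_smult[OF image_summable(1)[OF T] image_summable(2)[OF T]]
  by (auto simp: op_algebra_simps column_map_def fun_eq_iff A.mult_op_closed)

text \<open>Row and column have norm at most \<open>\<surd>C\<close> each. The estimate is applied to a whole matrix at once:
  for every \<open>k\<close>, the matrix \<open>T\<close> acts on the vectors \<open>a\<^sub>k \<xi>\<^sub>j\<close>.\<close>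

lemma column_map_matrix_bound:
  fixes n :: nat
  assumes T: "\<And>i j. i < n \<Longrightarrow> j < n \<Longrightarrow> T i j \<in> bounded_operators (L2 M)"
  shows "matrix_op_norm (L2 M) n (\<lambda>i j. column_map (T i j)) \<le> C * matrix_op_norm (L2 M) n T"
  unfolding matrix_op_norm_def[of _ _ "\<lambda>i j. column_map (T i j)"]
proof (rule cSup_least)
  show "{sqrt (\<Sum>i<n. (hnorm (L2 M) (finsum (L2 M) (\<lambda>j. column_map (T i j) (\<xi> j)) {..<n}))\<^sup>2) |\<xi>.
           (\<forall>j<n. \<xi> j \<in> carrier (L2 M)) \<and> (\<Sum>j<n. (hnorm (L2 M) (\<xi> j))\<^sup>2) \<le> 1} \<noteq> {}"
    by (auto intro!: exI[of _ "\<lambda>_. \<zero>\<^bsub>L2 M\<^esub>"])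
  fix s
  assume "s \<in> {sqrt (\<Sum>i<n. (hnorm (L2 M) (finsum (L2 M) (\<lambda>j. column_map (T i j) (\<xi> j)) {..<n}))\<^sup>2) |\<xi>.
           (\<forall>j<n. \<xi> j \<in> carrier (L2 M)) \<and> (\<Sum>j<n. (hnorm (L2 M) (\<xi> j))\<^sup>2) \<le> 1}"
  then obtain \<xi> where s: "s = sqrt (\<Sum>i<n. (hnorm (L2 M) (finsum (L2 M) (\<lambda>j. column_map (T i j) (\<xi> j)) {..<n}))\<^sup>2)"
    and \<xi>: "\<And>j. j < n \<Longrightarrow> \<xi> j \<in> carrier (L2 M)" and le: "(\<Sum>j<n. (hnorm (L2 M) (\<xi> j))\<^sup>2) \<le> 1" by blast
  define m where "m = matrix_op_norm (L2 M) n T"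
  have m0: "0 \<le> m" unfolding m_def by (rule L2.matrix_op_norm_nonneg[OF T])
  define W where "W i k = (\<Oplus>\<^bsub>L2 M\<^esub>j\<in>{..<n}. T i j (mult_op M (a k) (\<xi> j)))" for i k
  have Tc: "T i j (mult_op M (a k) (\<xi> j)) \<in> carrier (L2 M)"
    "summable (\<lambda>k. (hnorm (L2 M) (T i j (mult_op M (a k) (\<xi> j))))\<^sup>2)" if "i < n" "j < n" for i j k
    using image_summable(1,2)[OF T[OF that] \<xi>[OF that(2)]] by blast+
  have rows: "finsum (L2 M) (\<lambda>j. column_map (T i j) (\<xi> j)) {..<n} = row_op M b (W i) \<and>
      summable (\<lambda>k. (hnorm (L2 M) (W i k))\<^sup>2)" if i: "i < n" for i
  proof -
    have "finsum (L2 M) (\<lambda>j. column_map (T i j) (\<xi> j)) {..<n} =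
       finsum (L2 M) (\<lambda>j. row_op M b (\<lambda>k. T i j (mult_op M (a k) (\<xi> j)))) {..<n}"
      by (rule L2.finsum_cong') (use \<xi> Tc[OF i] in \<open>auto simp: column_map_def intro!: B.row_op_closed\<close>)
    then show ?thesis
      using B.row_op_finsum[of "{..<n}" "\<lambda>j k. T i j (mult_op M (a k) (\<xi> j))"] Tc[OF i]
      by (simp add: W_def[abs_def])
  qed
  have Wc: "W i k \<in> carrier (L2 M)" if "i < n" for i k
    unfolding W_def by (rule L2.finsum_closed) (use Tc[OF that] in auto)
  have "(\<Sum>i<n. (hnorm (L2 M) (finsum (L2 M) (\<lambda>j. column_map (T i j) (\<xi> j)) {..<n}))\<^sup>2)
     \<le> (\<Sum>i<n. C * (\<Sum>k. (hnorm (L2 M) (W i k))\<^sup>2))"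
    by (rule sum_mono) (use rows Wc B.row_op_square_integrable(2) in auto)
  also have "\<dots> = C * (\<Sum>k. \<Sum>i<n. (hnorm (L2 M) (W i k))\<^sup>2)"
    unfolding sum_distrib_left[symmetric] using rows by (subst suminf_sum) auto
  also have "\<dots> \<le> C * (\<Sum>k. m\<^sup>2 * (\<Sum>j<n. (hnorm (L2 M) (mult_op M (a k) (\<xi> j)))\<^sup>2))"
  proof (intro mult_left_mono suminf_le B.C_nonneg)
    show "(\<Sum>i<n. (hnorm (L2 M) (W i k))\<^sup>2) \<le> m\<^sup>2 * (\<Sum>j<n. (hnorm (L2 M) (mult_op M (a k) (\<xi> j)))\<^sup>2)" for k
      unfolding W_def m_def by (rule L2.matrix_op_norm_bound[OF T A.mult_op_closed[OF \<xi>]])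
    show "summable (\<lambda>k. \<Sum>i<n. (hnorm (L2 M) (W i k))\<^sup>2)" using rows by (intro summable_sum) auto
    show "summable (\<lambda>k. m\<^sup>2 * (\<Sum>j<n. (hnorm (L2 M) (mult_op M (a k) (\<xi> j)))\<^sup>2))"
      by (intro summable_mult summable_sum A.summable_mult_op(1) \<xi>) simp
  qed
  also have "(\<Sum>k. m\<^sup>2 * (\<Sum>j<n. (hnorm (L2 M) (mult_op M (a k) (\<xi> j)))\<^sup>2))
      = m\<^sup>2 * (\<Sum>j<n. \<Sum>k. (hnorm (L2 M) (mult_op M (a k) (\<xi> j)))\<^sup>2)"
  proof -
    have sm: "\<And>j. j \<in> {..<n} \<Longrightarrow> summable (\<lambda>k. (hnorm (L2 M) (mult_op M (a k) (\<xi> j)))\<^sup>2)"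
      using A.summable_mult_op(1)[OF \<xi>] by simp
    have s: "summable (\<lambda>k. \<Sum>j<n. (hnorm (L2 M) (mult_op M (a k) (\<xi> j)))\<^sup>2)"
      by (rule summable_sum) (rule sm)
    have e: "(\<Sum>k. \<Sum>j<n. (hnorm (L2 M) (mult_op M (a k) (\<xi> j)))\<^sup>2)
        = (\<Sum>j<n. \<Sum>k. (hnorm (L2 M) (mult_op M (a k) (\<xi> j)))\<^sup>2)"
      by (rule suminf_sum) (rule sm)
    show ?thesis by (simp only: suminf_mult[OF s] e)
  qed
  also have "C * (m\<^sup>2 * (\<Sum>j<n. \<Sum>k. (hnorm (L2 M) (mult_op M (a k) (\<xi> j)))\<^sup>2)) \<le>
      C * (m\<^sup>2 * (\<Sum>j<n. C * (hnorm (L2 M) (\<xi> j))\<^sup>2))"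
    by (intro mult_left_mono sum_mono A.summable_mult_op(2) \<xi> B.C_nonneg) auto
  also have "\<dots> = (C * m)\<^sup>2 * (\<Sum>j<n. (hnorm (L2 M) (\<xi> j))\<^sup>2)"
    by (simp add: sum_distrib_left[symmetric] power2_eq_square)
  also have "\<dots> \<le> (C * m)\<^sup>2 * 1" by (rule mult_left_mono[OF le]) simp
  finally have "(\<Sum>i<n. (hnorm (L2 M) (finsum (L2 M) (\<lambda>j. column_map (T i j) (\<xi> j)) {..<n}))\<^sup>2) \<le> (C * m)\<^sup>2" by simp
  then show "s \<le> C * matrix_op_norm (L2 M) n T"
    unfolding s using m0 B.C_nonneg real_sqrt_le_mono by (fastforce simp: m_def[symmetric])
qed

text \<open>Composing the functional of a pair \<open>\<xi>\<close>, \<open>\<eta>\<close> of square summable sequences with the map gives the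
  functional of the pair \<open>(a\<^sub>n \<xi>\<^sub>k)\<close>, \<open>(b\<^sub>n \<eta>\<^sub>k)\<close>, which is indexed by \<open>(k,n)\<close> and again square
  summable.\<close>

lemma column_map_sigma_weak_continuous:
  "continuous_map (sigma_weak_topology (L2 M)) (sigma_weak_topology (L2 M)) column_map"
proof -
  define B where "B = bounded_operators (L2 M)"
  define I where "I = square_summable_seqs (L2 M) \<times> square_summable_seqs (L2 M)"
  define f where "f T = (\<lambda>p\<in>I. \<Sum>k. hinner (L2 M) (T (fst p k)) (snd p k))" for T
  define P where "P = product_topology (\<lambda>_. euclidean :: complex topology) I"
  have W: "sigma_weak_topology (L2 M) = pullback_topology B f P"
    by (simp add: sigma_weak_topology_def Let_def B_def I_def P_def f_def[abs_def])
  have fP: "continuous_map (pullback_topology B f P) P f"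
    using continuous_map_pullback[OF continuous_map_id, of B f P] by simp
  have coord: "continuous_map (pullback_topology B f P) euclidean (\<lambda>T. f T p)" if "p \<in> I" for p
    using continuous_map_compose[OF fP continuous_map_product_projection[OF that, of "\<lambda>_. euclidean :: complex topology", folded P_def]]
    by (simp add: o_def)
  have pull: "\<exists>p'\<in>I. \<forall>T\<in>B. f (column_map T) p = f T p'" if p: "p \<in> I" for p
  proof -
    define \<xi> \<eta> where "\<xi> = fst p" and "\<eta> = snd p"
    have \<xi>: "\<xi> k \<in> carrier (L2 M)" "summable (\<lambda>k. (hnorm (L2 M) (\<xi> k))\<^sup>2)"
      and \<eta>: "\<eta> k \<in> carrier (L2 M)" "summable (\<lambda>k. (hnorm (L2 M) (\<eta> k))\<^sup>2)" for k
      using p by (auto simp: I_def square_summable_seqs_def \<xi>_def \<eta>_def)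
    define \<xi>' where "\<xi>' m = mult_op M (a (snd (prod_decode m))) (\<xi> (fst (prod_decode m)))" for m
    define \<eta>' where "\<eta>' m = mult_op M (b (snd (prod_decode m))) (\<eta> (fst (prod_decode m)))" for m
    have \<xi>'c: "\<xi>' m \<in> carrier (L2 M)" and \<eta>'c: "\<eta>' m \<in> carrier (L2 M)" for m
      by (simp_all add: \<xi>'_def \<eta>'_def A.mult_op_closed B.mult_op_closed \<xi> \<eta>)
    have \<xi>'s: "summable (\<lambda>m. (hnorm (L2 M) (\<xi>' m))\<^sup>2)"
      unfolding \<xi>'_def
      by (rule summable_prod_decode[of "\<lambda>(k, n). (hnorm (L2 M) (mult_op M (a n) (\<xi> k)))\<^sup>2"
            "\<lambda>k. C * (hnorm (L2 M) (\<xi> k))\<^sup>2", unfolded case_prod_beta fst_conv snd_conv])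
        (simp_all add: A.sum_mult_op_le \<xi> summable_mult)
    have \<eta>'s: "summable (\<lambda>m. (hnorm (L2 M) (\<eta>' m))\<^sup>2)"
      unfolding \<eta>'_def
      by (rule summable_prod_decode[of "\<lambda>(k, n). (hnorm (L2 M) (mult_op M (b n) (\<eta> k)))\<^sup>2"
            "\<lambda>k. C * (hnorm (L2 M) (\<eta> k))\<^sup>2", unfolded case_prod_beta fst_conv snd_conv])
        (simp_all add: B.sum_mult_op_le \<eta> summable_mult)
    have p': "(\<xi>', \<eta>') \<in> I"
      using \<xi>'c \<eta>'c \<xi>'s \<eta>'s by (auto simp: I_def square_summable_seqs_def)
    have "f (column_map T) p = f T (\<xi>', \<eta>')" if T: "T \<in> B" for T
    proof -
      have T': "T \<in> bounded_operators (L2 M)" using T by (simp add: B_def)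
      obtain K where K: "K \<ge> 0" "\<And>F. F \<in> carrier (L2 M) \<Longrightarrow> hnorm (L2 M) (T F) \<le> K * hnorm (L2 M) F"
        using L2.bounded_operatorE[OF T'] by metis
      define g where "g q = hinner (L2 M) (T (mult_op M (a (snd q)) (\<xi> (fst q)))) (mult_op M (b (snd q)) (\<eta> (fst q)))" for q
      have gm: "g (prod_decode m) = hinner (L2 M) (T (\<xi>' m)) (\<eta>' m)" for m
        by (simp add: g_def \<xi>'_def \<eta>'_def)
      have "summable (\<lambda>m. K * ((hnorm (L2 M) (\<xi>' m))\<^sup>2 + (hnorm (L2 M) (\<eta>' m))\<^sup>2))"
        by (intro summable_mult summable_add \<xi>'s \<eta>'s)
      then have "summable (\<lambda>m. cmod (g (prod_decode m)))"
      proof (rule summable_comparison_test')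
        fix m
        have "cmod (g (prod_decode m)) \<le> hnorm (L2 M) (T (\<xi>' m)) * hnorm (L2 M) (\<eta>' m)"
          unfolding gm by (rule L2.Cauchy_Schwarz[OF L2.bounded_operator_closed[OF T' \<xi>'c] \<eta>'c])
        also have "\<dots> \<le> K * hnorm (L2 M) (\<xi>' m) * hnorm (L2 M) (\<eta>' m)"
          by (rule mult_right_mono[OF K(2)[OF \<xi>'c]]) (simp add: \<eta>'c)
        also have "\<dots> \<le> K * ((hnorm (L2 M) (\<xi>' m))\<^sup>2 + (hnorm (L2 M) (\<eta>' m))\<^sup>2)"
          unfolding mult.assoc by (rule mult_left_mono[OF mult_le_power2_sum K(1)])
        finally show "norm (cmod (g (prod_decode m))) \<le> K * ((hnorm (L2 M) (\<xi>' m))\<^sup>2 + (hnorm (L2 M) (\<eta>' m))\<^sup>2)"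
          by simp
      qed
      then have "(\<Sum>m. g (prod_decode m)) = (\<Sum>k. \<Sum>n. g (k, n))" by (rule suminf_prod_decode)
      also have "\<dots> = (\<Sum>k. hinner (L2 M) (column_map T (\<xi> k)) (\<eta> k))"
      proof (rule suminf_cong)
        fix k
        show "(\<Sum>n. g (k, n)) = hinner (L2 M) (column_map T (\<xi> k)) (\<eta> k)"
          using B.row_op_hinner[OF image_summable(1)[OF T' \<xi>(1)] image_summable(2)[OF T' \<xi>(1)] \<eta>(1), of k k]
          by (simp add: g_def column_map_def \<xi>)
      qed
      finally show ?thesis using p p' by (simp add: f_def gm \<xi>_def \<eta>_def)
    qed
    then show ?thesis using p' by blast
  qed
  have top: "topspace (pullback_topology B f P) = B"
    using topspace_sigma_weak[of "L2 M"] by (simp add: W B_def)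
  show ?thesis
    unfolding W
  proof (rule continuous_map_pullback')
    show "topspace (pullback_topology B f P) \<subseteq> column_map -` B"
      unfolding top using column_map_bounded by (auto simp: B_def)
    show "continuous_map (pullback_topology B f P) P (f \<circ> column_map)"
      unfolding P_def continuous_map_componentwise
    proof (intro conjI ballI)
      show "(f \<circ> column_map) ` topspace (pullback_topology B f (product_topology (\<lambda>_. euclidean) I)) \<subseteq> extensional I"
        by (auto simp: f_def)
      fix p assume "p \<in> I"
      then obtain p' where p': "p' \<in> I" "\<forall>T\<in>B. f (column_map T) p = f T p'" using pull by blast
      show "continuous_map (pullback_topology B f (product_topology (\<lambda>_. euclidean) I)) euclidean (\<lambda>T. (f \<circ> column_map) T p)"
        unfolding P_def[symmetric]
        by (rule continuous_map_eq[OF coord[OF p'(1)]]) (use p'(2) top in simp)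
    qed
  qed
qed

end

context
  fixes \<mu> :: "('g::{topological_group_add, second_countable_topology}) measure"
    and p q :: "nat \<Rightarrow> 'g \<Rightarrow> complex" and \<phi> :: "'g \<Rightarrow> complex" and C :: real
  assumes haar: "left_haar_measure \<mu>"
    and p_cont: "\<And>n. continuous_on UNIV (p n)" and q_cont: "\<And>n. continuous_on UNIV (q n)"
    and p_bound: "\<And>N x. (\<Sum>n<N. (cmod (p n x))\<^sup>2) \<le> C"
    and q_bound: "\<And>N y. (\<Sum>n<N. (cmod (q n y))\<^sup>2) \<le> C"
    and factor: "\<And>x y. \<phi> (- y + x) = (\<Sum>n. p n x * cnj (q n y))"
begin

lemma two_columns_factorization: "two_columns \<mu> (\<lambda>n x. p n (- x)) (\<lambda>n x. q n (- x)) C"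
proof -
  have "(\<lambda>x. h (- x)) \<in> borel_measurable \<mu>" if "continuous_on UNIV h" for h :: "'g \<Rightarrow> complex"
  proof -
    have "continuous_on UNIV (\<lambda>x. h (- x))"
      by (rule continuous_on_compose2[OF that]) (auto intro!: continuous_intros)
    then have "(\<lambda>x. h (- x)) \<in> borel_measurable borel" by (rule borel_measurable_continuous_onI)
    then show ?thesis by (simp cong: measurable_cong_sets add: haar_sets[OF haar])
  qed
  then show ?thesis
    using p_cont q_cont p_bound q_bound by (simp add: two_columns_def bounded_column_def)
qed

interpretation two_columns \<mu> "\<lambda>n x. p n (- x)" "\<lambda>n x. q n (- x)" C
  by (rule two_columns_factorization)

text \<open>At \<open>x\<close> the sum of \<open>p\<^sub>n\<close> at \<open>(g\<inverse>x)\<inverse>\<close> times the conjugate of \<open>q\<^sub>n\<close> at \<open>x\<inverse>\<close> is \<open>\<phi>(x x\<inverse>g) = \<phi>(g)\<close>.\<close>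

lemma column_map_left_regular:
  "column_map (left_regular \<mu> g) = \<phi> g \<odot>\<^bsub>op_algebra (L2 \<mu>)\<^esub> left_regular \<mu> g"
proof
  fix F
  show "column_map (left_regular \<mu> g) F = (\<phi> g \<odot>\<^bsub>op_algebra (L2 \<mu>)\<^esub> left_regular \<mu> g) F"
  proof (cases "F \<in> carrier (L2 \<mu>)")
    case True
    then obtain f where f: "f \<in> square_integrable \<mu>" and F: "F = ae_class \<mu> f" by (auto simp: L2_carrier_simp)
    have G: "left_regular \<mu> g (mult_op \<mu> (\<lambda>x. p n (- x)) F) = ae_class \<mu> (\<lambda>x. p n (- (- g + x)) * f (- g + x))" for n
      unfolding F A.mult_op_class[OF f] by (rule left_regular_class[OF haar A.square_integrable_mult[OF f]])
    have sq: "(\<lambda>x. p n (- (- g + x)) * f (- g + x)) \<in> square_integrable \<mu>" for n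
      by (rule square_integrable_translate[OF haar A.square_integrable_mult[OF f]])
    have "AE x in \<mu>. \<forall>n. rep (ae_class \<mu> (\<lambda>x. p n (- (- g + x)) * f (- g + x))) x = p n (- (- g + x)) * f (- g + x)"
      unfolding AE_all_countable using rep_ae_class(2)[OF square_integrable_measurable[OF sq]] by blast
    then have "AE x in \<mu>. (\<Sum>n. cnj (q n (- x)) * rep (left_regular \<mu> g (mult_op \<mu> (\<lambda>x. p n (- x)) F)) x) = \<phi> g * f (- g + x)"
    proof eventually_elim
      fix x assume x: "\<forall>n. rep (ae_class \<mu> (\<lambda>x. p n (- (- g + x)) * f (- g + x))) x = p n (- (- g + x)) * f (- g + x)"
      have "summable (\<lambda>n. cmod (p n (- (- g + x)) * cnj (q n (- x))))"
        by (rule summable_norm_mult_square)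
          (use summable_square_bounded(1)[OF p_bound] summable_square_bounded(1)[OF q_bound] in simp_all)
      then have "summable (\<lambda>n. p n (- (- g + x)) * cnj (q n (- x)))" by (rule summable_norm_cancel)
      then have "(\<Sum>n. (p n (- (- g + x)) * cnj (q n (- x))) * f (- g + x)) = (\<Sum>n. p n (- (- g + x)) * cnj (q n (- x))) * f (- g + x)"
        by (rule suminf_mult2[symmetric])
      also have "(\<Sum>n. p n (- (- g + x)) * cnj (q n (- x))) = \<phi> (- (- x) + - (- g + x))"
        by (rule factor[symmetric])
      also have "- (- x) + - (- g + x) = g" by (simp add: minus_add add.assoc[symmetric])
      finally show "(\<Sum>n. cnj (q n (- x)) * rep (left_regular \<mu> g (mult_op \<mu> (\<lambda>x. p n (- x)) F)) x) = \<phi> g * f (- g + x)"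
        unfolding G x[rule_format] by (simp add: mult_ac)
    qed
    from ae_class_cong[OF this]
    have "column_map (left_regular \<mu> g) F = ae_class \<mu> (\<lambda>x. \<phi> g * f (- g + x))"
      using True by (simp add: column_map_def row_op_def)
    then show ?thesis by (simp add: F smult_left_regular_class[OF haar f])
  next
    case False
    then show ?thesis by (simp add: column_map_def op_algebra_simps)
  qed
qed

lemma column_map_regular_span: "column_map ` regular_span \<mu> \<subseteq> regular_span \<mu>"
proof -
  let ?A = "op_algebra (L2 \<mu>)"
  interpret op: abelian_monoid ?A by (rule L2.op_algebra_abelian_monoid)
  have in_carrier: "c \<odot>\<^bsub>?A\<^esub> left_regular \<mu> g \<in> carrier ?A" for c g
    using L2.op_smult_closed[OF left_regular_bounded[OF haar]] by (simp add: op_algebra_simps(1))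
  have eq: "column_map (finsum ?A (\<lambda>g. c g \<odot>\<^bsub>?A\<^esub> left_regular \<mu> g) F)
      = finsum ?A (\<lambda>g. (c g * \<phi> g) \<odot>\<^bsub>?A\<^esub> left_regular \<mu> g) F" if "finite F" for c F
    using that
  proof (induction F rule: finite_induct)
    case empty
    have z: "0 \<odot>\<^bsub>?A\<^esub> T = \<zero>\<^bsub>?A\<^esub>" if "T \<in> bounded_operators (L2 \<mu>)" for T
      using L2.bounded_operator_closed[OF that] by (auto simp: op_algebra_simps fun_eq_iff)
    have "column_map (\<zero>\<^bsub>?A\<^esub>) = \<zero>\<^bsub>?A\<^esub>"
      using column_map_smult[OF L2.op_zero_closed, of 0] z[OF L2.op_zero_closed]
        z[OF column_map_bounded[OF L2.op_zero_closed]] by simp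
    then show ?case by simp
  next
    case (insert g F)
    let ?S = "finsum ?A (\<lambda>g. c g \<odot>\<^bsub>?A\<^esub> left_regular \<mu> g) F"
    have S: "?S \<in> bounded_operators (L2 \<mu>)"
      using op.finsum_closed[of "\<lambda>g. c g \<odot>\<^bsub>?A\<^esub> left_regular \<mu> g" F] in_carrier by (simp add: op_algebra_simps(1))
    have e: "finsum ?A (\<lambda>g. d g \<odot>\<^bsub>?A\<^esub> left_regular \<mu> g) (insert g F)
        = (d g \<odot>\<^bsub>?A\<^esub> left_regular \<mu> g) \<oplus>\<^bsub>?A\<^esub> finsum ?A (\<lambda>g. d g \<odot>\<^bsub>?A\<^esub> left_regular \<mu> g) F" for d
      by (rule op.finsum_insert) (use insert in_carrier in auto)
    have "column_map (c g \<odot>\<^bsub>?A\<^esub> left_regular \<mu> g) = c g \<odot>\<^bsub>?A\<^esub> (\<phi> g \<odot>\<^bsub>?A\<^esub> left_regular \<mu> g)"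
      by (simp only: column_map_smult[OF left_regular_bounded[OF haar]] column_map_left_regular)
    also have "\<dots> = (c g * \<phi> g) \<odot>\<^bsub>?A\<^esub> left_regular \<mu> g"
      using L2.smult_assoc1[of "c g" "\<phi> g", simplified] L2.bounded_operator_closed[OF left_regular_bounded[OF haar]]
      by (auto simp: op_algebra_simps fun_eq_iff)
    finally show ?case
      unfolding e column_map_add[OF L2.op_smult_closed[OF left_regular_bounded[OF haar]] S] insert.IH by simp
  qed
  show ?thesis
  proof (rule image_subsetI)
    fix T assume "T \<in> regular_span \<mu>"
    then obtain c F where T: "T = finsum ?A (\<lambda>g. c g \<odot>\<^bsub>?A\<^esub> left_regular \<mu> g) F" and F: "finite F"
      unfolding regular_span_def[OF haar] by blast
    show "column_map T \<in> regular_span \<mu>"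
      unfolding regular_span_def[OF haar] T eq[OF F]
      by (intro CollectI exI[of _ "\<lambda>g. c g * \<phi> g"] exI[of _ F] conjI refl F)
  qed
qed

theorem fourier_multiplier_map_exists: "\<exists>\<Phi>. fourier_multiplier_map \<mu> \<phi> \<Phi>"
proof -
  let ?W = "sigma_weak_topology (L2 \<mu>)" and ?V = "group_vN \<mu>"
  have "column_map ` ?V \<subseteq> ?W closure_of (column_map ` regular_span \<mu>)"
    unfolding group_vN_eq[OF haar]
    by (rule continuous_map_image_closure_subset[OF column_map_sigma_weak_continuous])
  also have "\<dots> \<subseteq> ?V"
    unfolding group_vN_eq[OF haar] by (rule closure_of_mono[OF column_map_regular_span])
  finally have V: "column_map ` ?V \<subseteq> ?V" .
  have bd: "T \<in> bounded_operators (L2 \<mu>)" if "T \<in> ?V" for T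
    using group_vN_bounded[OF haar] that by blast
  have "completely_bounded (L2 \<mu>) ?V column_map"
    unfolding completely_bounded_def linear_on_ops_def
  proof (intro conjI ballI allI exI[of _ C] impI)
    fix n :: nat and A assume "\<forall>i<n. \<forall>j<n. A i j \<in> ?V"
    then show "matrix_op_norm (L2 \<mu>) n (\<lambda>i j. column_map (A i j)) \<le> C * matrix_op_norm (L2 \<mu>) n A"
      by (intro column_map_matrix_bound bd) auto
  qed (simp_all add: column_map_add column_map_smult bd)
  moreover have "continuous_map (subtopology ?W ?V) (subtopology ?W ?V) column_map"
    unfolding continuous_map_in_subtopology
    using V by (auto intro!: continuous_map_from_subtopology column_map_sigma_weak_continuous)
  ultimately have "fourier_multiplier_map \<mu> \<phi> column_map"
    unfolding fourier_multiplier_map_def using V column_map_left_regular by auto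
  then show ?thesis by blast
qed

end

section \<open>Representations on vectors with continuous orbits\<close>

text \<open>An action by bounded operators on a complete space, with a bound that is continuous in the group
  element and therefore locally bounded.\<close>

locale bounded_action = pre_hilbert H for H :: "'a hilbert" (structure) +
  fixes P :: "'g::topological_group_add \<Rightarrow> 'a \<Rightarrow> 'a" and \<omega> :: "'g \<Rightarrow> real"
  assumes P_closed: "x \<in> carrier H \<Longrightarrow> P g x \<in> carrier H"
    and P_add: "\<lbrakk>x \<in> carrier H; y \<in> carrier H\<rbrakk> \<Longrightarrow> P g (x \<oplus> y) = P g x \<oplus> P g y"
    and P_smult: "x \<in> carrier H \<Longrightarrow> P g (c \<odot> x) = c \<odot> P g x"
    and P_norm: "x \<in> carrier H \<Longrightarrow> hnorm H (P g x) \<le> \<omega> g * hnorm H x"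
    and P_zero: "x \<in> carrier H \<Longrightarrow> P 0 x = x"
    and P_plus: "x \<in> carrier H \<Longrightarrow> P g (P h x) = P (g + h) x"
    and \<omega>_nonneg: "0 \<le> \<omega> g" and \<omega>_cont: "continuous_on UNIV \<omega>"
    and Cauchy_conv: "\<lbrakk>range \<sigma> \<subseteq> carrier H; \<And>e. e > 0 \<Longrightarrow> \<exists>N. \<forall>m\<ge>N. \<forall>n\<ge>N. hdist H (\<sigma> m) (\<sigma> n) < e\<rbrakk>
       \<Longrightarrow> \<exists>x\<in>carrier H. (\<lambda>n::nat. hdist H (\<sigma> n) x) \<longlonglongrightarrow> 0"
begin

definition continuity_vectors :: "'a set" where
  "continuity_vectors = {x \<in> carrier H. \<forall>h. ((\<lambda>k. hdist H (P k x) (P h x)) \<longlongrightarrow> 0) (at h)}"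

lemma continuity_vectors_carrier: "x \<in> continuity_vectors \<Longrightarrow> x \<in> carrier H"
  by (simp add: continuity_vectors_def)

lemma hdist_P:
  assumes "x \<in> carrier H" "y \<in> carrier H"
  shows "hdist H (P g x) (P g y) \<le> \<omega> g * hdist H x y"
proof -
  have "P g x \<oplus> (- 1) \<odot> P g y = P g (x \<oplus> (- 1) \<odot> y)" using assms by (simp add: P_add P_smult)
  then show ?thesis using assms P_norm[of "x \<oplus> (- 1) \<odot> y" g] by (simp add: hdist_eq P_closed)
qed

lemma hdist_add_le:
  assumes "x \<in> carrier H" "y \<in> carrier H" "x' \<in> carrier H" "y' \<in> carrier H"
  shows "hdist H (x \<oplus> y) (x' \<oplus> y') \<le> hdist H x x' + hdist H y y'"
proof -
  have "(x \<oplus> y) \<oplus> (- 1) \<odot> (x' \<oplus> y') = (x \<oplus> (- 1) \<odot> x') \<oplus> (y \<oplus> (- 1) \<odot> y')"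
    using assms smult_r_distr[of "- 1" x' y'] by (simp add: a_ac)
  then show ?thesis
    using assms hnorm_triangle[of "x \<oplus> (- 1) \<odot> x'" "y \<oplus> (- 1) \<odot> y'"] by (simp add: hdist_eq)
qed

lemma hdist_smult:
  assumes "x \<in> carrier H" "y \<in> carrier H"
  shows "hdist H (c \<odot> x) (c \<odot> y) = cmod c * hdist H x y"
proof -
  have "(- 1) \<odot> (c \<odot> y) = c \<odot> ((- 1) \<odot> y)"
    using assms smult_assoc1[of "- 1" c y] smult_assoc1[of c "- 1" y] by simp
  then have "c \<odot> x \<oplus> (- 1) \<odot> (c \<odot> y) = c \<odot> (x \<oplus> (- 1) \<odot> y)"
    using assms smult_r_distr[of c x "(- 1) \<odot> y"] by simp
  then show ?thesis using assms by (simp add: hdist_eq hnorm_smult)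
qed

lemma continuity_vectorsI_squeeze:
  assumes x: "x \<in> carrier H"
    and f: "\<And>h. (f h \<longlongrightarrow> 0) (at h)" and le: "\<And>h k. hdist H (P k x) (P h x) \<le> f h k"
  shows "x \<in> continuity_vectors"
  unfolding continuity_vectors_def
proof (intro CollectI conjI x allI)
  fix h
  show "((\<lambda>k. hdist H (P k x) (P h x)) \<longlongrightarrow> 0) (at h)"
    by (rule tendsto_sandwich[OF _ _ tendsto_const f[of h]])
      (auto intro!: always_eventually simp: le hdist_nonneg P_closed x)
qed

lemma continuity_vectorsD: "x \<in> continuity_vectors \<Longrightarrow> ((\<lambda>k. hdist H (P k x) (P h x)) \<longlongrightarrow> 0) (at h)"
  by (simp add: continuity_vectors_def)

lemma zero_continuity: "\<zero> \<in> continuity_vectors"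
proof (rule continuity_vectorsI_squeeze[where f = "\<lambda>_ _. 0"])
  have "P g \<zero> = \<zero>" for g using P_smult[of \<zero> g 0] by (simp add: P_closed)
  then show "hdist H (P k \<zero>) (P h \<zero>) \<le> 0" for h k using hdist_eq_0_iff[of \<zero> \<zero>] by simp
qed auto

lemma add_continuity:
  assumes "x \<in> continuity_vectors" "y \<in> continuity_vectors"
  shows "x \<oplus> y \<in> continuity_vectors"
proof (rule continuity_vectorsI_squeeze)
  note c = assms[THEN continuity_vectors_carrier]
  show "x \<oplus> y \<in> carrier H" using c by simp
  show "((\<lambda>k. hdist H (P k x) (P h x) + hdist H (P k y) (P h y)) \<longlongrightarrow> 0) (at h)" for h
    using tendsto_add[OF assms[THEN continuity_vectorsD]] by simp
  show "hdist H (P k (x \<oplus> y)) (P h (x \<oplus> y)) \<le> hdist H (P k x) (P h x) + hdist H (P k y) (P h y)" for h k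
    using c by (simp add: P_add hdist_add_le P_closed)
qed

lemma smult_continuity:
  assumes "x \<in> continuity_vectors"
  shows "c \<odot> x \<in> continuity_vectors"
proof (rule continuity_vectorsI_squeeze)
  note c = assms[THEN continuity_vectors_carrier]
  show "c \<odot> x \<in> carrier H" using c by simp
  show "((\<lambda>k. cmod c * hdist H (P k x) (P h x)) \<longlongrightarrow> 0) (at h)" for h
    using tendsto_mult_right_zero[OF assms[THEN continuity_vectorsD]] by simp
  show "hdist H (P k (c \<odot> x)) (P h (c \<odot> x)) \<le> cmod c * hdist H (P k x) (P h x)" for h k
    using c by (simp add: P_smult hdist_smult P_closed)
qed

text \<open>The operators are uniformly bounded near \<open>h\<close>, hence orbits of nearby vectors stay close to each
  other.\<close>

lemma continuity_vectors_closed: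
  assumes \<sigma>: "\<And>n::nat. \<sigma> n \<in> continuity_vectors" and x: "x \<in> carrier H"
    and lim: "(\<lambda>n. hdist H (\<sigma> n) x) \<longlonglongrightarrow> 0"
  shows "x \<in> continuity_vectors"
  unfolding continuity_vectors_def
proof (intro CollectI conjI x allI tendstoI)
  fix h and e :: real assume e: "e > 0"
  note c = \<sigma>[THEN continuity_vectors_carrier]
  define B where "B = \<omega> h + 1"
  have B: "B > 0" using \<omega>_nonneg[of h] by (simp add: B_def)
  have "(\<omega> \<longlongrightarrow> \<omega> h) (at h)" using \<omega>_cont by (simp add: continuous_on_def)
  then have ev1: "\<forall>\<^sub>F k in at h. \<omega> k < B" by (rule order_tendstoD) (simp add: B_def)
  have "e / (4 * B) > 0" using e B by simp
  from LIMSEQ_D[OF lim this] obtain n where n: "hdist H (\<sigma> n) x < e / (4 * B)"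
    using hdist_nonneg[OF c x] by auto
  have ev2: "\<forall>\<^sub>F k in at h. hdist H (P k (\<sigma> n)) (P h (\<sigma> n)) < e / 2"
    by (rule order_tendstoD(2)[OF continuity_vectorsD[OF \<sigma>]]) (use e in simp)
  show "\<forall>\<^sub>F k in at h. dist (hdist H (P k x) (P h x)) 0 < e"
    using ev1 ev2
  proof eventually_elim
    case (elim k)
    have small: "hdist H (P g (\<sigma> n)) (P g x) \<le> e / 4" if "\<omega> g \<le> B" for g
    proof -
      have "hdist H (P g (\<sigma> n)) (P g x) \<le> \<omega> g * hdist H (\<sigma> n) x" by (rule hdist_P[OF c x])
      also have "\<dots> \<le> B * (e / (4 * B))"
        using that n \<omega>_nonneg[of g] hdist_nonneg[OF c x] by (intro mult_mono) auto
      finally show ?thesis using B by simp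
    qed
    have "hdist H (P k x) (P h x) \<le> hdist H (P k x) (P k (\<sigma> n)) + hdist H (P k (\<sigma> n)) (P h x)"
      by (rule hdist_triangle) (simp_all add: P_closed c x)
    also have "hdist H (P k (\<sigma> n)) (P h x) \<le> hdist H (P k (\<sigma> n)) (P h (\<sigma> n)) + hdist H (P h (\<sigma> n)) (P h x)"
      by (rule hdist_triangle) (simp_all add: P_closed c x)
    finally have "hdist H (P k x) (P h x) < e"
      using small[of k] small[of h] elim hdist_commute[OF P_closed[OF x, of k] P_closed[OF c[of n], of k]]
      by (simp add: B_def)
    then show ?case using hdist_nonneg[OF P_closed[OF x] P_closed[OF x]] by simp
  qed
qed

lemma P_continuity:
  assumes x: "x \<in> continuity_vectors"
  shows "P g x \<in> continuity_vectors"
  unfolding continuity_vectors_def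
proof (intro CollectI conjI allI)
  note c = x[THEN continuity_vectors_carrier]
  show "P g x \<in> carrier H" by (rule P_closed[OF c])
  fix h
  have "filterlim (\<lambda>k. k + g) (at (h + g)) (at h)"
    by (rule filterlim_atI) (auto intro!: tendsto_intros simp: eventually_at_filter)
  from filterlim_compose[OF continuity_vectorsD[OF x] this]
  show "((\<lambda>k. hdist H (P k (P g x)) (P h (P g x))) \<longlongrightarrow> 0) (at h)" by (simp add: P_plus c)
qed

sublocale cv: closed_subspace H continuity_vectors
proof
  show "continuity_vectors \<subseteq> carrier H" using continuity_vectors_carrier by blast
  fix \<sigma> :: "nat \<Rightarrow> 'a"
  assume \<sigma>: "range \<sigma> \<subseteq> continuity_vectors"
    and Cau: "\<And>e. e > 0 \<Longrightarrow> \<exists>N. \<forall>m\<ge>N. \<forall>n\<ge>N. hdist H (\<sigma> m) (\<sigma> n) < e"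
  have "range \<sigma> \<subseteq> carrier H" using \<sigma> continuity_vectors_carrier by blast
  from Cauchy_conv[OF this Cau] obtain x where x: "x \<in> carrier H" "(\<lambda>n. hdist H (\<sigma> n) x) \<longlonglongrightarrow> 0" by blast
  have "\<sigma> n \<in> continuity_vectors" for n using \<sigma> by blast
  then have "x \<in> continuity_vectors" by (rule continuity_vectors_closed[OF _ x])
  then show "\<exists>x\<in>continuity_vectors. (\<lambda>n. hdist H (\<sigma> n) x) \<longlonglongrightarrow> 0" using x by blast
qed (rule zero_continuity, rule add_continuity, assumption+, rule smult_continuity)

abbreviation "HC \<equiv> restrict_hilbert H continuity_vectors"

definition rep_of :: "'g \<Rightarrow> 'a \<Rightarrow> 'a" where
  "rep_of g = restrict (P g) continuity_vectors"

lemma rep_of_bounded: "rep_of g \<in> bounded_operators HC"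
proof -
  interpret HC: pre_hilbert HC by (rule cv.pre_hilbert_restrict)
  show ?thesis
    by (rule HC.bounded_operatorI[where C = "\<omega> g"])
      (auto simp: rep_of_def P_continuity add_continuity smult_continuity P_add P_smult P_norm continuity_vectors_carrier)
qed

lemma rep_of_compose: "compose continuity_vectors (rep_of g) (rep_of h) = rep_of (g + h)"
  by (auto simp: compose_def rep_of_def P_continuity P_plus continuity_vectors_carrier fun_eq_iff)

lemma rep_of_zero: "rep_of 0 = (\<lambda>x\<in>continuity_vectors. x)"
  by (auto simp: rep_of_def P_zero continuity_vectors_carrier fun_eq_iff)

lemma strongly_continuous_rep_of: "strongly_continuous_rep HC rep_of"
  unfolding strongly_continuous_rep_def
proof
  show "rep_of \<in> hom add_group (units_of (op_algebra HC))"
  proof -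
    have "rep_of g \<in> Units (op_algebra HC)" for g
    proof -
      have "rep_of (- g) \<in> bounded_operators HC" by (rule rep_of_bounded)
      moreover have "compose continuity_vectors (rep_of (- g)) (rep_of g) = (\<lambda>x\<in>continuity_vectors. x)"
        "compose continuity_vectors (rep_of g) (rep_of (- g)) = (\<lambda>x\<in>continuity_vectors. x)"
        by (simp_all add: rep_of_compose rep_of_zero)
      ultimately show ?thesis using rep_of_bounded[of g] by (auto simp: Units_def op_algebra_def)
    qed
    then show ?thesis by (auto simp: hom_def add_group_def units_of_def op_algebra_def rep_of_compose)
  qed
  interpret D: Metric_space continuity_vectors "hdist HC" by (rule cv.Metric_space_restrict)
  have nt: "norm_topology HC = D.mtopology" by (simp add: norm_topology_def)
  show "continuous_map euclidean (strong_op_topology HC) rep_of"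
    unfolding strong_op_topology_def continuous_map_in_subtopology continuous_map_componentwise
  proof (intro conjI ballI)
    show "rep_of ` topspace euclidean \<subseteq> extensional (carrier HC)" by (auto simp: rep_of_def)
    show "rep_of \<in> topspace euclidean \<rightarrow> bounded_operators HC" by (auto simp: rep_of_bounded)
    fix x assume "x \<in> carrier HC"
    then have x: "x \<in> continuity_vectors" by simp
    show "continuous_map euclidean (norm_topology HC) (\<lambda>g. rep_of g x)"
      unfolding nt D.continuous_map_to_metric
    proof (intro ballI allI impI)
      fix h and e :: real assume e: "e > 0"
      have "\<forall>\<^sub>F k in at h. hdist H (P k x) (P h x) < e"
        using order_tendstoD(2)[OF continuity_vectorsD[OF x] e] .
      then obtain U where U: "open U" "h \<in> U" "\<And>k. k \<in> U \<Longrightarrow> k \<noteq> h \<Longrightarrow> hdist H (P k x) (P h x) < e"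
        unfolding eventually_at_topological by blast
      have "rep_of k x \<in> D.mball (rep_of h x) e" if "k \<in> U" for k
      proof -
        have "hdist H (P h x) (P k x) < e"
        proof (cases "k = h")
          case True
          then show ?thesis using e hdist_eq_0_iff[of "P h x" "P h x"] P_closed continuity_vectors_carrier[OF x] by simp
        next
          case False
          then show ?thesis using U(3)[OF that] hdist_commute[of "P h x" "P k x"] P_closed continuity_vectors_carrier[OF x] by simp
        qed
        then show ?thesis using x P_continuity by (simp add: D.in_mball rep_of_def cv.hdist_restrict)
      qed
      then show "\<exists>U. openin euclidean U \<and> h \<in> U \<and> (\<forall>k\<in>U. rep_of k x \<in> D.mball (rep_of h x) e)"
        using U by auto
    qed
  qed
qed

lemma op_norm_rep_of: "op_norm HC (rep_of g) \<le> \<omega> g"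
  unfolding op_norm_def
proof (rule cSup_least)
  show "{hnorm HC (rep_of g x) |x. x \<in> carrier HC \<and> hnorm HC x \<le> 1} \<noteq> {}"
    using zero_continuity by (auto intro!: exI[of _ \<zero>])
  fix s assume "s \<in> {hnorm HC (rep_of g x) |x. x \<in> carrier HC \<and> hnorm HC x \<le> 1}"
  then obtain x where x: "x \<in> continuity_vectors" "hnorm H x \<le> 1" and s: "s = hnorm H (P g x)"
    by (auto simp: rep_of_def)
  have "s \<le> \<omega> g * hnorm H x" unfolding s by (rule P_norm[OF continuity_vectors_carrier[OF x(1)]])
  also have "\<dots> \<le> \<omega> g * 1" by (rule mult_left_mono[OF x(2) \<omega>_nonneg])
  finally show "s \<le> \<omega> g" by simp
qed

end

section \<open>The weighted measure and the representation\<close>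

lemma haar_nonzero: "left_haar_measure \<mu> \<Longrightarrow> emeasure \<mu> UNIV \<noteq> 0"
  unfolding left_haar_measure_def by blast

lemma haar_compact_finite: "left_haar_measure \<mu> \<Longrightarrow> compact K \<Longrightarrow> emeasure \<mu> K < \<infinity>"
  unfolding left_haar_measure_def by blast

text \<open>Cut the group into the shells \<open>n \<le> d(g,e) < n + 1\<close> and compare with a geometric series of ratio
  \<open>exp(b - c)\<close>.\<close>

lemma nn_integral_exp_dist_finite:
  fixes \<mu> :: "'g::{topological_group_add, metric_space, second_countable_topology} measure"
  assumes haar: "left_haar_measure \<mu>"
    and growth: "\<And>n::nat. emeasure \<mu> (ball 0 (real n)) \<le> ennreal (a * exp (b * real n))"
    and a: "a > 0" and c: "b < c" "0 < c"
  shows "(\<integral>\<^sup>+g. ennreal (exp (- c * dist g 0)) \<partial>\<mu>) < \<infinity>"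
proof -
  have sets: "ball (0::'g) r \<in> sets \<mu>" for r by (simp add: haar_sets[OF haar])
  have term_le: "h n \<le> (\<Sum>i. h i)" for h :: "nat \<Rightarrow> ennreal" and n
    using sum_le_suminf[of h "{n}"] by simp
  have pt: "ennreal (exp (- c * dist g 0)) \<le> (\<Sum>n. ennreal (exp (- c * real n)) * indicator (ball 0 (real (Suc n))) g)" for g :: 'g
  proof -
    obtain n where n: "real n \<le> dist g 0" "dist g 0 < real (Suc n)"
    proof
      have "real (nat \<lfloor>dist g 0\<rfloor>) = of_int \<lfloor>dist g 0\<rfloor>" by (rule of_nat_nat) simp
      then show "real (nat \<lfloor>dist g 0\<rfloor>) \<le> dist g 0" "dist g 0 < real (Suc (nat \<lfloor>dist g 0\<rfloor>))"
        unfolding of_nat_Suc using floor_correct[of "dist g 0"] by linarith+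
    qed
    have "ennreal (exp (- c * dist g 0)) \<le> ennreal (exp (- c * real n)) * indicator (ball 0 (real (Suc n))) g"
    proof -
      have "g \<in> ball 0 (real (Suc n))" using n(2) by (simp only: mem_ball dist_commute)
      moreover have "exp (- c * dist g 0) \<le> exp (- c * real n)"
        using mult_left_mono[OF n(1), of c] c(2) by simp
      ultimately show ?thesis by (simp add: ennreal_leI)
    qed
    also have "\<dots> \<le> (\<Sum>n. ennreal (exp (- c * real n)) * indicator (ball 0 (real (Suc n))) g)"
      by (rule term_le)
    finally show ?thesis .
  qed
  have "(\<integral>\<^sup>+g. ennreal (exp (- c * dist g 0)) \<partial>\<mu>) \<le>
     (\<integral>\<^sup>+g. (\<Sum>n. ennreal (exp (- c * real n)) * indicator (ball 0 (real (Suc n))) g) \<partial>\<mu>)"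
    by (rule nn_integral_mono[OF pt])
  also have "\<dots> = (\<Sum>n. \<integral>\<^sup>+g. ennreal (exp (- c * real n)) * indicator (ball 0 (real (Suc n))) g \<partial>\<mu>)"
    by (rule nn_integral_suminf)
      (intro borel_measurable_times_ennreal borel_measurable_const borel_measurable_indicator sets)
  also have "\<dots> = (\<Sum>n. ennreal (exp (- c * real n)) * emeasure \<mu> (ball 0 (real (Suc n))))"
    using sets by (simp add: nn_integral_cmult_indicator)
  also have "\<dots> \<le> (\<Sum>n. ennreal (a * exp b * exp (b - c) ^ n))"
  proof (rule suminf_le)
    fix n
    have "ennreal (exp (- c * real n)) * emeasure \<mu> (ball 0 (real (Suc n)))
       \<le> ennreal (exp (- c * real n)) * ennreal (a * exp (b * real (Suc n)))"
      by (rule mult_left_mono[OF growth]) simp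
    also have "\<dots> = ennreal (exp (- c * real n) * (a * exp (b * real (Suc n))))"
      using a by (simp add: ennreal_mult)
    also have "exp (- c * real n) * (a * exp (b * real (Suc n))) = a * exp b * exp (b - c) ^ n"
      by (simp add: exp_of_nat_mult[symmetric] exp_add[symmetric] algebra_simps)
    finally show "ennreal (exp (- c * real n)) * emeasure \<mu> (ball 0 (real (Suc n)))
       \<le> ennreal (a * exp b * exp (b - c) ^ n)" .
  qed auto
  also have "\<dots> = ennreal (\<Sum>n. a * exp b * exp (b - c) ^ n)"
    by (rule suminf_ennreal2) (use a c in \<open>auto intro!: summable_mult summable_geometric\<close>)
  also have "\<dots> < \<infinity>" by simp
  finally show ?thesis .
qed

lemma unit_vector_exists:
  fixes \<mu> :: "'g::{topological_group_add, metric_space, second_countable_topology} measure"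
  assumes haar: "left_haar_measure \<mu>" and proper: "\<And>(x :: 'g) r. compact (cball x r)"
  shows "\<exists>f\<in>square_integrable \<mu>. hnorm (L2 \<mu>) (ae_class \<mu> f) = 1"
proof -
  have sets: "ball (0::'g) r \<in> sets \<mu>" for r by (simp add: haar_sets[OF haar])
  have "(\<Union>n. ball (0::'g) (real n)) = UNIV"
    using reals_Archimedean2 by (auto simp: dist_commute)
  moreover have "emeasure \<mu> UNIV \<noteq> 0" by (rule haar_nonzero[OF haar])
  ultimately obtain n where n: "emeasure \<mu> (ball (0::'g) (real n)) \<noteq> 0"
    using emeasure_UN_eq_0[of \<mu> "\<lambda>n. ball (0::'g) (real n)"] sets by auto
  define B where "B = ball (0::'g) (real n)"
  have B: "B \<in> sets \<mu>" using sets by (simp add: B_def)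
  have "emeasure \<mu> B \<le> emeasure \<mu> (cball 0 (real n))"
    by (rule emeasure_mono) (auto simp: B_def haar_sets[OF haar])
  also have "\<dots> < \<infinity>" by (rule haar_compact_finite[OF haar proper])
  finally have fin: "emeasure \<mu> B < \<infinity>" .
  define m where "m = measure \<mu> B"
  have m: "emeasure \<mu> B = ennreal m" using fin by (simp add: m_def emeasure_eq_ennreal_measure)
  have mpos: "m > 0" using n m by (simp add: B_def[symmetric] less_le m_def)
  define f where "f x = complex_of_real (indicator B x / sqrt m)" for x
  have i: "(cmod (f x))\<^sup>2 = indicator B x / m" for x
    using mpos by (simp add: f_def norm_divide power_divide indicator_def)
  have "integrable \<mu> (indicator B :: _ \<Rightarrow> real)" using B fin by simp
  then have int: "integrable \<mu> (\<lambda>x. indicator B x / m)" by simp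
  have f: "f \<in> square_integrable \<mu>"
    unfolding square_integrable_def using int B by (simp add: i) (simp add: f_def[abs_def])
  have "(hnorm (L2 \<mu>) (ae_class \<mu> f))\<^sup>2 = 1"
    unfolding hnorm_L2_power2[OF f] i using B fin mpos by (simp add: m_def)
  then have "hnorm (L2 \<mu>) (ae_class \<mu> f) = 1"
    using L2.hnorm_nonneg[OF ae_class_in_L2[OF f]] by (simp add: power2_eq_1_iff)
  then show ?thesis using f by blast
qed

definition weighted_haar :: "('g::{topological_group_add, metric_space}) measure \<Rightarrow> real \<Rightarrow> 'g measure" where
  "weighted_haar \<mu> c = density \<mu>
     (\<lambda>g. ennreal (exp (- c * dist g 0) / enn2real (\<integral>\<^sup>+g. ennreal (exp (- c * dist g 0)) \<partial>\<mu>)))"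

context
  fixes \<mu> :: "'g::{topological_group_add, metric_space, second_countable_topology} measure" and c :: real
  assumes haar: "left_haar_measure \<mu>"
    and left_invariant: "\<And>g x y :: 'g. dist (g + x) (g + y) = dist x y"
    and c: "0 < c"
    and finite_weight: "(\<integral>\<^sup>+g. ennreal (exp (- c * dist g 0)) \<partial>\<mu>) < \<infinity>"
begin

private abbreviation "Z \<equiv> enn2real (\<integral>\<^sup>+g. ennreal (exp (- c * dist g 0)) \<partial>\<mu>)"
private abbreviation "w g \<equiv> exp (- c * dist g 0) / Z"
private abbreviation "\<nu> \<equiv> weighted_haar \<mu> c"

lemma measurable_mu: "f \<in> borel_measurable borel \<Longrightarrow> f \<in> borel_measurable \<mu>"
  by (simp cong: measurable_cong_sets add: haar_sets[OF haar])

lemma weight_measurable [measurable]: "(\<lambda>g. ennreal (exp (- c * dist g 0) / K)) \<in> borel_measurable \<mu>"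
  unfolding divide_inverse
  by (rule measurable_mu)
    (intro measurable_compose[OF _ measurable_ennreal] borel_measurable_continuous_onI continuous_intros)

lemma Z_pos: "Z > 0"
proof -
  have "(\<integral>\<^sup>+g. ennreal (exp (- c * dist g 0)) \<partial>\<mu>) \<noteq> 0"
  proof
    assume "(\<integral>\<^sup>+g. ennreal (exp (- c * dist g 0)) \<partial>\<mu>) = 0"
    then have "emeasure \<mu> {x \<in> space \<mu>. ennreal (exp (- c * dist x 0)) \<noteq> 0} = 0"
      using weight_measurable[of 1] by (subst (asm) nn_integral_0_iff) simp_all
    moreover have "{x \<in> space \<mu>. ennreal (exp (- c * dist x 0)) \<noteq> 0} = UNIV"
      by (auto simp: haar_space[OF haar])
    ultimately show False using haar_nonzero[OF haar] by simp
  qed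
  then show ?thesis using finite_weight by (simp add: enn2real_positive_iff zero_less_iff_neq_zero)
qed

lemma sets_weighted [simp, measurable_cong]: "sets \<nu> = sets borel"
  by (simp add: weighted_haar_def haar_sets[OF haar])

lemma nn_integral_weighted:
  "f \<in> borel_measurable borel \<Longrightarrow> (\<integral>\<^sup>+g. f g \<partial>\<nu>) = (\<integral>\<^sup>+g. ennreal (w g) * f g \<partial>\<mu>)"
  unfolding weighted_haar_def by (rule nn_integral_density[OF weight_measurable measurable_mu])

lemma space_weighted [simp]: "space \<nu> = UNIV"
  by (simp add: weighted_haar_def haar_space[OF haar])

lemma emeasure_weighted: "emeasure \<nu> UNIV = 1"
proof -
  have "emeasure \<nu> UNIV = (\<integral>\<^sup>+g. 1 \<partial>\<nu>)" using nn_integral_const[of \<nu> 1] by simp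
  also have "\<dots> = (\<integral>\<^sup>+g. ennreal (w g) * 1 \<partial>\<mu>)" by (rule nn_integral_weighted) simp
  also have "\<dots> = (\<integral>\<^sup>+g. ennreal (1 / Z) * ennreal (exp (- c * dist g 0)) \<partial>\<mu>)"
    using Z_pos by (simp flip: ennreal_mult)
  also have "\<dots> = ennreal (1 / Z) * (\<integral>\<^sup>+g. ennreal (exp (- c * dist g 0)) \<partial>\<mu>)"
    using weight_measurable[of 1] by (intro nn_integral_cmult) simp
  also have "\<dots> = ennreal (1 / Z) * ennreal Z" using finite_weight by simp
  also have "ennreal (1 / Z) * ennreal Z = 1" using Z_pos by (simp flip: ennreal_mult)
  finally show ?thesis .
qed

lemma finite_measure_weighted: "finite_measure \<nu>"
  by (rule finite_measureI) (simp add: emeasure_weighted)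

lemma measurable_translation_borel: "(\<lambda>x. h + x) \<in> borel_measurable (borel :: 'g measure)"
  by (intro borel_measurable_continuous_onI continuous_intros)

text \<open>Left invariance of the metric gives \<open>d(g,e) \<le> d(hg,e) + d(h,e)\<close>, which compares the densities
  at \<open>hg\<close> and \<open>g\<close>.\<close>

lemma nn_integral_weighted_translate:
  assumes u: "u \<in> borel_measurable borel"
  shows "(\<integral>\<^sup>+g. u (- h + g) \<partial>\<nu>) \<le> ennreal (exp (c * dist h 0)) * (\<integral>\<^sup>+g. u g \<partial>\<nu>)"
proof -
  have uh: "(\<lambda>g. u (- h + g)) \<in> borel_measurable borel"
    by (rule measurable_compose[OF measurable_translation_borel u])
  have m: "(\<lambda>g. ennreal (w g) * u (- h + g)) \<in> borel_measurable \<mu>"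
    using measurable_mu[OF uh] weight_measurable[of Z] by measurable
  have wl: "w (h + g) \<le> exp (c * dist h 0) * w g" for g
  proof -
    have 1: "dist g (- h) = dist (h + g) 0" using left_invariant[of h g "- h"] by simp
    have 2: "dist (- h) 0 = dist h 0" using left_invariant[of h "- h" 0] by (simp add: dist_commute)
    have "dist g 0 \<le> dist (h + g) 0 + dist h 0" using dist_triangle[of g 0 "- h"] 1 2 by simp
    then have "c * dist g 0 \<le> c * dist (h + g) 0 + c * dist h 0"
      using mult_left_mono[of _ _ c] c by (simp add: distrib_left[symmetric])
    then have "exp (- c * dist (h + g) 0) \<le> exp (c * dist h 0) * exp (- c * dist g 0)"
      by (simp add: exp_add[symmetric])
    then have "exp (- c * dist (h + g) 0) / Z \<le> exp (c * dist h 0) * exp (- c * dist g 0) / Z"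
      by (rule divide_right_mono) simp
    then show ?thesis by simp
  qed
  have "(\<integral>\<^sup>+g. u (- h + g) \<partial>\<nu>) = (\<integral>\<^sup>+g. ennreal (w g) * u (- h + g) \<partial>\<mu>)"
    by (rule nn_integral_weighted[OF uh])
  also have "\<dots> = (\<integral>\<^sup>+g. ennreal (w (h + g)) * u (- h + (h + g)) \<partial>\<mu>)"
    by (rule nn_integral_translation[OF haar m, symmetric])
  also have "\<dots> \<le> (\<integral>\<^sup>+g. ennreal (exp (c * dist h 0)) * (ennreal (w g) * u g) \<partial>\<mu>)"
  proof (rule nn_integral_mono)
    fix g
    have "ennreal (w (h + g)) \<le> ennreal (exp (c * dist h 0)) * ennreal (w g)"
      using wl[of g] by (simp add: ennreal_leI flip: ennreal_mult)
    then have "ennreal (w (h + g)) * u g \<le> ennreal (exp (c * dist h 0)) * ennreal (w g) * u g"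
      by (rule mult_right_mono) simp
    then show "ennreal (w (h + g)) * u (- h + (h + g)) \<le> ennreal (exp (c * dist h 0)) * (ennreal (w g) * u g)"
      by (simp add: add.assoc[symmetric] mult.assoc)
  qed
  also have "\<dots> = ennreal (exp (c * dist h 0)) * (\<integral>\<^sup>+g. ennreal (w g) * u g \<partial>\<mu>)"
    using measurable_mu[OF u] weight_measurable[of Z] by (intro nn_integral_cmult) measurable
  also have "\<dots> = ennreal (exp (c * dist h 0)) * (\<integral>\<^sup>+g. u g \<partial>\<nu>)" by (simp only: nn_integral_weighted[OF u])
  finally show ?thesis .
qed

private abbreviation "N \<equiv> count_space (UNIV :: nat set)"
private abbreviation "M \<equiv> \<nu> \<Otimes>\<^sub>M N"

lemma sigma_finite_N: "sigma_finite_measure N"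
  by (rule sigma_finite_measure_count_space)

lemma borel_measurable_M:
  fixes f :: "'g \<times> nat \<Rightarrow> 'b::topological_space"
  assumes "\<And>n. (\<lambda>g. f (g, n)) \<in> borel_measurable borel"
  shows "f \<in> borel_measurable M"
proof -
  have "(\<lambda>x. (\<lambda>n x. f (fst x, n)) (snd x) x) \<in> borel_measurable M"
  proof (rule measurable_compose_countable'[where I = UNIV and f = "\<lambda>n x. f (fst x, n)" and g = snd])
    show "(\<lambda>x. f (fst x, n)) \<in> borel_measurable M" for n
      by (rule measurable_compose[OF measurable_fst]) (use assms[of n] in \<open>simp cong: measurable_cong_sets\<close>)
  qed auto
  then show ?thesis by simp
qed

lemma borel_measurable_section:
  fixes f :: "'g \<times> nat \<Rightarrow> 'b::topological_space"
  assumes "f \<in> borel_measurable M"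
  shows "(\<lambda>g. f (g, n)) \<in> borel_measurable borel"
proof -
  have "(\<lambda>g. f (g, n)) \<in> borel_measurable \<nu>"
    by (rule measurable_compose[OF _ assms]) measurable
  then show ?thesis by (simp cong: measurable_cong_sets)
qed

lemma nn_integral_M:
  assumes f: "f \<in> borel_measurable M"
  shows "(\<integral>\<^sup>+x. f x \<partial>M) = (\<Sum>n. \<integral>\<^sup>+g. f (g, n) \<partial>\<nu>)"
proof -
  interpret sigma_finite_measure N by (rule sigma_finite_N)
  have "(\<integral>\<^sup>+x. f x \<partial>M) = (\<integral>\<^sup>+g. (\<integral>\<^sup>+n. f (g, n) \<partial>N) \<partial>\<nu>)" by (rule nn_integral_fst[OF f, symmetric])
  also have "\<dots> = (\<integral>\<^sup>+g. (\<Sum>n. f (g, n)) \<partial>\<nu>)" by (simp add: nn_integral_count_space_nat)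
  also have "\<dots> = (\<Sum>n. \<integral>\<^sup>+g. f (g, n) \<partial>\<nu>)"
    by (rule nn_integral_suminf) (use borel_measurable_section[OF f] in \<open>simp cong: measurable_cong_sets\<close>)
  finally show ?thesis .
qed

text \<open>The measure space is \<open>G \<times> \<nat>\<close>; its square integrable functions are those in \<open>L\<^sup>2(\<nu>; \<ell>\<^sup>2)\<close>.\<close>

definition shift :: "'g \<Rightarrow> 'g \<times> nat \<Rightarrow> 'g \<times> nat" where
  "shift h x = (- h + fst x, snd x)"

lemma shift_measurable: "shift h \<in> measurable M M"
proof -
  have "(\<lambda>g. - h + g) \<in> measurable \<nu> \<nu>" using measurable_translation_borel by (simp cong: measurable_cong_sets)
  then show ?thesis unfolding shift_def[abs_def] by measurable
qed

lemma quasi_invariant_shift: "quasi_invariant M (shift h) (exp (c * dist h 0))"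
  unfolding quasi_invariant_def
proof (intro conjI ballI shift_measurable)
  fix u :: "'g \<times> nat \<Rightarrow> ennreal" assume u: "u \<in> borel_measurable M"
  have "(\<integral>\<^sup>+x. u (shift h x) \<partial>M) = (\<Sum>n. \<integral>\<^sup>+g. u (- h + g, n) \<partial>\<nu>)"
    using nn_integral_M[OF measurable_compose[OF shift_measurable u]] by (simp add: shift_def)
  also have "\<dots> \<le> (\<Sum>n. ennreal (exp (c * dist h 0)) * (\<integral>\<^sup>+g. u (g, n) \<partial>\<nu>))"
    by (intro suminf_le nn_integral_weighted_translate borel_measurable_section[OF u]) auto
  also have "\<dots> = ennreal (exp (c * dist h 0)) * (\<integral>\<^sup>+x. u x \<partial>M)"
    by (simp add: nn_integral_M[OF u] ennreal_suminf_cmult)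
  finally show "(\<integral>\<^sup>+x. u (shift h x) \<partial>M) \<le> ennreal (exp (c * dist h 0)) * (\<integral>\<^sup>+x. u x \<partial>M)" .
qed simp

lemma bounded_action_shift:
  "bounded_action (L2 M) (\<lambda>h. composition_op M (shift h)) (\<lambda>h. exp (c / 2 * dist h 0))"
proof (intro bounded_action.intro pre_hilbert_L2 bounded_action_axioms.intro)
  fix F h
  assume F: "F \<in> carrier (L2 M)"
  note q = quasi_invariant_shift
  show "composition_op M (shift h) F \<in> carrier (L2 M)" by (rule composition_op_closed[OF q F])
  show "composition_op M (shift h) (k \<odot>\<^bsub>L2 M\<^esub> F) = k \<odot>\<^bsub>L2 M\<^esub> composition_op M (shift h) F" for k
    by (rule composition_op_smult[OF q F])
  have "sqrt (exp (c * dist h 0)) = exp (c / 2 * dist h 0)"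
    by (rule real_sqrt_unique) (simp_all add: power2_eq_square exp_add[symmetric])
  then show "hnorm (L2 M) (composition_op M (shift h) F) \<le> exp (c / 2 * dist h 0) * hnorm (L2 M) F"
    using composition_op_norm[OF q F, of h] by simp
  obtain f where f: "f \<in> square_integrable M" and Ff: "F = ae_class M f" using F by (auto simp: L2_carrier_simp)
  show "composition_op M (shift 0) F = F"
    unfolding Ff composition_op_class[OF q f] by (simp add: shift_def)
  show "composition_op M (shift h) (composition_op M (shift k) F) = composition_op M (shift (h + k)) F" for k
  proof -
    have "- (h + k) + g = - k + (- h + g)" for g by (metis add.assoc minus_add)
    then show ?thesis
      unfolding Ff composition_op_class[OF q f] composition_op_class[OF q square_integrable_compose(1)[OF q f]]
      by (simp add: shift_def)
  qed
next
  show "composition_op M (shift h) (F \<oplus>\<^bsub>L2 M\<^esub> G) = composition_op M (shift h) F \<oplus>\<^bsub>L2 M\<^esub> composition_op M (shift h) G"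
    if "F \<in> carrier (L2 M)" "G \<in> carrier (L2 M)" for F G h
    by (rule composition_op_add[OF quasi_invariant_shift that])
  show "continuous_on UNIV (\<lambda>h::'g. exp (c / 2 * dist h 0))" by (intro continuous_intros)
  show "\<exists>F\<in>carrier (L2 M). (\<lambda>n::nat. hdist (L2 M) (\<sigma> n) F) \<longlonglongrightarrow> 0"
    if "range \<sigma> \<subseteq> carrier (L2 M)" "\<And>e. e > 0 \<Longrightarrow> \<exists>N. \<forall>m\<ge>N. \<forall>n\<ge>N. hdist (L2 M) (\<sigma> m) (\<sigma> n) < e" for \<sigma>
    by (rule L2_Cauchy_convergent[OF that])
qed simp

interpretation act: bounded_action "L2 M" "\<lambda>h. composition_op M (shift h)" "\<lambda>h. exp (c / 2 * dist h 0)"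
  by (rule bounded_action_shift)

lemma continuous_borel: "continuous_on UNIV f \<Longrightarrow> f \<in> borel_measurable (borel :: 'g measure)"
  by (rule borel_measurable_continuous_onI)

context
  fixes p :: "nat \<Rightarrow> 'g \<Rightarrow> complex" and C :: real
  assumes p_cont: "\<And>n. continuous_on UNIV (p n)"
    and p_bound: "\<And>K x. (\<Sum>n<K. (cmod (p n x))\<^sup>2) \<le> C"
begin

definition column :: "'g \<Rightarrow> 'g \<times> nat \<Rightarrow> complex" where
  "column x z = p (snd z) (- fst z + x)"

lemma p_translate_cont: "continuous_on UNIV (\<lambda>g. p n (- g + x))"
  by (rule continuous_on_compose2[OF p_cont]) (auto intro!: continuous_intros)

lemma p_translate_meas: "(\<lambda>g. p n (- g + x)) \<in> borel_measurable borel"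
  by (rule continuous_borel[OF p_translate_cont])

lemma p_translate_meas_weighted: "(\<lambda>g. p n (- g + x)) \<in> borel_measurable \<nu>"
  using p_translate_meas by (simp cong: measurable_cong_sets)

lemma column_measurable: "column x \<in> borel_measurable M"
  by (rule borel_measurable_M) (simp add: column_def p_translate_meas)

lemma column_nn_integral: "(\<integral>\<^sup>+z. ennreal ((cmod (column x z))\<^sup>2) \<partial>M) \<le> ennreal C"
proof -
  note [measurable] = p_translate_meas_weighted
  have "(\<lambda>z. ennreal ((cmod (column x z))\<^sup>2)) \<in> borel_measurable M" using column_measurable by measurable
  then have "(\<integral>\<^sup>+z. ennreal ((cmod (column x z))\<^sup>2) \<partial>M) = (\<Sum>n. \<integral>\<^sup>+g. ennreal ((cmod (p n (- g + x)))\<^sup>2) \<partial>\<nu>)"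
    by (simp add: nn_integral_M column_def)
  also have "\<dots> = (\<integral>\<^sup>+g. (\<Sum>n. ennreal ((cmod (p n (- g + x)))\<^sup>2)) \<partial>\<nu>)"
    by (rule nn_integral_suminf[symmetric]) measurable
  also have "\<dots> \<le> (\<integral>\<^sup>+g. ennreal C \<partial>\<nu>)"
  proof (rule nn_integral_mono)
    fix g
    note s = summable_square_bounded[of "\<lambda>n. p n (- g + x)", OF p_bound]
    have "(\<Sum>n. ennreal ((cmod (p n (- g + x)))\<^sup>2)) = ennreal (\<Sum>n. (cmod (p n (- g + x)))\<^sup>2)"
      by (rule suminf_ennreal2[OF _ s(1)]) simp
    then show "(\<Sum>n. ennreal ((cmod (p n (- g + x)))\<^sup>2)) \<le> ennreal C" using s(2) by (simp add: ennreal_leI)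
  qed
  also have "\<dots> = ennreal C" by (simp add: emeasure_weighted)
  finally show ?thesis .
qed

lemma column_square_integrable: "column x \<in> square_integrable M"
  unfolding square_integrable_iff_nn_integral
  using column_measurable column_nn_integral[of x] by (auto intro: le_less_trans)

lemma shift_column: "composition_op M (shift x) (ae_class M (column 0)) = ae_class M (column x)"
  unfolding composition_op_class[OF quasi_invariant_shift column_square_integrable]
  by (simp add: column_def[abs_def] shift_def minus_add)

lemma C_ge_0: "0 \<le> C" using p_bound[of _ 0] by simp

lemma hnorm_column: "hnorm (L2 M) (ae_class M (column x)) \<le> sqrt C"
  by (rule hnorm_L2_le[OF column_square_integrable]) (simp_all add: C_ge_0 column_nn_integral)

definition single :: "nat \<Rightarrow> 'g \<times> nat \<Rightarrow> complex" where
  "single m z = (if snd z = m then p m (- fst z) else 0)"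

lemma single_measurable: "single m \<in> borel_measurable M"
proof (rule borel_measurable_M)
  show "(\<lambda>g. single m (g, n)) \<in> borel_measurable borel" for n
    using p_translate_meas[of m 0] by (cases "n = m") (simp_all add: single_def)
qed

lemma p_le_C: "(cmod (p n x))\<^sup>2 \<le> C"
proof -
  have "(cmod (p n x))\<^sup>2 \<le> (\<Sum>i<Suc n. (cmod (p i x))\<^sup>2)" by (rule member_le_sum) auto
  then show ?thesis using p_bound order_trans by blast
qed

lemma single_square_integrable: "single m \<in> square_integrable M"
proof -
  have "(\<integral>\<^sup>+z. ennreal ((cmod (single m z))\<^sup>2) \<partial>M) \<le> (\<integral>\<^sup>+z. ennreal ((cmod (column 0 z))\<^sup>2) \<partial>M)"
    by (rule nn_integral_mono) (simp add: single_def column_def)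
  then show ?thesis
    using column_square_integrable[of 0] single_measurable
    unfolding square_integrable_iff_nn_integral by (auto intro: le_less_trans)
qed

text \<open>Dominated convergence, the integrand being bounded and the weighted measure finite.\<close>

lemma single_continuity: "ae_class M (single m) \<in> act.continuity_vectors"
  unfolding act.continuity_vectors_def
proof (intro CollectI conjI allI)
  show "ae_class M (single m) \<in> carrier (L2 M)" by (simp add: single_square_integrable)
  note q = quasi_invariant_shift
  fix h
  let ?d = "\<lambda>k. hdist (L2 M) (composition_op M (shift k) (ae_class M (single m))) (composition_op M (shift h) (ae_class M (single m)))"
  note [measurable] = p_translate_meas_weighted
  have sq: "(\<lambda>z. single m (shift k z)) \<in> square_integrable M" for k
    by (rule square_integrable_compose(1)[OF q single_square_integrable])
  have d: "ennreal ((?d k)\<^sup>2) = (\<integral>\<^sup>+g. ennreal ((cmod (p m (- g + k) - p m (- g + h)))\<^sup>2) \<partial>\<nu>)" for k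
  proof -
    have "ennreal ((?d k)\<^sup>2) = (\<integral>\<^sup>+z. ennreal ((cmod (single m (shift k z) - single m (shift h z)))\<^sup>2) \<partial>M)"
      unfolding composition_op_class[OF q single_square_integrable] hdist_L2[OF sq sq]
      by (rule nn_integral_hnorm_L2[symmetric, OF square_integrable_diff[OF sq sq]])
    also have "\<dots> = (\<Sum>n. \<integral>\<^sup>+g. ennreal ((cmod (single m (shift k (g, n)) - single m (shift h (g, n))))\<^sup>2) \<partial>\<nu>)"
      using square_integrable_measurable[OF sq] by (intro nn_integral_M) measurable
    also have "\<dots> = (\<Sum>n\<in>{m}. \<integral>\<^sup>+g. ennreal ((cmod (single m (shift k (g, n)) - single m (shift h (g, n))))\<^sup>2) \<partial>\<nu>)"
      by (rule suminf_finite) (simp_all add: single_def shift_def)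
    finally show ?thesis by (simp add: single_def shift_def minus_add)
  qed
  have d0: "0 \<le> ?d k" for k
    by (intro L2.hdist_nonneg composition_op_closed[OF q]) (simp_all add: single_square_integrable)
  show "(?d \<longlongrightarrow> 0) (at h)"
    unfolding tendsto_at_iff_sequentially
  proof (intro allI impI)
    fix X :: "nat \<Rightarrow> 'g" assume X: "X \<longlonglongrightarrow> h"
    have "(\<lambda>i. \<integral>\<^sup>+g. ennreal ((cmod (p m (- g + X i) - p m (- g + h)))\<^sup>2) \<partial>\<nu>) \<longlonglongrightarrow> (\<integral>\<^sup>+g. 0 \<partial>\<nu>)"
    proof (rule nn_integral_dominated_convergence[where w = "\<lambda>_. ennreal (4 * C)"])
      show "AE g in \<nu>. ennreal ((cmod (p m (- g + X i) - p m (- g + h)))\<^sup>2) \<le> ennreal (4 * C)" for i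
      proof (rule AE_I2, rule ennreal_leI)
        fix g
        show "(cmod (p m (- g + X i) - p m (- g + h)))\<^sup>2 \<le> 4 * C"
          using norm_add_power2_le[of "p m (- g + X i)" "- p m (- g + h)"]
            p_le_C[of m "- g + X i"] p_le_C[of m "- g + h"] by simp
      qed
      show "(\<integral>\<^sup>+g. ennreal (4 * C) \<partial>\<nu>) < \<infinity>" by (simp add: emeasure_weighted)
      show "AE g in \<nu>. (\<lambda>i. ennreal ((cmod (p m (- g + X i) - p m (- g + h)))\<^sup>2)) \<longlonglongrightarrow> 0"
      proof (rule AE_I2)
        fix g
        have "isCont (p m) (- g + h)" using p_cont by (simp add: continuous_on_eq_continuous_at)
        then have "(\<lambda>i. p m (- g + X i)) \<longlonglongrightarrow> p m (- g + h)"
          by (rule isCont_tendsto_compose) (intro tendsto_intros X)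
        then have "(\<lambda>i. ennreal ((cmod (p m (- g + X i) - p m (- g + h)))\<^sup>2)) \<longlonglongrightarrow> ennreal ((cmod (p m (- g + h) - p m (- g + h)))\<^sup>2)"
          by (intro tendsto_intros tendsto_ennrealI)
        then show "(\<lambda>i. ennreal ((cmod (p m (- g + X i) - p m (- g + h)))\<^sup>2)) \<longlonglongrightarrow> 0" by simp
      qed
      show "(\<lambda>g. ennreal ((cmod (p m (- g + X i) - p m (- g + h)))\<^sup>2)) \<in> borel_measurable \<nu>" for i
        by measurable
    qed simp_all
    then have "(\<lambda>i. ennreal ((?d (X i))\<^sup>2)) \<longlonglongrightarrow> ennreal 0" by (simp add: d)
    then have "(\<lambda>i. (?d (X i))\<^sup>2) \<longlonglongrightarrow> 0" by (subst (asm) tendsto_ennreal_iff) auto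
    then have "(\<lambda>i. sqrt ((?d (X i))\<^sup>2)) \<longlonglongrightarrow> sqrt 0" by (rule tendsto_real_sqrt)
    then show "(?d \<circ> X) \<longlonglongrightarrow> 0" using d0 by (simp add: o_def)
  qed
qed

definition truncated :: "nat \<Rightarrow> 'g \<times> nat \<Rightarrow> complex" where
  "truncated K z = (if snd z < K then p (snd z) (- fst z) else 0)"

lemma truncated_eq_sum: "truncated K = (\<lambda>z. \<Sum>m<K. single m z)"
  by (auto simp: truncated_def single_def fun_eq_iff)

lemma truncated_square_integrable: "truncated K \<in> square_integrable M"
  unfolding truncated_eq_sum by (intro square_integrable_sum single_square_integrable)

lemma truncated_continuity: "ae_class M (truncated K) \<in> act.continuity_vectors"
proof (induction K)
  case 0
  then show ?case using act.zero_continuity by (simp add: truncated_eq_sum L2_zero)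
next
  case (Suc K)
  have "ae_class M (truncated (Suc K)) = ae_class M (truncated K) \<oplus>\<^bsub>L2 M\<^esub> ae_class M (single K)"
    by (simp add: L2_add truncated_square_integrable single_square_integrable) (simp add: truncated_eq_sum)
  then show ?case using act.add_continuity[OF Suc single_continuity] by simp
qed

text \<open>The column is the limit of its truncations, which are finite sums of vectors with continuous
  orbits.\<close>

lemma column_continuity: "ae_class M (column 0) \<in> act.continuity_vectors"
proof (rule act.continuity_vectors_closed[OF truncated_continuity])
  show "ae_class M (column 0) \<in> carrier (L2 M)" by (simp add: column_square_integrable)
  note [measurable] = p_translate_meas_weighted
  define t where "t n = enn2real (\<integral>\<^sup>+g. ennreal ((cmod (p n (- g + 0)))\<^sup>2) \<partial>\<nu>)" for n
  have tfin: "(\<integral>\<^sup>+g. ennreal ((cmod (p n (- g + 0)))\<^sup>2) \<partial>\<nu>) = ennreal (t n)" for n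
  proof -
    have "(\<integral>\<^sup>+g. ennreal ((cmod (p n (- g + 0)))\<^sup>2) \<partial>\<nu>) \<le> (\<integral>\<^sup>+g. ennreal C \<partial>\<nu>)"
      by (intro nn_integral_mono ennreal_leI p_le_C)
    also have "\<dots> < \<infinity>" by (simp add: emeasure_weighted)
    finally show ?thesis by (simp add: t_def)
  qed
  have t0: "0 \<le> t n" for n by (simp add: t_def)
  have "(\<Sum>n. ennreal (t n)) \<le> ennreal C"
  proof -
    have "(\<lambda>z. ennreal ((cmod (column 0 z))\<^sup>2)) \<in> borel_measurable M" using column_measurable by measurable
    then have "(\<integral>\<^sup>+z. ennreal ((cmod (column 0 z))\<^sup>2) \<partial>M) = (\<Sum>n. ennreal (t n))"
      by (simp add: nn_integral_M tfin[symmetric] column_def)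
    then show ?thesis using column_nn_integral[of 0] by simp
  qed
  then have "(\<Sum>n. ennreal (t n)) < \<infinity>" by (rule le_less_trans) simp
  then have "(\<Sum>n. ennreal (t n)) \<noteq> \<infinity>" by simp
  then have ts: "summable t" by (intro summable_suminf_not_top) (auto simp: t0)
  have d: "(hdist (L2 M) (ae_class M (truncated K)) (ae_class M (column 0)))\<^sup>2 = (\<Sum>n. t (n + K))" for K
  proof -
    note sq = square_integrable_diff[OF truncated_square_integrable column_square_integrable, of K 0]
    have ts': "summable (\<lambda>n. t (n + K))" by (rule summable_ignore_initial_segment[OF ts])
    have "ennreal ((hdist (L2 M) (ae_class M (truncated K)) (ae_class M (column 0)))\<^sup>2)
        = (\<integral>\<^sup>+z. ennreal ((cmod (truncated K z - column 0 z))\<^sup>2) \<partial>M)"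
      unfolding hdist_L2[OF truncated_square_integrable column_square_integrable]
      by (rule nn_integral_hnorm_L2[OF sq, symmetric])
    also have "\<dots> = (\<Sum>n. \<integral>\<^sup>+g. ennreal ((cmod (truncated K (g, n) - column 0 (g, n)))\<^sup>2) \<partial>\<nu>)"
    proof (rule nn_integral_M)
      note [measurable] = square_integrable_measurable[OF truncated_square_integrable] column_measurable
      show "(\<lambda>z. ennreal ((cmod (truncated K z - column 0 z))\<^sup>2)) \<in> borel_measurable M" by measurable
    qed
    also have "\<dots> = (\<Sum>n. ennreal (if n < K then 0 else t n))"
    proof (rule suminf_cong)
      show "(\<integral>\<^sup>+g. ennreal ((cmod (truncated K (g, n) - column 0 (g, n)))\<^sup>2) \<partial>\<nu>) = ennreal (if n < K then 0 else t n)" for n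
        by (simp add: truncated_def column_def tfin[symmetric])
    qed
    also have "\<dots> = ennreal (\<Sum>n. if n < K then 0 else t n)"
      by (rule suminf_ennreal2) (auto simp: t0 intro!: summable_comparison_test'[OF ts])
    also have "(\<Sum>n. if n < K then 0 else t n) = (\<Sum>n. t (n + K))"
    proof -
      have s: "summable (\<lambda>n. if n < K then 0 else t n)"
        by (rule summable_comparison_test'[OF ts]) (simp add: t0)
      show ?thesis using suminf_split_initial_segment[OF s, of K] by simp
    qed
    finally show ?thesis by (simp add: suminf_nonneg[OF ts'] t0)
  qed
  have "(\<lambda>K. \<Sum>n. t (n + K)) \<longlonglongrightarrow> 0" by (rule suminf_exist_split2[OF ts])
  then have "(\<lambda>K. (hdist (L2 M) (ae_class M (truncated K)) (ae_class M (column 0)))\<^sup>2) \<longlonglongrightarrow> 0" by (simp add: d)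
  from tendsto_real_sqrt[OF this]
  show "(\<lambda>K. hdist (L2 M) (ae_class M (truncated K)) (ae_class M (column 0))) \<longlonglongrightarrow> 0"
    by (simp add: truncated_square_integrable column_square_integrable)
qed

end

text \<open>For every fixed \<open>g\<close> the sum over the coordinates has the same value \<open>s\<close>, and the weighted measure
  is a probability measure.\<close>

lemma hinner_columns:
  assumes p: "\<And>n. continuous_on UNIV (p n)" "\<And>K x. (\<Sum>n<K. (cmod (p n x))\<^sup>2) \<le> C"
    and q: "\<And>n. continuous_on UNIV (q n)" "\<And>K x. (\<Sum>n<K. (cmod (q n x))\<^sup>2) \<le> C"
    and eq: "\<And>g. (\<Sum>n. p n (- g + x) * cnj (q n (- g + y))) = s"
  shows "hinner (L2 M) (ae_class M (column p x)) (ae_class M (column q y)) = s"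
proof -
  interpret finite_measure \<nu> by (rule finite_measure_weighted)
  interpret pair_sigma_finite \<nu> N
    by (intro pair_sigma_finite.intro sigma_finite_N sigma_finite_measure_axioms)
  note sp = column_square_integrable[OF p] and sq = column_square_integrable[OF q]
  have "hinner (L2 M) (ae_class M (column p x)) (ae_class M (column q y)) = (\<integral>z. column p x z * cnj (column q y z) \<partial>M)"
    by (rule L2_hinner[OF sp sq])
  also have "\<dots> = (\<integral>g. (\<integral>n. column p x (g, n) * cnj (column q y (g, n)) \<partial>N) \<partial>\<nu>)"
    by (rule integral_fst'[OF integrable_mult_cnj[OF sp sq], symmetric])
  also have "\<dots> = (\<integral>g. s \<partial>\<nu>)"
  proof (rule Bochner_Integration.integral_cong[OF refl])
    fix g
    have "summable (\<lambda>n. cmod (p n (- g + x) * cnj (q n (- g + y))))"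
      by (rule summable_norm_mult_square)
        (use summable_square_bounded(1)[OF p(2)] summable_square_bounded(1)[OF q(2)] in simp_all)
    then have "integrable N (\<lambda>n. p n (- g + x) * cnj (q n (- g + y)))"
      by (simp add: integrable_count_space_nat_iff)
    then show "(\<integral>n. column p x (g, n) * cnj (column q y (g, n)) \<partial>N) = s"
      by (simp add: column_def[OF p] column_def[OF q] integral_count_space_nat eq)
  qed
  also have "\<dots> = s" by (simp add: measure_def emeasure_weighted)
  finally show ?thesis .
qed

lemma representation_from_factorization:
  fixes p q :: "nat \<Rightarrow> 'g \<Rightarrow> complex"
  assumes p: "\<And>n. continuous_on UNIV (p n)" "\<And>K x. (\<Sum>n<K. (cmod (p n x))\<^sup>2) \<le> C"
    and q: "\<And>n. continuous_on UNIV (q n)" "\<And>K x. (\<Sum>n<K. (cmod (q n x))\<^sup>2) \<le> C"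
    and factor: "\<And>x y. \<phi> (- y + x) = (\<Sum>n. p n x * cnj (q n y))"
  shows "\<exists>(H :: ('g \<times> nat \<Rightarrow> complex) set hilbert) \<pi> \<xi> \<eta>.
        hilbert_space H \<and> strongly_continuous_rep H \<pi> \<and> \<xi> \<in> carrier H \<and> \<eta> \<in> carrier H \<and>
        (\<forall>x y. \<phi> (- y + x) = hinner H (\<pi> x \<xi>) (\<pi> y \<eta>)) \<and>
        (\<forall>x. hnorm H (\<pi> x \<xi>) \<le> sqrt C) \<and> (\<forall>y. hnorm H (\<pi> y \<eta>) \<le> sqrt C) \<and>
        (\<forall>g. op_norm H (\<pi> g) \<le> exp (c / 2 * dist g 0))"
proof (intro exI conjI allI)
  let ?\<xi> = "ae_class M (column p 0)" and ?\<eta> = "ae_class M (column q 0)"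
  note cp = column_continuity[OF p] and cq = column_continuity[OF q]
  have rp: "act.rep_of x ?\<xi> = ae_class M (column p x)" for x
    using cp by (simp add: act.rep_of_def shift_column[OF p])
  have rq: "act.rep_of y ?\<eta> = ae_class M (column q y)" for y
    using cq by (simp add: act.rep_of_def shift_column[OF q])
  show "hilbert_space act.HC" by (rule act.cv.hilbert_space_restrict)
  show "strongly_continuous_rep act.HC act.rep_of" by (rule act.strongly_continuous_rep_of)
  show "?\<xi> \<in> carrier act.HC" "?\<eta> \<in> carrier act.HC" using cp cq by simp_all
  show "op_norm act.HC (act.rep_of g) \<le> exp (c / 2 * dist g 0)" for g by (rule act.op_norm_rep_of)
  show "hnorm act.HC (act.rep_of x ?\<xi>) \<le> sqrt C" for x using hnorm_column[OF p, of x] by (simp add: rp)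
  show "hnorm act.HC (act.rep_of y ?\<eta>) \<le> sqrt C" for y using hnorm_column[OF q, of y] by (simp add: rq)
  fix x y
  have "(\<Sum>n. p n (- g + x) * cnj (q n (- g + y))) = \<phi> (- y + x)" for g
  proof -
    have "- (- g + y) + (- g + x) = - y + x" by (simp add: minus_add add.assoc[symmetric])
    then show ?thesis using factor[of "- g + y" "- g + x"] by simp
  qed
  from hinner_columns[OF p q this]
  show "\<phi> (- y + x) = hinner act.HC (act.rep_of x ?\<xi>) (act.rep_of y ?\<eta>)" by (simp add: rp rq)
qed

end

lemma herz_schur_factorization:
  fixes \<phi> :: "'g::{topological_group_add, second_countable_topology} \<Rightarrow> complex"
  assumes "schur_bounded (\<lambda>x y. \<phi> (- y + x)) C" "0 \<le> C" and cont: "continuous_on UNIV \<phi>"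
  obtains p q :: "nat \<Rightarrow> 'g \<Rightarrow> complex" where
    "\<And>n. continuous_on UNIV (p n)" "\<And>K x. (\<Sum>n<K. (cmod (p n x))\<^sup>2) \<le> C"
    "\<And>n. continuous_on UNIV (q n)" "\<And>K y. (\<Sum>n<K. (cmod (q n y))\<^sup>2) \<le> C"
    "\<And>x y. \<phi> (- y + x) = (\<Sum>n. p n x * cnj (q n y))"
proof (rule schur_bounded_continuous_factorization[OF assms(1,2)])
  show "continuous_on UNIV (\<lambda>x. \<phi> (- y + x))" for y
    by (rule continuous_on_compose2[OF cont]) (auto intro!: continuous_intros)
  show "continuous_on UNIV (\<lambda>y. \<phi> (- y + x))" for x
    by (rule continuous_on_compose2[OF cont]) (auto intro!: continuous_intros)
qed (rule that, assumption+)

theorem corollary1p4: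
  fixes \<phi> :: "'g::{topological_group_add, metric_space, second_countable_topology} \<Rightarrow> complex"
    and \<mu> :: "'g measure"
    and a b :: real
  assumes loc_compact: "locally_compact_space (euclidean :: 'g topology)"
    and herz_schur: "herz_schur_multiplier \<phi>"
    and left_invariant: "\<And>g x y :: 'g. dist (g + x) (g + y) = dist x y"
    and proper: "\<And>(x :: 'g) r. compact (cball x r)"
    and haar: "left_haar_measure \<mu>"
    and "a > 0" and "b > 0"
    and growth: "\<And>n :: nat. emeasure \<mu> (ball 0 (real n)) \<le> ennreal (a * exp (b * real n))"
  shows
    "(\<exists>(H :: ('g \<times> nat \<Rightarrow> complex) set hilbert) \<pi> \<xi> \<eta>.
        hilbert_space H \<and> strongly_continuous_rep H \<pi> \<and> \<xi> \<in> carrier H \<and> \<eta> \<in> carrier H \<and>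
        (\<forall>x y. \<phi> (- y + x) = hinner H (\<pi> x \<xi>) (\<pi> y \<eta>)) \<and>
        (\<forall>x. hnorm H (\<pi> x \<xi>) \<le> sqrt 2 * sqrt (M0A_norm \<mu> \<phi>)) \<and>
        (\<forall>y. hnorm H (\<pi> y \<eta>) \<le> sqrt 2 * sqrt (M0A_norm \<mu> \<phi>))) \<and>
     (\<forall>c>b. \<exists>(H :: ('g \<times> nat \<Rightarrow> complex) set hilbert) \<pi> \<xi> \<eta>.
        hilbert_space H \<and> strongly_continuous_rep H \<pi> \<and> \<xi> \<in> carrier H \<and> \<eta> \<in> carrier H \<and>
        (\<forall>x y. \<phi> (- y + x) = hinner H (\<pi> x \<xi>) (\<pi> y \<eta>)) \<and>
        (\<forall>x. hnorm H (\<pi> x \<xi>) \<le> sqrt 2 * sqrt (M0A_norm \<mu> \<phi>)) \<and>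
        (\<forall>y. hnorm H (\<pi> y \<eta>) \<le> sqrt 2 * sqrt (M0A_norm \<mu> \<phi>)) \<and>
        (\<forall>g. op_norm H (\<pi> g) \<le> exp (c / 2 * dist g 0)))"
proof -
  have cont: "continuous_on UNIV \<phi>" and sm: "schur_multiplier (\<lambda>x y. \<phi> (- y + x))"
    using herz_schur by (simp_all add: herz_schur_multiplier_def)
  have "- (g + y) + (g + x) = - y + x" for g x y :: 'g by (simp add: minus_add add.assoc[symmetric])
  then obtain C where C: "0 \<le> C" "schur_bounded (\<lambda>x y. \<phi> (- y + x)) C"
    using schur_multiplier_schur_bounded[OF sm] by auto
  have "\<exists>\<Phi>. fourier_multiplier_map \<mu> \<phi> \<Phi>"
    by (rule herz_schur_factorization[OF C(2,1) cont], rule fourier_multiplier_map_exists[OF haar])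
  then have \<Phi>: "fourier_multiplier_map \<mu> \<phi> (SOME \<Phi>. fourier_multiplier_map \<mu> \<phi> \<Phi>)" by (rule someI_ex)
  obtain f0 where f0: "f0 \<in> square_integrable \<mu>" "hnorm (L2 \<mu>) (ae_class \<mu> f0) = 1"
    using unit_vector_exists[OF haar proper] by blast
  define m where "m = M0A_norm \<mu> \<phi>"
  have m: "schur_bounded (\<lambda>x y. \<phi> (- y + x)) m" "0 \<le> m"
    unfolding m_def M0A_norm_def by (rule fourier_multiplier_schur_bounded[OF haar \<Phi> f0])+
  have le: "sqrt m \<le> sqrt 2 * sqrt m" using m(2) by (simp add: mult_le_cancel_right1)
  have ex: "\<exists>(H :: ('g \<times> nat \<Rightarrow> complex) set hilbert) \<pi> \<xi> \<eta>.
        hilbert_space H \<and> strongly_continuous_rep H \<pi> \<and> \<xi> \<in> carrier H \<and> \<eta> \<in> carrier H \<and>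
        (\<forall>x y. \<phi> (- y + x) = hinner H (\<pi> x \<xi>) (\<pi> y \<eta>)) \<and>
        (\<forall>x. hnorm H (\<pi> x \<xi>) \<le> sqrt 2 * sqrt m) \<and>
        (\<forall>y. hnorm H (\<pi> y \<eta>) \<le> sqrt 2 * sqrt m) \<and>
        (\<forall>g. op_norm H (\<pi> g) \<le> exp (c / 2 * dist g 0))" if c: "b < c" for c
  proof -
    have c0: "0 < c" using c \<open>b > 0\<close> by simp
    note fw = nn_integral_exp_dist_finite[OF haar growth \<open>a > 0\<close> c c0]
    obtain p q :: "nat \<Rightarrow> 'g \<Rightarrow> complex" where
      pq: "\<And>n. continuous_on UNIV (p n)" "\<And>K x. (\<Sum>n<K. (cmod (p n x))\<^sup>2) \<le> m"
      "\<And>n. continuous_on UNIV (q n)" "\<And>K y. (\<Sum>n<K. (cmod (q n y))\<^sup>2) \<le> m"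
      "\<And>x y. \<phi> (- y + x) = (\<Sum>n. p n x * cnj (q n y))"
      using herz_schur_factorization[OF m cont] by blast
    from representation_from_factorization[OF haar left_invariant c0 fw pq]
    obtain H :: "('g \<times> nat \<Rightarrow> complex) set hilbert" and \<pi> \<xi> \<eta> where H: "hilbert_space H"
      "strongly_continuous_rep H \<pi>" "\<xi> \<in> carrier H" "\<eta> \<in> carrier H"
      "\<forall>x y. \<phi> (- y + x) = hinner H (\<pi> x \<xi>) (\<pi> y \<eta>)"
      and b1: "\<forall>x. hnorm H (\<pi> x \<xi>) \<le> sqrt m" and b2: "\<forall>y. hnorm H (\<pi> y \<eta>) \<le> sqrt m"
      and b3: "\<forall>g. op_norm H (\<pi> g) \<le> exp (c / 2 * dist g 0)" by blast
    have "\<forall>x. hnorm H (\<pi> x \<xi>) \<le> sqrt 2 * sqrt m" "\<forall>y. hnorm H (\<pi> y \<eta>) \<le> sqrt 2 * sqrt m"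
      using order_trans[OF b1[rule_format] le] order_trans[OF b2[rule_format] le] by blast+
    with H b3 show ?thesis by blast
  qed
  have "b < b + 1" by simp
  from ex[OF this] ex show ?thesis unfolding m_def by blast
qed

end
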